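(* Let $\widetilde A_\ell$, $f_L=B_L\Gamma^{-1}y$, $F_L$ arise from the Bayesian problem described in the context, where $n_L$ is the number of unknowns. Consider the MGMC V-cycle ($\gamma_\ell=1$) for $\widetilde A_L,f_L$ with $\nu_1=\nu_2=\nu/2$ for an even integer $\nu>0$, an exact sampler on level $0$, and the same symmetric splitting matrix $\widetilde M_\ell=\widetilde M_\ell^\top$ for pre- and post-smoothing on each level $\ell\geq 1$, such that $0<\widetilde A_\ell\le\widetilde M_\ell$ for all $\ell\ge1$ and $$\|\widetilde M_\ell^{1/2}(\widetilde A_\ell^{-1}-I_{\ell-1}^\ell\widetilde A_{\ell-1}^{-1}I_\ell^{\ell-1})\widetilde M_\ell^{1/2}\|_2\le C_A\quad\text{for all }\ell\ge1$$ with $C_A>0$ independent of $\ell$. Assume that $\theta_L^{(0)}$ is drawn from a multivariate normal distribution with $$\max\{\|\widetilde A_L^{1/2}\mathbb E[\theta_L^{(0)}]\|_2,\ \|\widetilde A_L^{1/2}\mathrm{Cov}(\theta_L^{(0)})\widetilde A_L^{1/2}\|_2\}\le C_0$$ for a constant $C_0$ independent of $n_L$, and let $\theta_L^{(m+1)}=\mathrm{MGMC}_L(\widetilde A_L,f_L,\theta_L^{(m)})$. Then: 1. The cost of generating a new sample $\theta_L^{(m+1)}$ from $\theta_L^{(m)}$ is bounded by a constant (independent of $L$) times $n_L$ as $n_L\to\infty$. 2. The integrated autocorrelation time $\tau^{(m)}_{\mathrm{int},F_L}$ of $F_L^\top\theta_L^{(m)}$ ($m\ge1$) is bounded by a constant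 that is independent of $n_L$. 3. The mean and variance of $F_L^\top\theta_L^{(m)}$ differ from those of the target distribution by a constant that is independent of $n_L$, and the convergence is exponential: for all $m\ge 0$ $$\bigl|\mathbb E[F_L^\top\theta_L^{(m)}]-F_L^\top\widetilde A_L^{-1}f_L\bigr|\le C_{1,1}e^{-C_2m},\qquad\bigl|\mathrm{Var}(F_L^\top\theta_L^{(m)})-F_L^\top\widetilde A_L^{-1}F_L\bigr|\le C_{1,2}e^{-2C_2m},$$ where $C_{1,1},C_{1,2}$ and $C_2=\log(C_A+\nu)-\log(C_A)$ are positive constants independent of $n_L$. Furthermore, suppose that there is a subspace $W\subset V$ with norm $\|\cdot\|_W$ such that (a) for some $C_{\mathcal A}>0$ and every $g\in H$ the solution $u\in V$ of $a(u,\varphi)=\langle g,\varphi\rangle_H$ for all $\varphi\in V$ lies in $W$ with $\|u\|_W\le C_{\mathcal A}\|g\|_H$, and (b) $\inf_{w_\ell\in V_\ell}\|w-w_\ell\|_V\le\sqrt{\Psi(\ell)}\|w\|_W$ for all $w\in W$ with a decreasing $\Psi:\mathbb N_0\to[0,\infty)$, $\Psi(\ell)\to0$. Then the sequence $(F_L^\top\theta_L^* )_{L\in\mathbb N}$ with $\theta_L^*\sim\mathcal N(\widetilde A_L^{-1}f_L,\widetilde A_L^{-1})$ converges in distribution to a real-valued Gaussian random variable with mean $\langle\chi,\mu\rangle_H$ and variance $\langle\chi,\widetilde{\mathcal A}^{-1}\chi\rangle_H$.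
   Context: Setting: $H$ is a real separable Hilbert space; $\mathcal A$ is a self-adjoint positive definite (possibly unbounded) operator on $H$ with compact inverse (not necessarily trace class); $V:=D(\mathcal A^{1/2})$, $a(\zeta,\varphi)=\langle\mathcal A^{1/2}\zeta,\mathcal A^{1/2}\varphi\rangle_H$, $\|v\|_V=a(v,v)^{1/2}$. $V_0\subset V_1\subset\dots\subset V$ are nested finite-dimensional subspaces, $\dim V_\ell=n_\ell$, bases $\{\phi_j^\ell\}_{j=1}^{n_\ell}$, $P_\ell x=\sum_jx^j\phi_j^\ell$. $(A_\ell)_{jk}=a(\phi_j^\ell,\phi_k^\ell)$; $I_{\ell-1}^\ell$ is the matrix of $P_\ell^{-1}P_{\ell-1}$, $I_\ell^{\ell-1}=(I_{\ell-1}^\ell)^\top$. $\mathcal B:H\to\mathbb R^\beta$ is bounded linear ($\beta$ fixed), $\Gamma\in\mathbb R^{\beta\times\beta}$ symmetric positive definite, $y\in\mathbb R^\beta$ fixed, $(B_\ell)_{jk}=(\mathcal B\phi_j^\ell)_k$, $\widetilde A_\ell=A_\ell+B_\ell\Gamma^{-1}B_\ell^\top$. $\widetilde{\mathcal A}=\mathcal A+\mathcal B^*\Gamma^{-1}\mathcal B$, $\mu=\widetilde{\mathcal A}^{-1}\mathcal B^*\Gamma^{-1}y$. $\mathcal F(\phi)=\langle\phi,\chi\rangle_H$ for fixed $\chi\in H$, $(F_L)_j=\mathcal F(\phi_j^L)$ (with $F_L\ne0$ in item 2). $A\le B$ means $B-A$ is positive semidefinite. Random smoother: $\mathrm{RandomSmoother}(A,M,f,\theta):=\theta+M^{-1}(f+\xi-A\theta)$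 with a fresh $\xi\sim\mathcal N(0,M+M^\top-A)$. MGMC update $\mathrm{MGMC}_\ell(\widetilde A_\ell,f_\ell,\theta_\ell)$ (V-cycle, exact coarse sampler): if $\ell=0$, return a fresh sample from $\mathcal N(\widetilde A_0^{-1}f_0,\widetilde A_0^{-1})$. If $\ell\ge1$: (1) starting from $\theta_\ell$ apply $\nu_1$ times $\theta\mapsto\mathrm{RandomSmoother}(\widetilde A_\ell,\widetilde M_\ell,f_\ell,\theta)$, giving $\theta_{\ell,\nu_1}$; (2) set $f_{\ell-1}:=I_\ell^{\ell-1}(f_\ell-\widetilde A_\ell\theta_{\ell,\nu_1})$, $\psi_{\ell-1}:=\mathrm{MGMC}_{\ell-1}(\widetilde A_{\ell-1},f_{\ell-1},0)$, $\theta_{\ell,\nu_1+1}:=\theta_{\ell,\nu_1}+I_{\ell-1}^\ell\psi_{\ell-1}$; (3) starting from $\theta_{\ell,\nu_1+1}$ apply $\nu_2$ times the same random smoother and return the result. All random variables drawn are mutually independent and independent of $\theta_L^{(0)}$. Integrated autocorrelation time: $\tau^{(m)}_{\mathrm{int},F_L}:=1+2\sum_{s=1}^\infty\frac{\mathrm{Cov}(F_L^\top\theta_L^{(m+s)},F_L^\top\theta_L^{(m)})}{\mathrm{Cov}(F_L^\top\theta_L^{(m)},F_L^\top\theta_L^{(m)})}$. Cost (item 1): number of arithmetic operations per update, excluding one-off precomputations. It is assumed that $n_{\ell-1}\le\rho_Gn_\ell$ with $\rho_G<1$ independent of $\ell$; that $A_\ell$ and $I_{\ell-1}^\ell$ have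 a number of nonzeros per row bounded independently of $\ell$, so that residual computation, restriction and prolongation on level $\ell$ cost $O((1+\beta)n_\ell)$; that one smoother application on level $\ell$ costs at most $c_1\beta^{p_\Gamma}+c_2(1+\beta)n_\ell$ with $c_1,c_2$ independent of $\ell$ ($p_\Gamma=1$ if $\Gamma$ is diagonal, $p_\Gamma=2$ otherwise); and that sampling on level $0$ has a cost depending only on $n_0$. *)

theory Defs
  imports
    "HOL-Probability.Probability"
    "Jordan_Normal_Form.Gauss_Jordan_Elimination"
begin

unbundle no inner_syntax and no vec_syntax

section \<open>Unbounded operators on a real Hilbert space\<close>

text \<open>An operator is a pair of a domain \<open>D\<close> and a total function \<open>T\<close>; the values of \<open>T\<close>
  outside \<open>D\<close> are irrelevant.\<close>

definition densely_defined_op :: "'h::real_inner set \<Rightarrow> ('h \<Rightarrow> 'h) \<Rightarrow> bool" where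
  "densely_defined_op D T \<longleftrightarrow> subspace D \<and> closure D = UNIV \<and>
     (\<forall>x\<in>D. \<forall>y\<in>D. T (x + y) = T x + T y) \<and> (\<forall>c. \<forall>x\<in>D. T (c *\<^sub>R x) = c *\<^sub>R T x)"

definition adjoint_domain :: "'h::real_inner set \<Rightarrow> ('h \<Rightarrow> 'h) \<Rightarrow> 'h set" where
  "adjoint_domain D T = {y. \<exists>z. \<forall>x\<in>D. inner (T x) y = inner x z}"

definition self_adjoint_op :: "'h::real_inner set \<Rightarrow> ('h \<Rightarrow> 'h) \<Rightarrow> bool" where
  "self_adjoint_op D T \<longleftrightarrow> densely_defined_op D T \<and> adjoint_domain D T = D \<and>
     (\<forall>x\<in>D. \<forall>y\<in>D. inner (T x) y = inner x (T y))"

definition positive_definite_op :: "'h::real_inner set \<Rightarrow> ('h \<Rightarrow> 'h) \<Rightarrow> bool" where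
  "positive_definite_op D T \<longleftrightarrow> (\<forall>x\<in>D. x \<noteq> 0 \<longrightarrow> 0 < inner (T x) x)"

definition has_compact_inverse :: "'h::real_inner set \<Rightarrow> ('h \<Rightarrow> 'h) \<Rightarrow> bool" where
  "has_compact_inverse D T \<longleftrightarrow>
     bij_betw T D UNIV \<and> compact (closure (inv_into D T ` cball 0 1))"

text \<open>\<open>(DS, S)\<close> is the positive square root of \<open>(D, T)\<close>, i.e. the nonnegative self-adjoint
  operator with \<open>S\<^sup>2 = T\<close> as unbounded operators (equality of domains included).  For
  nonnegative self-adjoint \<open>T\<close> it exists and is unique.\<close>

definition positive_sqrt_op ::
    "'h::real_inner set \<Rightarrow> ('h \<Rightarrow> 'h) \<Rightarrow> 'h set \<Rightarrow> ('h \<Rightarrow> 'h) \<Rightarrow> bool" where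
  "positive_sqrt_op D T DS S \<longleftrightarrow> self_adjoint_op DS S \<and> (\<forall>x\<in>DS. 0 \<le> inner (S x) x) \<and>
     D = {x\<in>DS. S x \<in> DS} \<and> (\<forall>x\<in>D. T x = S (S x))"

definition energy :: "('h::real_inner \<Rightarrow> 'h) \<Rightarrow> 'h \<Rightarrow> 'h \<Rightarrow> real" where
  "energy S u v = inner (S u) (S v)"

definition energy_norm :: "('h::real_inner \<Rightarrow> 'h) \<Rightarrow> 'h \<Rightarrow> real" where
  "energy_norm S v = sqrt (energy S v v)"

definition is_norm_on :: "'h::real_vector set \<Rightarrow> ('h \<Rightarrow> real) \<Rightarrow> bool" where
  "is_norm_on W N \<longleftrightarrow>
     (\<forall>w\<in>W. 0 \<le> N w \<and> (N w = 0 \<longleftrightarrow> w = 0)) \<and>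
     (\<forall>v\<in>W. \<forall>w\<in>W. N (v + w) \<le> N v + N w) \<and> (\<forall>c. \<forall>w\<in>W. N (c *\<^sub>R w) = \<bar>c\<bar> * N w)"

section \<open>Real matrices of variable size\<close>

definition sym_psd :: "real mat \<Rightarrow> bool" where
  "sym_psd A \<longleftrightarrow> A\<^sup>T = A \<and> (\<forall>x\<in>carrier_vec (dim_col A). 0 \<le> x \<bullet> (A *\<^sub>v x))"

definition sym_pos_def :: "real mat \<Rightarrow> bool" where
  "sym_pos_def A \<longleftrightarrow>
     A\<^sup>T = A \<and> (\<forall>x\<in>carrier_vec (dim_col A). x \<noteq> 0\<^sub>v (dim_col A) \<longrightarrow> 0 < x \<bullet> (A *\<^sub>v x))"

text \<open>The order \<open>B - A \<ge> 0\<close>; the library's \<open>\<le>\<close> on matrices is entrywise.\<close>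

definition loewner_le :: "real mat \<Rightarrow> real mat \<Rightarrow> bool" where
  "loewner_le A B \<longleftrightarrow> sym_psd (B - A)"

definition minv :: "real mat \<Rightarrow> real mat" where
  "minv A = the (mat_inverse A)"

text \<open>The choice is determined: the positive semidefinite square root is unique.\<close>

definition msqrt :: "real mat \<Rightarrow> real mat" where
  "msqrt A = (SOME R. R \<in> carrier_mat (dim_row A) (dim_col A) \<and> sym_psd R \<and> R * R = A)"

definition euclidean_norm :: "real vec \<Rightarrow> real" where
  "euclidean_norm v = sqrt (v \<bullet> v)"

definition spectral_norm :: "real mat \<Rightarrow> real" where
  "spectral_norm A =
     (SUP x\<in>{x\<in>carrier_vec (dim_col A). euclidean_norm x \<le> 1}. euclidean_norm (A *\<^sub>v x))"

definition nnz :: "real mat \<Rightarrow> nat" where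
  "nnz A = card {(i, j). i < dim_row A \<and> j < dim_col A \<and> A $$ (i, j) \<noteq> 0}"

definition row_nnz_le :: "real mat \<Rightarrow> nat \<Rightarrow> bool" where
  "row_nnz_le A s \<longleftrightarrow> (\<forall>i<dim_row A. card {j. j < dim_col A \<and> A $$ (i, j) \<noteq> 0} \<le> s)"

section \<open>Random vectors\<close>

definition borel_vec :: "nat \<Rightarrow> real vec measure" where
  "borel_vec n =
     vimage_algebra (carrier_vec n) (\<lambda>v. \<lambda>i\<in>{..<n}. v $ i) (\<Pi>\<^sub>M i\<in>{..<n}. (borel :: real measure))"

text \<open>Parametrised by the variance \<open>s \<ge> 0\<close>; zero variance gives a Dirac measure.\<close>

definition gaussian_law :: "real \<Rightarrow> real \<Rightarrow> real measure" where
  "gaussian_law m s = (if s = 0 then return borel m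
     else density lborel (\<lambda>x. ennreal (normal_density m (sqrt s) x)))"

text \<open>\<open>X \<sim> N(m, C)\<close>: every linear functional of \<open>X\<close> is Gaussian with the corresponding
  moments. The covariance \<open>C\<close> may be singular.\<close>

definition multivariate_normal ::
    "'w measure \<Rightarrow> nat \<Rightarrow> ('w \<Rightarrow> real vec) \<Rightarrow> real vec \<Rightarrow> real mat \<Rightarrow> bool" where
  "multivariate_normal M n X m C \<longleftrightarrow>
     X \<in> M \<rightarrow>\<^sub>M borel_vec n \<and> m \<in> carrier_vec n \<and> C \<in> carrier_mat n n \<and> sym_psd C \<and>
     (\<forall>v\<in>carrier_vec n. distr M borel (\<lambda>\<omega>. v \<bullet> X \<omega>) = gaussian_law (v \<bullet> m) (v \<bullet> (C *\<^sub>v v)))"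

definition covariance :: "'w measure \<Rightarrow> ('w \<Rightarrow> real) \<Rightarrow> ('w \<Rightarrow> real) \<Rightarrow> real" where
  "covariance M X Y =
     (\<integral>\<omega>. (X \<omega> - (\<integral>\<omega>'. X \<omega>' \<partial>M)) * (Y \<omega> - (\<integral>\<omega>'. Y \<omega>' \<partial>M)) \<partial>M)"

definition mean_vec :: "'w measure \<Rightarrow> nat \<Rightarrow> ('w \<Rightarrow> real vec) \<Rightarrow> real vec" where
  "mean_vec M n X = Matrix.vec n (\<lambda>i. \<integral>\<omega>. X \<omega> $ i \<partial>M)"

definition cov_mat :: "'w measure \<Rightarrow> nat \<Rightarrow> ('w \<Rightarrow> real vec) \<Rightarrow> real mat" where
  "cov_mat M n X = Matrix.mat n n (\<lambda>(i, j). covariance M (\<lambda>\<omega>. X \<omega> $ i) (\<lambda>\<omega>. X \<omega> $ j))"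

definition autocorrelation :: "'w measure \<Rightarrow> (nat \<Rightarrow> 'w \<Rightarrow> real) \<Rightarrow> nat \<Rightarrow> nat \<Rightarrow> real" where
  "autocorrelation M X m s = covariance M (X (m + s)) (X m) / covariance M (X m) (X m)"

definition integrated_autocorrelation_time ::
    "'w measure \<Rightarrow> (nat \<Rightarrow> 'w \<Rightarrow> real) \<Rightarrow> nat \<Rightarrow> real" where
  "integrated_autocorrelation_time M X m = 1 + 2 * (\<Sum>s. autocorrelation M X m (Suc s))"

section \<open>Discretisation\<close>

text \<open>The basis of the \<open>l\<close>-th space is \<open>\<phi> l 0, \<dots>, \<phi> l (n l - 1)\<close>. Vectors and matrices
  on level \<open>l\<close> have the variable-size types of \<^theory>\<open>Jordan_Normal_Form.Matrix\<close>; the data space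
  \<open>\<real>\<^sup>\<beta>\<close> is \<^typ>\<open>real ^ 'b\<close> with \<open>\<beta> = CARD('b)\<close>.\<close>

definition level_space :: "(nat \<Rightarrow> nat \<Rightarrow> 'h::real_vector) \<Rightarrow> (nat \<Rightarrow> nat) \<Rightarrow> nat \<Rightarrow> 'h set" where
  "level_space \<phi> n l = span (\<phi> l ` {..<n l})"

definition level_basis :: "(nat \<Rightarrow> nat \<Rightarrow> 'h::real_vector) \<Rightarrow> (nat \<Rightarrow> nat) \<Rightarrow> nat \<Rightarrow> bool" where
  "level_basis \<phi> n l \<longleftrightarrow> inj_on (\<phi> l) {..<n l} \<and> independent (\<phi> l ` {..<n l})"

definition coord_map ::
    "(nat \<Rightarrow> nat \<Rightarrow> 'h::real_vector) \<Rightarrow> (nat \<Rightarrow> nat) \<Rightarrow> nat \<Rightarrow> real vec \<Rightarrow> 'h" where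
  "coord_map \<phi> n l x = (\<Sum>j<n l. (x $ j) *\<^sub>R \<phi> l j)"

definition coord_inv ::
    "(nat \<Rightarrow> nat \<Rightarrow> 'h::real_vector) \<Rightarrow> (nat \<Rightarrow> nat) \<Rightarrow> nat \<Rightarrow> 'h \<Rightarrow> real vec" where
  "coord_inv \<phi> n l = inv_into (carrier_vec (n l)) (coord_map \<phi> n l)"

text \<open>The matrix of \<open>P\<^sub>l\<^sup>-\<^sup>1 P\<^sub>l\<^sub>-\<^sub>1\<close>, from level \<open>l - 1\<close> to level \<open>l\<close>; used only for \<open>l \<ge> 1\<close>.\<close>

definition prolongation ::
    "(nat \<Rightarrow> nat \<Rightarrow> 'h::real_vector) \<Rightarrow> (nat \<Rightarrow> nat) \<Rightarrow> nat \<Rightarrow> real mat" where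
  "prolongation \<phi> n l = Matrix.mat (n l) (n (l - 1))
     (\<lambda>(i, j). coord_inv \<phi> n l (coord_map \<phi> n (l - 1) (unit_vec (n (l - 1)) j)) $ i)"

definition stiffness_mat ::
    "('h::real_inner \<Rightarrow> 'h) \<Rightarrow> (nat \<Rightarrow> nat \<Rightarrow> 'h) \<Rightarrow> (nat \<Rightarrow> nat) \<Rightarrow> nat \<Rightarrow> real mat" where
  "stiffness_mat S \<phi> n l = Matrix.mat (n l) (n l) (\<lambda>(j, k). energy S (\<phi> l j) (\<phi> l k))"

text \<open>The \<open>j\<close>-th row of \<open>B\<^sub>l\<close>.\<close>

definition obs_row :: "('h \<Rightarrow> real ^ 'b) \<Rightarrow> (nat \<Rightarrow> nat \<Rightarrow> 'h) \<Rightarrow> nat \<Rightarrow> nat \<Rightarrow> real ^ 'b" where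
  "obs_row B \<phi> l j = B (\<phi> l j)"

text \<open>\<open>A\<^sub>l + B\<^sub>l \<Gamma>\<^sup>-\<^sup>1 B\<^sub>l\<^sup>T\<close>, the latter product written in terms of the rows of \<open>B\<^sub>l\<close>.\<close>

definition posterior_mat :: "('h::real_inner \<Rightarrow> 'h) \<Rightarrow> ('h \<Rightarrow> real ^ 'b) \<Rightarrow> real ^ 'b ^ 'b \<Rightarrow>
    (nat \<Rightarrow> nat \<Rightarrow> 'h) \<Rightarrow> (nat \<Rightarrow> nat) \<Rightarrow> nat \<Rightarrow> real mat" where
  "posterior_mat S B \<Gamma> \<phi> n l = stiffness_mat S \<phi> n l +
     Matrix.mat (n l) (n l) (\<lambda>(j, k). inner (obs_row B \<phi> l j) (matrix_inv \<Gamma> *v obs_row B \<phi> l k))"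

definition posterior_rhs :: "('h \<Rightarrow> real ^ 'b) \<Rightarrow> real ^ 'b ^ 'b \<Rightarrow> real ^ 'b \<Rightarrow>
    (nat \<Rightarrow> nat \<Rightarrow> 'h) \<Rightarrow> (nat \<Rightarrow> nat) \<Rightarrow> nat \<Rightarrow> real vec" where
  "posterior_rhs B \<Gamma> y \<phi> n l = Matrix.vec (n l) (\<lambda>j. inner (obs_row B \<phi> l j) (matrix_inv \<Gamma> *v y))"

definition functional_vec ::
    "'h::real_inner \<Rightarrow> (nat \<Rightarrow> nat \<Rightarrow> 'h) \<Rightarrow> (nat \<Rightarrow> nat) \<Rightarrow> nat \<Rightarrow> real vec" where
  "functional_vec \<chi> \<phi> n l = Matrix.vec (n l) (\<lambda>j. inner (\<phi> l j) \<chi>)"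

text \<open>The operator \<open>\<A> + \<B>\<^sup>* \<Gamma>\<^sup>-\<^sup>1 \<B>\<close>, with the same domain \<open>D\<close> as \<open>\<A>\<close>.\<close>

definition posterior_op ::
    "('h::real_inner \<Rightarrow> 'h) \<Rightarrow> ('h \<Rightarrow> real ^ 'b) \<Rightarrow> real ^ 'b ^ 'b \<Rightarrow> 'h \<Rightarrow> 'h" where
  "posterior_op A B \<Gamma> u = A u + adjoint B (matrix_inv \<Gamma> *v B u)"

definition posterior_op_inv ::
    "'h::real_inner set \<Rightarrow> ('h \<Rightarrow> 'h) \<Rightarrow> ('h \<Rightarrow> real ^ 'b) \<Rightarrow> real ^ 'b ^ 'b \<Rightarrow> 'h \<Rightarrow> 'h" where
  "posterior_op_inv D A B \<Gamma> = inv_into D (posterior_op A B \<Gamma>)"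

definition posterior_mean :: "'h::real_inner set \<Rightarrow> ('h \<Rightarrow> 'h) \<Rightarrow> ('h \<Rightarrow> real ^ 'b) \<Rightarrow>
    real ^ 'b ^ 'b \<Rightarrow> real ^ 'b \<Rightarrow> 'h" where
  "posterior_mean D A B \<Gamma> y = posterior_op_inv D A B \<Gamma> (adjoint B (matrix_inv \<Gamma> *v y))"

section \<open>The multigrid Monte Carlo V-cycle\<close>

text \<open>The update is a function of the random vectors drawn in it: \<open>\<xi>\<close> is the noise of a single
  smoothing step. A fresh sample from \<open>N(minv (A 0) f, minv (A 0))\<close>, whose mean is itself random,
  is realised as \<open>minv (A 0) *\<^sub>v f + \<zeta>\<close> with fresh \<open>\<zeta> \<sim> N(0, minv (A 0))\<close>.\<close>

definition random_smoother ::
    "real mat \<Rightarrow> real mat \<Rightarrow> real vec \<Rightarrow> real vec \<Rightarrow> real vec \<Rightarrow> real vec" where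
  "random_smoother A M f \<xi> \<theta> = \<theta> + minv M *\<^sub>v (f + \<xi> - A *\<^sub>v \<theta>)"

text \<open>On level \<open>l\<close> the pre-smoothing steps use \<open>\<xi> l k\<close> for \<open>k < \<nu>1\<close>, the post-smoothing steps
  those for \<open>\<nu>1 \<le> k < \<nu>1 + \<nu>2\<close>.\<close>

primrec mgmc :: "(nat \<Rightarrow> real mat) \<Rightarrow> (nat \<Rightarrow> real mat) \<Rightarrow> (nat \<Rightarrow> real mat) \<Rightarrow> nat \<Rightarrow> nat \<Rightarrow>
    (nat \<Rightarrow> nat \<Rightarrow> real vec) \<Rightarrow> real vec \<Rightarrow> nat \<Rightarrow> real vec \<Rightarrow> real vec \<Rightarrow> real vec" where
  "mgmc A M I \<nu>1 \<nu>2 \<xi> \<zeta> 0 f \<theta> = minv (A 0) *\<^sub>v f + \<zeta>"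
| "mgmc A M I \<nu>1 \<nu>2 \<xi> \<zeta> (Suc l) f \<theta> =
    (let smooth = (\<lambda>k. random_smoother (A (Suc l)) (M (Suc l)) f (\<xi> (Suc l) k));
         \<theta>\<^sub>1 = fold smooth [0..<\<nu>1] \<theta>;
         f\<^sub>c = (I (Suc l))\<^sup>T *\<^sub>v (f - A (Suc l) *\<^sub>v \<theta>\<^sub>1);
         \<psi> = mgmc A M I \<nu>1 \<nu>2 \<xi> \<zeta> l f\<^sub>c (0\<^sub>v (dim_row (A l)));
         \<theta>\<^sub>2 = \<theta>\<^sub>1 + I (Suc l) *\<^sub>v \<psi>
     in fold smooth [\<nu>1..<\<nu>1 + \<nu>2] \<theta>\<^sub>2)"

text \<open>The random vectors that drive the chain on a fixed finest level: the initial state, the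
  noise \<open>Smooth m l k\<close> of smoothing step \<open>k\<close> on level \<open>l\<close> in the update from state \<open>m\<close> to state
  \<open>m + 1\<close>, and the noise \<open>Coarse m\<close> of the coarse sampler in that update. A V-cycle visits
  every level exactly once, so these labels are distinct for distinct draws.\<close>

datatype draw = Init | Smooth nat nat nat | Coarse nat

definition draws :: "nat \<Rightarrow> nat \<Rightarrow> draw set" where
  "draws \<nu> L = insert Init ({Smooth m l k | m l k. 1 \<le> l \<and> l \<le> L \<and> k < \<nu>} \<union> range Coarse)"

definition draw_dim :: "(nat \<Rightarrow> nat) \<Rightarrow> nat \<Rightarrow> draw \<Rightarrow> nat" where
  "draw_dim n L d = (case d of Init \<Rightarrow> n L | Smooth m l k \<Rightarrow> n l | Coarse m \<Rightarrow> n 0)"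

primrec mgmc_chain :: "(nat \<Rightarrow> real mat) \<Rightarrow> (nat \<Rightarrow> real mat) \<Rightarrow> (nat \<Rightarrow> real mat) \<Rightarrow>
    nat \<Rightarrow> nat \<Rightarrow> nat \<Rightarrow> real vec \<Rightarrow> (draw \<Rightarrow> 'w \<Rightarrow> real vec) \<Rightarrow> nat \<Rightarrow> 'w \<Rightarrow> real vec" where
  "mgmc_chain A M I \<nu>1 \<nu>2 L f R 0 \<omega> = R Init \<omega>"
| "mgmc_chain A M I \<nu>1 \<nu>2 L f R (Suc m) \<omega> =
     mgmc A M I \<nu>1 \<nu>2 (\<lambda>l k. R (Smooth m l k) \<omega>) (R (Coarse m) \<omega>) L f
       (mgmc_chain A M I \<nu>1 \<nu>2 L f R m \<omega>)"

section \<open>Cost\<close>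

text \<open>Numbers of arithmetic operations, per level, of the steps of an update (one-off
  precomputations excluded). A smoother application includes drawing its noise, a prolongation
  includes the addition of the correction to the current state.\<close>

record op_counts =
  smoother_ops :: "nat \<Rightarrow> nat"
  residual_ops :: "nat \<Rightarrow> nat"
  restriction_ops :: "nat \<Rightarrow> nat"
  prolongation_ops :: "nat \<Rightarrow> nat"
  coarse_sampler_ops :: nat

text \<open>Follows the recursion of \<open>mgmc\<close>.\<close>

primrec mgmc_cost :: "op_counts \<Rightarrow> nat \<Rightarrow> nat \<Rightarrow> nat \<Rightarrow> nat" where
  "mgmc_cost K \<nu>1 \<nu>2 0 = coarse_sampler_ops K"
| "mgmc_cost K \<nu>1 \<nu>2 (Suc l) =
     \<nu>1 * smoother_ops K (Suc l) + residual_ops K (Suc l) + restriction_ops K (Suc l) +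
     mgmc_cost K \<nu>1 \<nu>2 l + prolongation_ops K (Suc l) + \<nu>2 * smoother_ops K (Suc l)"

text \<open>Residual, restriction and prolongation take work proportional to the number of stored
  entries of the sparse matrices involved plus \<open>(1 + \<beta>) n\<^sub>l\<close> (vector updates and the rank-\<open>\<beta>\<close>
  part); with a bounded number of nonzeros per row this is \<open>O((1 + \<beta>) n\<^sub>l)\<close>.\<close>

definition cost_model :: "op_counts \<Rightarrow> (nat \<Rightarrow> real mat) \<Rightarrow> (nat \<Rightarrow> real mat) \<Rightarrow>
    (nat \<Rightarrow> nat) \<Rightarrow> real ^ 'b ^ 'b \<Rightarrow> nat \<Rightarrow> real \<Rightarrow> real \<Rightarrow> real \<Rightarrow> bool" where
  "cost_model K A I n \<Gamma> s c\<^sub>0 c\<^sub>1 c\<^sub>2 \<longleftrightarrow>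
    (let \<beta> = real CARD('b);
         p\<^sub>\<Gamma> = (if \<forall>i j. i \<noteq> j \<longrightarrow> vec_nth (vec_nth \<Gamma> i) j = 0 then 1 else 2 :: nat) in
     (\<forall>l. row_nnz_le (A l) s) \<and> (\<forall>l\<ge>1. row_nnz_le (I l) s) \<and>
     (\<forall>l\<ge>1. real (residual_ops K l) \<le> c\<^sub>0 * (real (nnz (A l)) + (1 + \<beta>) * real (n l))) \<and>
     (\<forall>l\<ge>1. real (restriction_ops K l) \<le> c\<^sub>0 * (real (nnz (I l)) + (1 + \<beta>) * real (n l))) \<and>
     (\<forall>l\<ge>1. real (prolongation_ops K l) \<le> c\<^sub>0 * (real (nnz (I l)) + (1 + \<beta>) * real (n l))) \<and>
     (\<forall>l\<ge>1. real (smoother_ops K l) \<le> c\<^sub>1 * \<beta> ^ p\<^sub>\<Gamma> + c\<^sub>2 * (1 + \<beta>) * real (n l)))"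

end

(* The update maps the error, state minus target mean, to its image under E plus fresh Gaussian noise,
   where E is the error propagation operator of the deterministic V-cycle, and N(A^-1 f, A^-1) is
   invariant.  Hence Cov(theta_m) - A^-1 is conjugated by E in every update and everything reduces to
   the bound 0 <= E <= C_A / (C_A + nu) in the energy inner product.  This bound follows by induction
   on the level: on level l + 1, E = S^k (Q + P E_l P') S^k with k = nu / 2, P' the adjoint of the
   prolongation P, the smoother S = 1 - X and Q = 1 - P P' <= C_A X, so that with z = C_A / (C_A + nu)
   E <= S^k (z + (1 - z) C_A X) S^k = z S^k (1 + nu X) S^k <= z.

   The target moments are values of Galerkin solutions at functionals, which gives the uniform bound on
   F^T A^-1 F from the coercivity of the energy form, and convergence from quasi-optimality. *)

theory Submission
  imports Defs "Jordan_Normal_Form.Determinant"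
begin

section \<open>Symmetric matrices and their quadratic forms\<close>

text \<open>No spectral decomposition is used. The scalar estimate (1 - t)^nu (1 + nu t) <= 1
  becomes monotonicity of the moments of the smoother, and the passage from 0 <= E <= z to a bound
  on the norm of E tests positivity of E at one vector. The hypotheses on \<open>msqrt\<close> and
  \<open>spectral_norm\<close> are turned into inequalities between quadratic forms; as
  \<open>msqrt\<close> is a choice, the existence of a square root comes first.

  The stochastic obstacle is that the right-hand side of a coarse update is the restricted residual
  of a random state, so the coarse target mean is itself random. The induction on the level
  therefore speaks of errors, state minus \<open>minv (A l)\<close> applied to a possibly random
  right-hand side, and of the scalars obtained by testing them in the energy product. An update then
  acts on the test vector, independence enters as vanishing covariance, and no conditioning occurs.

  An autocorrelation has the variance at time m in its denominator. This variance may vanish at m =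
  0; after one update it is at least 1 - z^2 times the target variance.\<close>

lemma scalar_prod_transpose:
  fixes A :: "real mat"
  assumes "A \<in> carrier_mat m n" "x \<in> carrier_vec n" "y \<in> carrier_vec m"
  shows "x \<bullet> (A\<^sup>T *\<^sub>v y) = (A *\<^sub>v x) \<bullet> y"
proof -
  have "x \<bullet> (A\<^sup>T *\<^sub>v y) = (A\<^sup>T *\<^sub>v y) \<bullet> x"
    using assms by (intro comm_scalar_prod[of _ n]) auto
  also have "\<dots> = y \<bullet> (A *\<^sub>v x)"
    using assms by (intro transpose_vec_mult_scalar)
  also have "\<dots> = (A *\<^sub>v x) \<bullet> y"
    using assms by (intro comm_scalar_prod[of _ m]) auto
  finally show ?thesis .
qed

lemma symmetric_form_left:
  fixes A :: "real mat"
  assumes "A \<in> carrier_mat n n" "A\<^sup>T = A" "x \<in> carrier_vec n" "y \<in> carrier_vec n"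
  shows "(A *\<^sub>v x) \<bullet> y = x \<bullet> (A *\<^sub>v y)"
  using scalar_prod_transpose[of A n n x y] assms by simp

lemma symmetric_form_commute:
  fixes A :: "real mat"
  assumes "A \<in> carrier_mat n n" "A\<^sup>T = A" "x \<in> carrier_vec n" "y \<in> carrier_vec n"
  shows "x \<bullet> (A *\<^sub>v y) = y \<bullet> (A *\<^sub>v x)"
  using symmetric_form_left[OF assms] comm_scalar_prod[of "A *\<^sub>v x" n y] assms by simp

lemma quadratic_form_diff:
  fixes A :: "real mat"
  assumes "A \<in> carrier_mat n n" "A\<^sup>T = A" "x \<in> carrier_vec n" "y \<in> carrier_vec n"
  shows "(x - y) \<bullet> (A *\<^sub>v (x - y)) = x \<bullet> (A *\<^sub>v x) - 2 * (x \<bullet> (A *\<^sub>v y)) + y \<bullet> (A *\<^sub>v y)"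
  using assms symmetric_form_commute[OF assms]
  by (simp add: mult_minus_distrib_mat_vec[of A n n] minus_scalar_prod_distrib[of _ n]
      scalar_prod_minus_distrib[of _ n])

lemma quadratic_form_add:
  fixes A :: "real mat"
  assumes "A \<in> carrier_mat n n" "A\<^sup>T = A" "x \<in> carrier_vec n" "y \<in> carrier_vec n"
  shows "(x + y) \<bullet> (A *\<^sub>v (x + y)) = x \<bullet> (A *\<^sub>v x) + 2 * (x \<bullet> (A *\<^sub>v y)) + y \<bullet> (A *\<^sub>v y)"
  using assms symmetric_form_commute[OF assms]
  by (simp add: mult_add_distrib_mat_vec[of A n n] add_scalar_prod_distrib[of _ n]
      scalar_prod_add_distrib[of _ n])

lemma quadratic_form_smult:
  fixes A :: "real mat"
  assumes "A \<in> carrier_mat n n" "x \<in> carrier_vec n"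
  shows "(c \<cdot>\<^sub>v x) \<bullet> (A *\<^sub>v (c \<cdot>\<^sub>v x)) = c\<^sup>2 * (x \<bullet> (A *\<^sub>v x))"
  using assms by (simp add: mult_mat_vec[of A n n] power2_eq_square)

lemma scalar_prod_self_nonneg: "0 \<le> x \<bullet> (x :: real vec)"
  by (simp add: scalar_prod_def sum_nonneg)

lemma scalar_prod_self_pos:
  fixes x :: "real vec"
  assumes "x \<in> carrier_vec n" "x \<noteq> 0\<^sub>v n"
  shows "0 < x \<bullet> x"
proof -
  obtain i where i: "i < n" "x $ i \<noteq> 0"
    using assms by (metis carrier_vecD eq_vecI index_zero_vec(1) index_zero_vec(2))
  have "0 < (\<Sum>i = 0..<n. x $ i * x $ i)"
    using i by (intro sum_pos2[of _ i]) (auto simp: zero_less_mult_iff)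
  then show ?thesis using assms by (simp add: scalar_prod_def)
qed

lemma unit_form:
  fixes A :: "real mat"
  assumes "A \<in> carrier_mat m n" "i < m" "j < n"
  shows "unit_vec m i \<bullet> (A *\<^sub>v unit_vec n j) = A $$ (i, j)"
  using assms scalar_prod_left_unit[of "A *\<^sub>v unit_vec n j" m i] by auto

lemma mult_mat_zero_vec:
  fixes A :: "real mat"
  assumes "A \<in> carrier_mat m n"
  shows "A *\<^sub>v 0\<^sub>v n = 0\<^sub>v m"
  using assms by (intro eq_vecI) auto

lemma smult_mat_mult_vec:
  fixes A :: "real mat"
  assumes "A \<in> carrier_mat m n" "x \<in> carrier_vec n"
  shows "(c \<cdot>\<^sub>m A) *\<^sub>v x = c \<cdot>\<^sub>v (A *\<^sub>v x)"
  using assms by (intro eq_vecI) auto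

lemma transpose_smult_mat: "(c \<cdot>\<^sub>m A)\<^sup>T = (c :: real) \<cdot>\<^sub>m A\<^sup>T"
  by (intro eq_matI) auto

lemma smult_smult_mat: "a \<cdot>\<^sub>m (b \<cdot>\<^sub>m A) = (a * b :: real) \<cdot>\<^sub>m A"
  by (intro eq_matI) auto

text \<open>\<open>minv\<close> unwraps the result of Gauss-Jordan elimination. A positive definite
  matrix has trivial kernel, hence nonzero determinant, hence is a unit of the matrix ring, so the
  elimination does return a matrix.\<close>

lemma sym_pos_def_inverse:
  assumes A: "A \<in> carrier_mat n n" "sym_pos_def A"
  shows "minv A \<in> carrier_mat n n" "A * minv A = 1\<^sub>m n" "minv A * A = 1\<^sub>m n"
proof -
  have "v = 0\<^sub>v n" if "v \<in> carrier_vec n" "A *\<^sub>v v = 0\<^sub>v n" for v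
    using A that unfolding sym_pos_def_def by force
  then have "Determinant.det A \<noteq> 0"
    using det_0_iff_vec_prod_zero_field[OF A(1)] by blast
  then have "A \<in> Units (ring_mat TYPE(real) n ())"
    using det_non_zero_imp_unit[OF A(1), where b = "()"] by blast
  then obtain B where "mat_inverse A = Some B"
    using mat_inverse(1)[OF A(1), where b = "()"] by (cases "mat_inverse A") auto
  then show "minv A \<in> carrier_mat n n" "A * minv A = 1\<^sub>m n" "minv A * A = 1\<^sub>m n"
    using mat_inverse(2)[OF A(1)] by (auto simp: minv_def)
qed

lemma minv_mult_vec:
  assumes "A \<in> carrier_mat n n" "sym_pos_def A" "x \<in> carrier_vec n"
  shows "minv A *\<^sub>v x \<in> carrier_vec n" "A *\<^sub>v (minv A *\<^sub>v x) = x" "minv A *\<^sub>v (A *\<^sub>v x) = x"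
  using assms sym_pos_def_inverse[OF assms(1,2)]
  by (auto simp flip: assoc_mult_mat_vec[of _ n n _ n])

lemma sym_pos_def_form_pos:
  assumes "A \<in> carrier_mat n n" "sym_pos_def A" "x \<in> carrier_vec n" "x \<noteq> 0\<^sub>v n"
  shows "0 < x \<bullet> (A *\<^sub>v x)"
  using assms by (auto simp: sym_pos_def_def)

lemma sym_pos_def_form_nonneg:
  assumes "A \<in> carrier_mat n n" "sym_pos_def A" "x \<in> carrier_vec n"
  shows "0 \<le> x \<bullet> (A *\<^sub>v x)"
  using sym_pos_def_form_pos[OF assms] assms by (cases "x = 0\<^sub>v n") auto

text \<open>The form of the inverse at x is the form of A at z = A^-1 x.\<close>

lemma minv_form_nonneg:
  assumes "A \<in> carrier_mat n n" "sym_pos_def A" "x \<in> carrier_vec n"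
  shows "0 \<le> x \<bullet> (minv A *\<^sub>v x)"
proof -
  let ?z = "minv A *\<^sub>v x"
  have "0 \<le> ?z \<bullet> (A *\<^sub>v ?z)"
    using sym_pos_def_form_nonneg assms minv_mult_vec by blast
  also have "\<dots> = x \<bullet> ?z"
    using assms minv_mult_vec[OF assms] comm_scalar_prod[of x n ?z] by simp
  finally show ?thesis .
qed

lemma minv_form_commute:
  assumes "A \<in> carrier_mat n n" "sym_pos_def A" "x \<in> carrier_vec n" "y \<in> carrier_vec n"
  shows "x \<bullet> (minv A *\<^sub>v y) = y \<bullet> (minv A *\<^sub>v x)"
proof -
  note x = minv_mult_vec[OF assms(1-3)] and y = minv_mult_vec[OF assms(1,2,4)]
  have "(A *\<^sub>v (minv A *\<^sub>v x)) \<bullet> (minv A *\<^sub>v y) = (minv A *\<^sub>v x) \<bullet> (A *\<^sub>v (minv A *\<^sub>v y))"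
    using assms x y by (intro symmetric_form_left[of _ n]) (auto simp: sym_pos_def_def)
  then show ?thesis
    using x y comm_scalar_prod[of "minv A *\<^sub>v x" n y] assms by simp
qed

lemma loewner_leD:
  assumes "A \<in> carrier_mat n n" "B \<in> carrier_mat n n" "loewner_le A B" "x \<in> carrier_vec n"
  shows "x \<bullet> (A *\<^sub>v x) \<le> x \<bullet> (B *\<^sub>v x)"
proof -
  have "0 \<le> x \<bullet> ((B - A) *\<^sub>v x)"
    using assms by (auto simp: loewner_le_def sym_psd_def)
  then show ?thesis
    using assms by (simp add: minus_mult_distrib_mat_vec[of _ n n] scalar_prod_minus_distrib[of _ n])
qed

section \<open>Norms\<close>

lemma euclidean_norm_nonneg: "0 \<le> euclidean_norm x"
  by (simp add: euclidean_norm_def scalar_prod_self_nonneg)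

lemma euclidean_norm_square: "(euclidean_norm x)\<^sup>2 = x \<bullet> x"
  by (simp add: euclidean_norm_def scalar_prod_self_nonneg)

lemma scalar_prod_Cauchy_Schwarz:
  fixes x y :: "real vec"
  assumes "x \<in> carrier_vec n" "y \<in> carrier_vec n"
  shows "\<bar>x \<bullet> y\<bar> \<le> euclidean_norm x * euclidean_norm y"
proof -
  have "(x \<bullet> y)\<^sup>2 \<le> (x \<bullet> x) * (y \<bullet> y)"
    using assms Cauchy_Schwarz_ineq_sum[of "\<lambda>i. x $ i" "\<lambda>i. y $ i" "{0..<n}"]
    by (simp add: scalar_prod_def power2_eq_square)
  then have "(x \<bullet> y)\<^sup>2 \<le> (euclidean_norm x * euclidean_norm y)\<^sup>2"
    by (simp add: power_mult_distrib euclidean_norm_square)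
  then show ?thesis
    by (metis abs_le_square_iff abs_of_nonneg euclidean_norm_nonneg mult_nonneg_nonneg)
qed

text \<open>\<open>spectral_norm\<close> is a supremum of reals and bounds its elements only once
  the set is known to be bounded above. Cauchy-Schwarz on each row gives the Frobenius norm as such
  a bound.\<close>

lemma euclidean_norm_mult_vec_bound:
  obtains c where "\<And>x. x \<in> carrier_vec (dim_col A) \<Longrightarrow> euclidean_norm x \<le> 1 \<Longrightarrow>
    euclidean_norm (A *\<^sub>v x) \<le> c"
proof
  fix x assume x: "x \<in> carrier_vec (dim_col A)" "euclidean_norm x \<le> 1"
  have "((A *\<^sub>v x) $ i)\<^sup>2 \<le> (euclidean_norm (row A i))\<^sup>2" if i: "i < dim_row A" for i
  proof -
    have "\<bar>row A i \<bullet> x\<bar> \<le> euclidean_norm (row A i) * euclidean_norm x"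
      using x by (intro scalar_prod_Cauchy_Schwarz) auto
    also have "\<dots> \<le> euclidean_norm (row A i)"
      using x euclidean_norm_nonneg by (simp add: mult_left_le)
    finally show ?thesis
      using i by (simp add: abs_le_square_iff[symmetric] euclidean_norm_nonneg)
  qed
  then have "(A *\<^sub>v x) \<bullet> (A *\<^sub>v x) \<le> (\<Sum>i = 0..<dim_row A. (euclidean_norm (row A i))\<^sup>2)"
    by (auto simp: scalar_prod_def[of "A *\<^sub>v x"] power2_eq_square intro!: sum_mono)
  then show "euclidean_norm (A *\<^sub>v x) \<le> sqrt (\<Sum>i = 0..<dim_row A. (euclidean_norm (row A i))\<^sup>2)"
    by (simp add: euclidean_norm_def)
qed

lemma spectral_norm_upper:
  assumes x: "x \<in> carrier_vec (dim_col A)" "euclidean_norm x \<le> 1"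
  shows "euclidean_norm (A *\<^sub>v x) \<le> spectral_norm A"
proof -
  obtain c where c: "\<And>x. x \<in> carrier_vec (dim_col A) \<Longrightarrow> euclidean_norm x \<le> 1 \<Longrightarrow>
      euclidean_norm (A *\<^sub>v x) \<le> c"
    using euclidean_norm_mult_vec_bound by blast
  show ?thesis
    unfolding spectral_norm_def
    by (rule cSUP_upper) (use x c in \<open>auto intro!: bdd_aboveI2\<close>)
qed

lemma spectral_norm_form_bound:
  assumes A: "A \<in> carrier_mat n n" and x: "x \<in> carrier_vec n" and C: "spectral_norm A \<le> C"
  shows "\<bar>x \<bullet> (A *\<^sub>v x)\<bar> \<le> C * (x \<bullet> x)"
proof (cases "x = 0\<^sub>v n")
  case True
  then show ?thesis using A by simp
next
  case False
  define r where "r = euclidean_norm x"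
  have r: "0 < r" "r\<^sup>2 = x \<bullet> x"
    using scalar_prod_self_pos[OF x False] euclidean_norm_square
    by (auto simp: r_def euclidean_norm_def)
  define u where "u = (1 / r) \<cdot>\<^sub>v x"
  have u: "u \<in> carrier_vec n" "x = r \<cdot>\<^sub>v u" using x r by (auto simp: u_def smult_smult_assoc)
  have "u \<bullet> u = 1"
    using x r by (simp add: u_def power2_eq_square flip: r(2))
  then have nu: "euclidean_norm u = 1" by (simp add: euclidean_norm_def)
  have "\<bar>u \<bullet> (A *\<^sub>v u)\<bar> \<le> euclidean_norm u * euclidean_norm (A *\<^sub>v u)"
    using u A by (intro scalar_prod_Cauchy_Schwarz) auto
  also have "\<dots> \<le> C"
    using nu spectral_norm_upper[of u A] u A C by auto
  finally have "r\<^sup>2 * \<bar>u \<bullet> (A *\<^sub>v u)\<bar> \<le> r\<^sup>2 * C" by (simp add: mult_left_mono)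
  moreover have "\<bar>x \<bullet> (A *\<^sub>v x)\<bar> = r\<^sup>2 * \<bar>u \<bullet> (A *\<^sub>v u)\<bar>"
    using quadratic_form_smult[OF A u(1), of r] u by (simp add: abs_mult)
  ultimately show ?thesis using r by (simp add: mult.commute)
qed

section \<open>The positive semidefinite square root\<close>

text \<open>The square root of \<open>1 - B\<close> for \<open>0 \<le> B \<le> 1\<close> is the binomial series at exponent \<open>1/2\<close>, whose
  coefficients are absolutely summable.\<close>

definition sqrt_coeff :: "nat \<Rightarrow> real" where
  "sqrt_coeff k = (1/2 gchoose k) * (-1) ^ k"

lemma sqrt_coeff_0: "sqrt_coeff 0 = 1"
  by (simp add: sqrt_coeff_def)

lemma sqrt_coeff_Suc: "sqrt_coeff (Suc k) = sqrt_coeff k * ((k - 1/2) / (k + 1))"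
proof -
  have "(1/2 :: real) gchoose Suc k = (1/2 gchoose k) * ((1/2 - k) / (k + 1))"
    using gbinomial_mult_1[of "1/2 :: real" k] by (simp add: field_simps)
  then show ?thesis unfolding sqrt_coeff_def by (simp only:) (simp add: field_simps)
qed

text \<open>The ratio of consecutive coefficients is negative only at index 0, so the sign changes
  once, right after the constant term.\<close>

lemma sqrt_coeff_nonpos: "sqrt_coeff (Suc k) \<le> 0"
proof (induction k)
  case 0
  show ?case by (simp add: sqrt_coeff_Suc sqrt_coeff_0)
next
  case (Suc k)
  then show ?case by (subst sqrt_coeff_Suc) (intro mult_nonpos_nonneg, auto)
qed

text \<open>The alternating partial sum up to m has the closed form (-1)^m (-1/2 choose m), a
  product of the nonnegative factors (k + 1/2) / (k + 1).\<close>

lemma sqrt_coeff_partial_sum_nonneg: "0 \<le> (\<Sum>k\<le>m. sqrt_coeff k)"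
proof -
  have "0 \<le> (-1) ^ m * ((-1/2 :: real) gchoose m)" for m
  proof (induction m)
    case (Suc m)
    have "(-1/2 :: real) gchoose Suc m = (-1/2 gchoose m) * ((-1/2 - m) / (m + 1))"
      using gbinomial_mult_1[of "-1/2 :: real" m] by (simp add: field_simps)
    then have "(-1) ^ Suc m * ((-1/2 :: real) gchoose Suc m) =
        ((-1) ^ m * ((-1/2 :: real) gchoose m)) * ((m + 1/2) / (m + 1))"
      by (simp only:) (simp add: field_simps)
    then show ?case using Suc by simp
  qed simp
  then show ?thesis
    using gbinomial_sum_lower_neg[of "1/2 :: real" m] by (simp add: sqrt_coeff_def)
qed

lemma summable_abs_sqrt_coeff: "summable (\<lambda>k. \<bar>sqrt_coeff k\<bar>)"
proof (rule summableI_nonneg_bounded)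
  fix m
  have "(\<Sum>k<m. \<bar>sqrt_coeff k\<bar>) \<le> (\<Sum>k\<le>m. \<bar>sqrt_coeff k\<bar>)"
    by (intro sum_mono2) auto
  \<comment> \<open>All coefficients but the leading 1 are nonpositive, so taking absolute values
    reflects the sum at 1.\<close>
  also have "\<dots> = 2 - (\<Sum>k\<le>m. sqrt_coeff k)"
  proof (induction m)
    case (Suc m)
    then show ?case using sqrt_coeff_nonpos[of m] by simp
  qed (simp add: sqrt_coeff_0)
  also have "\<dots> \<le> 2" using sqrt_coeff_partial_sum_nonneg by simp
  finally show "(\<Sum>k<m. \<bar>sqrt_coeff k\<bar>) \<le> 2" .
qed simp

text \<open>These are the coefficients of the square of the series, that is of 1 - t, by the
  Vandermonde identity at 1/2 + 1/2 = 1.\<close>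

lemma sqrt_coeff_convolution:
  "(\<Sum>i\<le>m. sqrt_coeff i * sqrt_coeff (m - i)) = (if m = 0 then 1 else if m = 1 then -1 else 0)"
proof -
  have "(\<Sum>i\<le>m. sqrt_coeff i * sqrt_coeff (m - i)) =
      (\<Sum>i\<le>m. (-1) ^ m * ((1/2 gchoose i) * (1/2 gchoose (m - i))))"
    by (intro sum.cong refl) (auto simp: sqrt_coeff_def simp flip: power_add)
  also have "\<dots> = (-1) ^ m * (1 gchoose m)"
    using gbinomial_Vandermonde[of "1/2 :: real" "1/2" m]
    by (simp add: atMost_atLeast0 flip: sum_distrib_left)
  also have "(1 :: real) gchoose m = of_nat (1 choose m)"
    by (simp add: binomial_gbinomial)
  finally show ?thesis by (cases m) (auto simp: binomial_eq_0)
qed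

lemma pow_mat_add:
  fixes B :: "real mat"
  assumes B: "B \<in> carrier_mat n n"
  shows "B ^\<^sub>m i * B ^\<^sub>m j = B ^\<^sub>m (i + j)"
proof (induction j)
  case 0
  have "B ^\<^sub>m i \<in> carrier_mat n n" using B by simp
  then show ?case using B by simp
next
  case (Suc j)
  have c: "B ^\<^sub>m k \<in> carrier_mat n n" for k using B by simp
  have "B ^\<^sub>m i * B ^\<^sub>m Suc j = (B ^\<^sub>m i * B ^\<^sub>m j) * B"
    using assoc_mult_mat[OF c c B] by simp
  then show ?case using Suc by simp
qed

text \<open>The induction descends by two: the form of B^(j+2) at x is the form of B^j at B x, and B
  x is no longer than x.\<close>

lemma psd_contraction_powers:
  fixes B :: "real mat"
  assumes B: "B \<in> carrier_mat n n" "B\<^sup>T = B"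
    and b: "\<And>x. x \<in> carrier_vec n \<Longrightarrow> 0 \<le> x \<bullet> (B *\<^sub>v x) \<and> x \<bullet> (B *\<^sub>v x) \<le> x \<bullet> x"
  shows "(B ^\<^sub>m k)\<^sup>T = B ^\<^sub>m k"
    and "x \<in> carrier_vec n \<Longrightarrow> 0 \<le> x \<bullet> (B ^\<^sub>m k *\<^sub>v x) \<and> x \<bullet> (B ^\<^sub>m k *\<^sub>v x) \<le> x \<bullet> x"
proof -
  have c: "B ^\<^sub>m k \<in> carrier_mat n n" for k using B by simp
  show "(B ^\<^sub>m k)\<^sup>T = B ^\<^sub>m k"
  proof (induction k)
    case (Suc k)
    have "(B ^\<^sub>m Suc k)\<^sup>T = B * B ^\<^sub>m k"
      using transpose_mult[OF c B(1)] Suc B by simp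
    also have "\<dots> = B ^\<^sub>m Suc k" using pow_mat_add[OF B(1), of 1 k] B by simp
    finally show ?case .
  qed (use B in simp)
  \<comment> \<open>Positivity of B at x - B x bounds 2 |B x|^2 by the forms of B at x and at B x,
    hence by |x|^2 + |B x|^2.\<close>
  have sq: "(B *\<^sub>v x) \<bullet> (B *\<^sub>v x) \<le> x \<bullet> x" if x: "x \<in> carrier_vec n" for x
  proof -
    have Bx: "B *\<^sub>v x \<in> carrier_vec n" using B x by simp
    have "0 \<le> (x - B *\<^sub>v x) \<bullet> (B *\<^sub>v (x - B *\<^sub>v x))" using b x Bx by simp
    also have "\<dots> = x \<bullet> (B *\<^sub>v x) - 2 * ((B *\<^sub>v x) \<bullet> (B *\<^sub>v x)) + (B *\<^sub>v x) \<bullet> (B *\<^sub>v (B *\<^sub>v x))"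
      using quadratic_form_diff[OF B x Bx] symmetric_form_left[OF B x Bx] by simp
    finally show ?thesis using b[OF x] b[OF Bx] by linarith
  qed
  show "x \<in> carrier_vec n \<Longrightarrow> 0 \<le> x \<bullet> (B ^\<^sub>m k *\<^sub>v x) \<and> x \<bullet> (B ^\<^sub>m k *\<^sub>v x) \<le> x \<bullet> x"
  proof (induction k arbitrary: x rule: less_induct)
    case (less k)
    consider "k = 0" | "k = 1" | j where "k = Suc (Suc j)" by (metis One_nat_def not0_implies_Suc)
    then show ?case
    proof cases
      case (3 j)
      have Bx: "B *\<^sub>v x \<in> carrier_vec n" using B less by simp
      have "B ^\<^sub>m k = B * (B ^\<^sub>m j * B)"
        using pow_mat_add[OF B(1), of 1 "Suc j"] B 3 by simp
      then have "x \<bullet> (B ^\<^sub>m k *\<^sub>v x) = x \<bullet> (B *\<^sub>v (B ^\<^sub>m j *\<^sub>v (B *\<^sub>v x)))"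
        using B c[of j] less.prems Bx
        by (simp add: assoc_mult_mat_vec[OF B(1) mult_carrier_mat[OF c B(1)]] assoc_mult_mat_vec[OF c B(1)])
      also have "\<dots> = (B *\<^sub>v x) \<bullet> (B ^\<^sub>m j *\<^sub>v (B *\<^sub>v x))"
        using B less.prems mult_mat_vec_carrier[OF c Bx] by (intro symmetric_form_left[symmetric]) auto
      finally show ?thesis
        using less.IH[of j "B *\<^sub>v x"] 3 Bx sq[OF less.prems] by force
    qed (use b less B scalar_prod_self_nonneg[of x] in auto)
  qed
qed

lemma sym_psd_sqrt_contraction:
  fixes B :: "real mat"
  assumes B: "B \<in> carrier_mat n n" "B\<^sup>T = B"
    and b: "\<And>x. x \<in> carrier_vec n \<Longrightarrow> 0 \<le> x \<bullet> (B *\<^sub>v x) \<and> x \<bullet> (B *\<^sub>v x) \<le> x \<bullet> x"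
  obtains R where "R \<in> carrier_mat n n" "sym_psd R" "R * R = 1\<^sub>m n - B"
proof -
  have c: "B ^\<^sub>m k \<in> carrier_mat n n" for k using B by simp
  have pw1: "(B ^\<^sub>m k)\<^sup>T = B ^\<^sub>m k" for k
    by (rule psd_contraction_powers(1)[OF B b])
  have pw2: "0 \<le> x \<bullet> (B ^\<^sub>m k *\<^sub>v x) \<and> x \<bullet> (B ^\<^sub>m k *\<^sub>v x) \<le> x \<bullet> x" if "x \<in> carrier_vec n" for x k
    by (rule psd_contraction_powers(2)[OF B]) (use b that in auto)
  have form: "x \<bullet> (P *\<^sub>v y) = (\<Sum>i<n. \<Sum>j<n. x $ i * y $ j * P $$ (i, j))"
    if "x \<in> carrier_vec n" "y \<in> carrier_vec n" "P \<in> carrier_mat n n" for x y and P :: "real mat"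
    using that by (simp add: scalar_prod_def sum_distrib_left atLeast0LessThan ac_simps)
  have psym: "(B ^\<^sub>m k) $$ (i, j) = (B ^\<^sub>m k) $$ (j, i)" if "i < n" "j < n" for i j k
    using pw1[of k] c[of k] that by (metis carrier_matD index_transpose_mat(1))
  \<comment> \<open>Positivity at the sum and the difference of two unit vectors bounds an
    off-diagonal entry by the mean of two diagonal entries, each at most 1. So the series for R
    converges entry by entry and all limits are limits of reals.\<close>
  have entry: "\<bar>(B ^\<^sub>m k) $$ (i, j)\<bar> \<le> 1" if ij: "i < n" "j < n" for k i j
  proof -
    let ?P = "B ^\<^sub>m k" and ?e = "unit_vec n :: nat \<Rightarrow> real vec"
    have ent: "?e i \<bullet> (?P *\<^sub>v ?e j) = ?P $$ (i, j)" if "i < n" "j < n" for i j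
      using that unit_form[OF c] by simp
    have ui: "?e i \<bullet> ?e i = 1" "?e j \<bullet> ?e j = 1" using ij by auto
    have "0 \<le> (?e i - ?e j) \<bullet> (?P *\<^sub>v (?e i - ?e j))" "0 \<le> (?e i + ?e j) \<bullet> (?P *\<^sub>v (?e i + ?e j))"
      using pw2[of _ k] by auto
    then have "\<bar>2 * ?P $$ (i, j)\<bar> \<le> ?P $$ (i, i) + ?P $$ (j, j)"
      using quadratic_form_diff[OF c pw1, of "?e i" "?e j" k]
        quadratic_form_add[OF c pw1, of "?e i" "?e j" k] ent ij by simp
    moreover have "?P $$ (i, i) \<le> 1" "?P $$ (j, j) \<le> 1"
      using pw2[of "?e i" k] pw2[of "?e j" k] ent ij ui by auto
    ultimately show ?thesis by linarith
  qed
  have summ: "summable (\<lambda>k. norm (sqrt_coeff k * (B ^\<^sub>m k) $$ (i, j)))" if "i < n" "j < n" for i j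
    by (rule summable_comparison_test'[OF summable_abs_sqrt_coeff])
      (use entry[OF that] in \<open>auto simp: abs_mult intro: mult_left_le\<close>)
  define R where "R = Matrix.mat n n (\<lambda>(i, j). \<Sum>k. sqrt_coeff k * (B ^\<^sub>m k) $$ (i, j))"
  have R: "R \<in> carrier_mat n n" by (simp add: R_def)
  have sq: "R * R = 1\<^sub>m n - B"
  proof (rule eq_matI)
    fix i l assume "i < dim_row (1\<^sub>m n - B)" "l < dim_col (1\<^sub>m n - B)"
    then have il: "i < n" "l < n" using B by auto
    define g where "g j k m = (sqrt_coeff k * (B ^\<^sub>m k) $$ (i, j)) * (sqrt_coeff m * (B ^\<^sub>m m) $$ (j, l))"
      for j k m
    have "(\<lambda>N. \<Sum>j<n. \<Sum>k\<le>N. g j k (N - k)) sums (\<Sum>j<n. R $$ (i, j) * R $$ (j, l))"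
    proof (rule sums_sum)
      fix j assume "j \<in> {..<n}"
      then show "(\<lambda>N. \<Sum>k\<le>N. g j k (N - k)) sums (R $$ (i, j) * R $$ (j, l))"
        using Cauchy_product_sums[OF summ[of i j] summ[of j l]] il by (simp add: g_def R_def)
    qed
    moreover have "(\<Sum>j<n. \<Sum>k\<le>N. g j k (N - k)) =
        (if N = 0 then 1 else if N = 1 then -1 else 0) * (B ^\<^sub>m N) $$ (i, l)" for N
    proof -
      have "(\<Sum>j<n. \<Sum>k\<le>N. g j k (N - k)) = (\<Sum>k\<le>N. \<Sum>j<n. g j k (N - k))"
        by (rule sum.swap)
      also have "\<dots> = (\<Sum>k\<le>N. sqrt_coeff k * sqrt_coeff (N - k) * (B ^\<^sub>m N) $$ (i, l))"
      proof (intro sum.cong refl)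
        fix k assume k: "k \<in> {..N}"
        have "(B ^\<^sub>m N) $$ (i, l) = (B ^\<^sub>m k * B ^\<^sub>m (N - k)) $$ (i, l)"
          using k by (simp add: pow_mat_add[OF B(1)])
        also have "\<dots> = (\<Sum>j<n. (B ^\<^sub>m k) $$ (i, j) * (B ^\<^sub>m (N - k)) $$ (j, l))"
          by (subst index_mult_mat) (use il carrier_matD[OF c[of k]] carrier_matD[OF c[of "N - k"]] in
              \<open>simp_all add: scalar_prod_def atLeast0LessThan del: pow_mat_dim\<close>)
        finally show "(\<Sum>j<n. g j k (N - k)) = sqrt_coeff k * sqrt_coeff (N - k) * (B ^\<^sub>m N) $$ (i, l)"
          by (simp add: g_def sum_distrib_left ac_simps)
      qed
      finally show ?thesis by (simp add: sqrt_coeff_convolution flip: sum_distrib_right)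
    qed
    ultimately have "(\<lambda>N. (if N = 0 then 1 else if N = 1 then -1 else 0) * (B ^\<^sub>m N) $$ (i, l)) sums
        (\<Sum>j<n. R $$ (i, j) * R $$ (j, l))" by simp
    moreover have "(\<lambda>N. (if N = 0 then 1 else if N = 1 then -1 else 0) * (B ^\<^sub>m N) $$ (i, l)) sums
        (\<Sum>N\<in>{0, 1}. (if N = 0 then 1 else if N = 1 then -1 else 0) * (B ^\<^sub>m N) $$ (i, l))"
      by (rule sums_finite) auto
    ultimately have "(\<Sum>j<n. R $$ (i, j) * R $$ (j, l)) =
        (\<Sum>N\<in>{0, 1}. (if N = 0 then 1 else if N = 1 then -1 else 0) * (B ^\<^sub>m N) $$ (i, l))"
      using sums_unique2 by blast
    then show "(R * R) $$ (i, l) = (1\<^sub>m n - B) $$ (i, l)"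
      using il R B by (simp add: scalar_prod_def atLeast0LessThan)
  qed (use R B in auto)
  have "sym_psd R"
    unfolding sym_psd_def
  proof (intro conjI ballI)
    show "R\<^sup>T = R"
      by (rule eq_matI) (auto simp: R_def psym)
    fix x :: "real vec"
    assume "x \<in> carrier_vec (dim_col R)"
    then have x: "x \<in> carrier_vec n" using R by simp
    have "(\<lambda>k. \<Sum>i<n. \<Sum>j<n. x $ i * x $ j * (sqrt_coeff k * (B ^\<^sub>m k) $$ (i, j))) sums
        (\<Sum>i<n. \<Sum>j<n. x $ i * x $ j * R $$ (i, j))"
    proof (intro sums_sum sums_mult)
      fix i j assume ij: "i \<in> {..<n}" "j \<in> {..<n}"
      then show "(\<lambda>k. sqrt_coeff k * (B ^\<^sub>m k) $$ (i, j)) sums R $$ (i, j)"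
        using summable_sums[OF summable_norm_cancel[OF summ[of i j]]] by (simp add: R_def)
    qed
    moreover have "(\<Sum>i<n. \<Sum>j<n. x $ i * x $ j * (sqrt_coeff k * (B ^\<^sub>m k) $$ (i, j))) =
        sqrt_coeff k * (x \<bullet> (B ^\<^sub>m k *\<^sub>v x))" for k
      using form[OF x x c] by (simp add: sum_distrib_left ac_simps)
    ultimately have lim: "(\<lambda>m. \<Sum>k<m. sqrt_coeff k * (x \<bullet> (B ^\<^sub>m k *\<^sub>v x))) \<longlonglongrightarrow> x \<bullet> (R *\<^sub>v x)"
      using form[OF x x R] by (simp add: sums_def)
    \<comment> \<open>Beyond k = 0 the coefficients are nonpositive and the forms of the powers are
      at most x . x. Replacing every form by x . x therefore only lowers the partial sum, and leaves
      a nonnegative partial sum of coefficients times x . x.\<close>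
    have "0 \<le> (\<Sum>k<m. sqrt_coeff k * (x \<bullet> (B ^\<^sub>m k *\<^sub>v x)))" for m
    proof (cases m)
      case (Suc m')
      have "0 \<le> (\<Sum>k\<le>m'. sqrt_coeff k) * (x \<bullet> x)"
        using sqrt_coeff_partial_sum_nonneg scalar_prod_self_nonneg by simp
      also have "\<dots> \<le> (\<Sum>k\<le>m'. sqrt_coeff k * (x \<bullet> (B ^\<^sub>m k *\<^sub>v x)))"
        unfolding sum_distrib_right
      proof (rule sum_mono)
        fix k
        show "sqrt_coeff k * (x \<bullet> x) \<le> sqrt_coeff k * (x \<bullet> (B ^\<^sub>m k *\<^sub>v x))"
        proof (cases k)
          case 0
          then show ?thesis using x B by simp
        next
          case (Suc j)
          then show ?thesis
            using sqrt_coeff_nonpos[of j] pw2[OF x, of k] by (intro mult_left_mono_neg) auto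
        qed
      qed
      finally show ?thesis using Suc by (simp add: lessThan_Suc_atMost)
    qed simp
    then show "0 \<le> x \<bullet> (R *\<^sub>v x)" by (intro LIMSEQ_le_const[OF lim]) auto
  qed
  with R sq that show thesis by blast
qed

lemma sym_psd_sqrt_exists:
  assumes A: "A \<in> carrier_mat n n" "sym_psd A"
  shows "\<exists>R\<in>carrier_mat n n. sym_psd R \<and> R * R = A"
proof -
  \<comment> \<open>Scaling by a number above the spectral norm puts 1 - A / c between 0 and 1;
    adding 1 keeps c positive for A = 0.\<close>
  define c where "c = \<bar>spectral_norm A\<bar> + 1"
  have c: "0 < c" by (simp add: c_def)
  have sym: "A\<^sup>T = A" using A by (simp add: sym_psd_def)
  define B where "B = 1\<^sub>m n - (1 / c) \<cdot>\<^sub>m A"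
  have B: "B \<in> carrier_mat n n" "B\<^sup>T = B"
    using A sym by (auto simp: B_def intro!: eq_matI)
      (metis carrier_matD index_transpose_mat(1))+
  have "0 \<le> x \<bullet> (B *\<^sub>v x) \<and> x \<bullet> (B *\<^sub>v x) \<le> x \<bullet> x" if x: "x \<in> carrier_vec n" for x
  proof -
    have eq: "x \<bullet> (B *\<^sub>v x) = x \<bullet> x - (1 / c) * (x \<bullet> (A *\<^sub>v x))"
      using A x by (simp add: B_def minus_mult_distrib_mat_vec[of _ n n] smult_mat_mult_vec[of _ n n]
          scalar_prod_minus_distrib[of _ n])
    moreover have "0 \<le> x \<bullet> (A *\<^sub>v x)" using A x by (auto simp: sym_psd_def)
    moreover have "x \<bullet> (A *\<^sub>v x) \<le> c * (x \<bullet> x)"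
      using abs_le_D1[OF spectral_norm_form_bound[OF A(1) x, of c]] by (simp add: c_def)
    ultimately have "0 \<le> (1 / c) * (x \<bullet> (A *\<^sub>v x))" "(1 / c) * (x \<bullet> (A *\<^sub>v x)) \<le> x \<bullet> x"
      using c by (auto simp: field_simps)
    then show ?thesis using eq by linarith
  qed
  then obtain R where R: "R \<in> carrier_mat n n" "sym_psd R" "R * R = 1\<^sub>m n - B"
    using sym_psd_sqrt_contraction[OF B] by blast
  have "1\<^sub>m n - B = (1 / c) \<cdot>\<^sub>m A" using A by (auto simp: B_def)
  moreover have "1 \<cdot>\<^sub>m A = A" by (intro eq_matI) auto
  ultimately have "(sqrt c \<cdot>\<^sub>m R) * (sqrt c \<cdot>\<^sub>m R) = A"
    using R c A by (simp add: mult_smult_assoc_mat[of _ n n _ n] mult_smult_distrib[of _ n n _ n]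
        smult_smult_mat)
  moreover have "sym_psd (sqrt c \<cdot>\<^sub>m R)"
    using R c by (auto simp: sym_psd_def smult_mat_mult_vec[of _ n n] transpose_smult_mat)
  ultimately show ?thesis using R by (intro bexI[of _ "sqrt c \<cdot>\<^sub>m R"]) auto
qed

lemma msqrt_props:
  assumes "A \<in> carrier_mat n n" "sym_psd A"
  shows "msqrt A \<in> carrier_mat n n" "(msqrt A)\<^sup>T = msqrt A" "msqrt A * msqrt A = A"
proof -
  have "\<exists>R. R \<in> carrier_mat (dim_row A) (dim_col A) \<and> sym_psd R \<and> R * R = A"
    using sym_psd_sqrt_exists[OF assms] assms(1) by auto
  from someI_ex[OF this] show "msqrt A \<in> carrier_mat n n" "(msqrt A)\<^sup>T = msqrt A" "msqrt A * msqrt A = A"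
    using assms(1) unfolding msqrt_def sym_psd_def by auto
qed

lemma sym_pos_def_imp_sym_psd:
  assumes "A \<in> carrier_mat n n" "sym_pos_def A"
  shows "sym_psd A"
  using sym_pos_def_form_nonneg[OF assms] assms by (auto simp: sym_psd_def sym_pos_def_def)

lemma msqrt_form:
  assumes A: "A \<in> carrier_mat n n" "sym_psd A" and xy: "x \<in> carrier_vec n" "y \<in> carrier_vec n"
  shows "(msqrt A *\<^sub>v x) \<bullet> (msqrt A *\<^sub>v y) = x \<bullet> (A *\<^sub>v y)"
proof -
  note r = msqrt_props[OF A]
  have "x \<bullet> (A *\<^sub>v y) = x \<bullet> (msqrt A *\<^sub>v (msqrt A *\<^sub>v y))"
    using r xy by (metis assoc_mult_mat_vec)
  then show ?thesis
    using symmetric_form_left[OF r(1,2) xy(1), of "msqrt A *\<^sub>v y"] r xy by simp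
qed

lemma psd_form_Cauchy_Schwarz:
  assumes A: "A \<in> carrier_mat n n" "sym_psd A" and xy: "x \<in> carrier_vec n" "y \<in> carrier_vec n"
  shows "\<bar>x \<bullet> (A *\<^sub>v y)\<bar> \<le> euclidean_norm (msqrt A *\<^sub>v x) * euclidean_norm (msqrt A *\<^sub>v y)"
  using scalar_prod_Cauchy_Schwarz[of "msqrt A *\<^sub>v x" n "msqrt A *\<^sub>v y"] msqrt_props(1)[OF A] xy
  by (simp add: msqrt_form[OF A])

text \<open>With z = R x for the root R of A one has A x = R z and z . z equal to the form of A at
  x. This serves twice: with the splitting matrix for the approximation property, and with the
  target precision for the initial covariance.\<close>

lemma spectral_norm_sandwich:
  assumes A: "A \<in> carrier_mat n n" "sym_psd A" and E: "E \<in> carrier_mat n n"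
    and C: "spectral_norm (msqrt A * E * msqrt A) \<le> C" and x: "x \<in> carrier_vec n"
  shows "\<bar>(A *\<^sub>v x) \<bullet> (E *\<^sub>v (A *\<^sub>v x))\<bar> \<le> C * (x \<bullet> (A *\<^sub>v x))"
proof -
  let ?R = "msqrt A"
  let ?z = "?R *\<^sub>v x"
  note r = msqrt_props[OF A]
  have z: "?z \<in> carrier_vec n" using r x by simp
  have Ax: "A *\<^sub>v x = ?R *\<^sub>v ?z" using r x by (metis assoc_mult_mat_vec)
  have Ez: "E *\<^sub>v (?R *\<^sub>v ?z) \<in> carrier_vec n" using r z E by simp
  have "(A *\<^sub>v x) \<bullet> (E *\<^sub>v (A *\<^sub>v x)) = ?z \<bullet> (?R *\<^sub>v (E *\<^sub>v (?R *\<^sub>v ?z)))"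
    unfolding Ax by (rule symmetric_form_left[OF r(1,2) z Ez])
  also have "?R *\<^sub>v (E *\<^sub>v (?R *\<^sub>v ?z)) = (?R * E * ?R) *\<^sub>v ?z"
    using r E z by (simp add: assoc_mult_mat_vec[of _ n n _ n])
  finally show ?thesis
    using spectral_norm_form_bound[of "?R * E * ?R" n ?z C] r E z C msqrt_form[OF A x x] by simp
qed

section \<open>Convergence of the V-cycle in the energy norm\<close>

locale spd_splitting =
  fixes n :: nat and A M :: "real mat"
  assumes A: "A \<in> carrier_mat n n" "sym_pos_def A"
    and M: "M \<in> carrier_mat n n" "M\<^sup>T = M" "loewner_le A M"
begin

lemma A_sym: "A\<^sup>T = A"
  using A by (simp add: sym_pos_def_def)

lemma M_pos_def: "sym_pos_def M"
  unfolding sym_pos_def_def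
proof (intro conjI ballI impI)
  fix x :: "real vec"
  assume "x \<in> carrier_vec (dim_col M)" "x \<noteq> 0\<^sub>v (dim_col M)"
  then show "0 < x \<bullet> (M *\<^sub>v x)"
    using loewner_leD[OF A(1) M(1,3), of x] sym_pos_def_form_pos[OF A, of x] M(1) by auto
qed (rule M(2))

lemma A_form_commute:
  "x \<in> carrier_vec n \<Longrightarrow> y \<in> carrier_vec n \<Longrightarrow> x \<bullet> (A *\<^sub>v y) = y \<bullet> (A *\<^sub>v x)"
  by (rule symmetric_form_commute[OF A(1) A_sym])

text \<open>The operator X = M^-1 A of the overview.\<close>

definition correction :: "real vec \<Rightarrow> real vec" where
  "correction x = minv M *\<^sub>v (A *\<^sub>v x)"

definition smooth_err :: "real vec \<Rightarrow> real vec" where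
  "smooth_err x = x - correction x"

lemma correction_carrier [simp]: "x \<in> carrier_vec n \<Longrightarrow> correction x \<in> carrier_vec n"
  using A minv_mult_vec(1)[OF M(1) M_pos_def] by (simp add: correction_def)

lemma smooth_err_carrier [simp]: "x \<in> carrier_vec n \<Longrightarrow> smooth_err x \<in> carrier_vec n"
  by (simp add: smooth_err_def)

lemma M_correction: "x \<in> carrier_vec n \<Longrightarrow> M *\<^sub>v correction x = A *\<^sub>v x"
  using A minv_mult_vec(2)[OF M(1) M_pos_def] by (simp add: correction_def)

lemma smooth_err_pow_carrier [simp]: "x \<in> carrier_vec n \<Longrightarrow> (smooth_err ^^ k) x \<in> carrier_vec n"
  by (induction k) auto

lemma correction_form:
  assumes "x \<in> carrier_vec n" "y \<in> carrier_vec n"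
  shows "x \<bullet> (A *\<^sub>v correction y) = (A *\<^sub>v x) \<bullet> (minv M *\<^sub>v (A *\<^sub>v y))"
  using symmetric_form_left[OF A(1) A_sym assms(1) correction_carrier[OF assms(2)]]
  by (simp add: correction_def)

text \<open>As a matrix M^-1 A need not be symmetric; in the energy product it gives the form of A
  M^-1 A, which is.\<close>

lemma correction_form_commute:
  assumes "x \<in> carrier_vec n" "y \<in> carrier_vec n"
  shows "x \<bullet> (A *\<^sub>v correction y) = correction x \<bullet> (A *\<^sub>v y)"
proof -
  have "x \<bullet> (A *\<^sub>v correction y) = y \<bullet> (A *\<^sub>v correction x)"
    using assms A minv_form_commute[OF M(1) M_pos_def] by (simp add: correction_form)
  then show ?thesis using A_form_commute[of y "correction x"] assms by simp
qed

lemma smooth_err_form: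
  assumes "x \<in> carrier_vec n" "y \<in> carrier_vec n"
  shows "x \<bullet> (A *\<^sub>v smooth_err y) = x \<bullet> (A *\<^sub>v y) - x \<bullet> (A *\<^sub>v correction y)"
  using assms A
  by (simp add: smooth_err_def mult_minus_distrib_mat_vec[of _ n n] scalar_prod_minus_distrib[of _ n])

lemma smooth_err_form_left:
  assumes "x \<in> carrier_vec n" "y \<in> carrier_vec n"
  shows "smooth_err x \<bullet> (A *\<^sub>v y) = x \<bullet> (A *\<^sub>v y) - x \<bullet> (A *\<^sub>v correction y)"
  using assms A correction_form_commute[OF assms]
  by (simp add: smooth_err_def minus_scalar_prod_distrib[of _ n])

lemma smooth_err_pow_form:
  assumes "x \<in> carrier_vec n" "y \<in> carrier_vec n"
  shows "x \<bullet> (A *\<^sub>v (smooth_err ^^ k) y) = (smooth_err ^^ k) x \<bullet> (A *\<^sub>v y)"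
  using assms
proof (induction k arbitrary: x)
  case (Suc k)
  have "x \<bullet> (A *\<^sub>v (smooth_err ^^ Suc k) y) = smooth_err x \<bullet> (A *\<^sub>v (smooth_err ^^ k) y)"
    using Suc.prems by (simp add: smooth_err_form smooth_err_form_left)
  also have "\<dots> = (smooth_err ^^ k) (smooth_err x) \<bullet> (A *\<^sub>v y)"
    using Suc by simp
  finally show ?case by (simp add: funpow_swap1)
qed simp

text \<open>This is X <= 1. Since A <= M, z = X x satisfies |z|^2 <= <x, z> in the energy product;
  expanding |x - z|^2 >= 0 then gives <x, z> <= |x|^2.\<close>

lemma correction_form_le:
  assumes x: "x \<in> carrier_vec n"
  shows "x \<bullet> (A *\<^sub>v correction x) \<le> x \<bullet> (A *\<^sub>v x)"
proof -
  let ?z = "correction x"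
  have z: "?z \<in> carrier_vec n" using x by simp
  have "?z \<bullet> (A *\<^sub>v ?z) \<le> ?z \<bullet> (M *\<^sub>v ?z)"
    using loewner_leD[OF A(1) M(1,3) z] .
  also have "\<dots> = x \<bullet> (A *\<^sub>v ?z)"
    using x z by (simp add: M_correction A_form_commute[of _ x])
  finally have "?z \<bullet> (A *\<^sub>v ?z) \<le> x \<bullet> (A *\<^sub>v ?z)" .
  moreover have "0 \<le> (x - ?z) \<bullet> (A *\<^sub>v (x - ?z))"
    using x z by (intro sym_pos_def_form_nonneg[OF A]) simp
  ultimately show ?thesis
    using quadratic_form_diff[OF A(1) A_sym x z] by linarith
qed

text \<open>Half of the factors are moved to the left. An even power becomes a norm squared; an odd
  one leaves a single S, nonnegative because X <= 1.\<close>

lemma smooth_err_pow_form_nonneg: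
  assumes x: "x \<in> carrier_vec n"
  shows "0 \<le> x \<bullet> (A *\<^sub>v (smooth_err ^^ k) x)"
proof -
  define j where "j = k div 2"
  let ?w = "(smooth_err ^^ j) x"
  have w: "?w \<in> carrier_vec n" using x by simp
  consider "k = j + j" | "k = Suc (j + j)" unfolding j_def by linarith
  then show ?thesis
  proof cases
    case 1
    then have "x \<bullet> (A *\<^sub>v (smooth_err ^^ k) x) = ?w \<bullet> (A *\<^sub>v ?w)"
      using smooth_err_pow_form[OF x w, of j] by (simp add: funpow_add)
    then show ?thesis using sym_pos_def_form_nonneg[OF A w] by simp
  next
    case 2
    then have "x \<bullet> (A *\<^sub>v (smooth_err ^^ k) x) = ?w \<bullet> (A *\<^sub>v smooth_err ?w)"
      using smooth_err_pow_form[OF x smooth_err_carrier[OF w], of j] by (simp add: funpow_add funpow_swap1)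
    then show ?thesis using correction_form_le[OF w] w by (simp add: smooth_err_form)
  qed
qed

text \<open>The moments \<open>h j = \<langle>x, S\<^sup>j x\<rangle>\<close> of the smoother \<open>S\<close> form a completely monotone sequence;
  its first and second differences replace the spectral estimate \<open>(1 - t)\<^sup>\<nu> (1 + \<nu> t) \<le> 1\<close>.\<close>

lemma smoothing_property:
  fixes k :: nat
  assumes x: "x \<in> carrier_vec n"
  defines "w \<equiv> (smooth_err ^^ k) x"
  shows "w \<bullet> (A *\<^sub>v w) + 2 * real k * ((A *\<^sub>v w) \<bullet> (minv M *\<^sub>v (A *\<^sub>v w))) \<le> x \<bullet> (A *\<^sub>v x)"
proof -
  define h where "h j = x \<bullet> (A *\<^sub>v (smooth_err ^^ j) x)" for j
  define d where "d j = h j - h (Suc j)" for j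
  \<comment> \<open>The first difference is the form of S^j X at x, because 1 - S = X.\<close>
  have d: "d j = (smooth_err ^^ j) x \<bullet> (A *\<^sub>v correction x)" for j
    using x smooth_err_pow_form[OF x x, of j] smooth_err_pow_form[OF x, of "smooth_err x" j]
    by (simp add: d_def h_def smooth_err_form funpow_swap1)
  \<comment> \<open>The second difference is the form of S^j at X x, hence nonnegative.\<close>
  have dec: "d (Suc j) \<le> d j" for j
  proof -
    let ?c = "correction x"
    have c: "?c \<in> carrier_vec n" "(smooth_err ^^ j) ?c \<in> carrier_vec n" using x by auto
    have "d j - d (Suc j) = x \<bullet> (A *\<^sub>v (smooth_err ^^ j) ?c) - smooth_err x \<bullet> (A *\<^sub>v (smooth_err ^^ j) ?c)"
      using x c smooth_err_pow_form[OF x c(1), of j] smooth_err_pow_form[OF _ c(1), of "smooth_err x" j]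
      by (simp add: d funpow_swap1)
    also have "\<dots> = ?c \<bullet> (A *\<^sub>v (smooth_err ^^ j) ?c)"
      using x c by (simp add: smooth_err_form_left correction_form_commute)
    also have "\<dots> \<ge> 0" by (rule smooth_err_pow_form_nonneg[OF c(1)])
    finally show ?thesis by simp
  qed
  \<comment> \<open>h 0 - h j telescopes into j decreasing differences, each at least d j. At j = 2k
    this is the claim, with h (2k) = |S^k x|^2 and d (2k) the form of X at S^k x.\<close>
  have sum: "real j * d j \<le> h 0 - h j" for j
  proof (induction j)
    case (Suc j)
    have "real (Suc j) * d (Suc j) \<le> real (Suc j) * d j"
      using dec by (intro mult_left_mono) auto
    also have "\<dots> \<le> h 0 - h (Suc j)" using Suc by (simp add: d_def algebra_simps)
    finally show ?case .
  qed simp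
  have w: "w \<in> carrier_vec n" using x by (simp add: w_def)
  have h2: "w \<bullet> (A *\<^sub>v w) = h (k + k)"
    using smooth_err_pow_form[OF x w, of k] by (simp add: h_def w_def funpow_add)
  have "w \<bullet> (A *\<^sub>v smooth_err w) = h (Suc (k + k))"
    using smooth_err_pow_form[OF x smooth_err_carrier[OF w], of k]
    by (simp add: h_def w_def funpow_add funpow_swap1)
  then have "(A *\<^sub>v w) \<bullet> (minv M *\<^sub>v (A *\<^sub>v w)) = d (k + k)"
    using w h2 by (simp add: smooth_err_form correction_form d_def)
  then show ?thesis
    using sum[of "k + k"] h2 x by (simp add: h_def algebra_simps)
qed

end

section \<open>Error operator of the V-cycle and its contraction\<close>

locale galerkin_hierarchy =
  fixes n :: "nat \<Rightarrow> nat" and A M I :: "nat \<Rightarrow> real mat" and \<kappa> :: nat and C\<^sub>A :: real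
  assumes A: "A l \<in> carrier_mat (n l) (n l)" "sym_pos_def (A l)"
    and M: "M (Suc l) \<in> carrier_mat (n (Suc l)) (n (Suc l))" "(M (Suc l))\<^sup>T = M (Suc l)"
      "loewner_le (A (Suc l)) (M (Suc l))"
    and I: "I (Suc l) \<in> carrier_mat (n (Suc l)) (n l)"
    and galerkin: "x \<in> carrier_vec (n l) \<Longrightarrow> y \<in> carrier_vec (n l) \<Longrightarrow>
      (I (Suc l) *\<^sub>v x) \<bullet> (A (Suc l) *\<^sub>v (I (Suc l) *\<^sub>v y)) = x \<bullet> (A l *\<^sub>v y)"
    \<comment> \<open>The norm hypothesis as an inequality of forms. At w = A x it says that the
      energy lost by projecting x to the coarse space is at most \<open>C\<^sub>A\<close> times the
      form of X at x.\<close>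
    and approx: "w \<in> carrier_vec (n (Suc l)) \<Longrightarrow>
      w \<bullet> (minv (A (Suc l)) *\<^sub>v w) -
        ((I (Suc l))\<^sup>T *\<^sub>v w) \<bullet> (minv (A l) *\<^sub>v ((I (Suc l))\<^sup>T *\<^sub>v w))
      \<le> C\<^sub>A * (w \<bullet> (minv (M (Suc l)) *\<^sub>v w))"
    and C\<^sub>A_pos: "0 < C\<^sub>A"
begin

sublocale split: spd_splitting "n (Suc l)" "A (Suc l)" "M (Suc l)" for l
  by unfold_locales (use A M in auto)

abbreviation form :: "nat \<Rightarrow> real vec \<Rightarrow> real vec \<Rightarrow> real" where
  "form l x y \<equiv> x \<bullet> (A l *\<^sub>v y)"

lemma form_commute:
  "x \<in> carrier_vec (n l) \<Longrightarrow> y \<in> carrier_vec (n l) \<Longrightarrow> form l x y = form l y x"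
  using symmetric_form_commute[OF A(1), of l] A(2)[of l] by (simp add: sym_pos_def_def)

lemma form_diff_right:
  "\<lbrakk>x \<in> carrier_vec (n l); y \<in> carrier_vec (n l); z \<in> carrier_vec (n l)\<rbrakk> \<Longrightarrow>
    form l x (y - z) = form l x y - form l x z"
  using A(1)[of l] by (simp add: mult_minus_distrib_mat_vec[of _ "n l" "n l"]
      scalar_prod_minus_distrib[of _ "n l"])

lemma form_add_right:
  "\<lbrakk>x \<in> carrier_vec (n l); y \<in> carrier_vec (n l); z \<in> carrier_vec (n l)\<rbrakk> \<Longrightarrow>
    form l x (y + z) = form l x y + form l x z"
  using A(1)[of l] by (simp add: mult_add_distrib_mat_vec[of _ "n l" "n l"]
      scalar_prod_add_distrib[of _ "n l"])

lemma form_diff_left: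
  "\<lbrakk>x \<in> carrier_vec (n l); y \<in> carrier_vec (n l); z \<in> carrier_vec (n l)\<rbrakk> \<Longrightarrow>
    form l (y - z) x = form l y x - form l z x"
  using form_diff_right[of x l y z] form_commute[of x l] by simp

lemma form_nonneg: "x \<in> carrier_vec (n l) \<Longrightarrow> 0 \<le> form l x x"
  by (rule sym_pos_def_form_nonneg[OF A])

text \<open>The energy adjoint of the prolongation. Prolonging \<open>proj l x\<close> gives the
  energy-orthogonal projection of x onto the coarse space.\<close>

definition proj :: "nat \<Rightarrow> real vec \<Rightarrow> real vec" where
  "proj l x = minv (A l) *\<^sub>v ((I (Suc l))\<^sup>T *\<^sub>v (A (Suc l) *\<^sub>v x))"

lemma restrict_carrier [simp]:
  "x \<in> carrier_vec (n (Suc l)) \<Longrightarrow> (I (Suc l))\<^sup>T *\<^sub>v x \<in> carrier_vec (n l)"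
  using I[of l] by (intro mult_mat_vec_carrier[of _ _ "n (Suc l)"]) auto

lemma prolong_carrier [simp]: "x \<in> carrier_vec (n l) \<Longrightarrow> I (Suc l) *\<^sub>v x \<in> carrier_vec (n (Suc l))"
  using I[of l] by simp

lemma A_carrier_vec [simp]: "x \<in> carrier_vec (n l) \<Longrightarrow> A l *\<^sub>v x \<in> carrier_vec (n l)"
  using A(1)[of l] by simp

lemma proj_carrier [simp]: "x \<in> carrier_vec (n (Suc l)) \<Longrightarrow> proj l x \<in> carrier_vec (n l)"
  unfolding proj_def by (intro minv_mult_vec(1)[OF A]) simp

lemma proj_form:
  assumes "x \<in> carrier_vec (n (Suc l))" "z \<in> carrier_vec (n l)"
  shows "form l z (proj l x) = form (Suc l) (I (Suc l) *\<^sub>v z) x"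
  using assms minv_mult_vec(2)[OF A, of "(I (Suc l))\<^sup>T *\<^sub>v (A (Suc l) *\<^sub>v x)" l]
  by (simp add: proj_def scalar_prod_transpose[OF I])

lemma prolong_form:
  assumes "x \<in> carrier_vec (n (Suc l))" "z \<in> carrier_vec (n l)"
  shows "form (Suc l) x (I (Suc l) *\<^sub>v z) = form l (proj l x) z"
  using proj_form[OF assms] form_commute[of x "Suc l" "I (Suc l) *\<^sub>v z"]
    form_commute[of "proj l x" l z] assms by simp

text \<open>On level 0 the exact sampler forgets the state, so the error operator is 0. A coarse
  cycle started at 0 delivers the exact coarse correction except for its image under the coarse
  error operator, which explains the difference in the last line.\<close>

primrec vcycle_err :: "nat \<Rightarrow> real vec \<Rightarrow> real vec" where
  "vcycle_err 0 x = 0\<^sub>v (n 0)"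
| "vcycle_err (Suc l) x =
    (let w = (split.smooth_err l ^^ \<kappa>) x
     in (split.smooth_err l ^^ \<kappa>) (w - I (Suc l) *\<^sub>v (proj l w - vcycle_err l (proj l w))))"

definition coarse_err :: "nat \<Rightarrow> real vec \<Rightarrow> real vec" where
  "coarse_err l w = w - I (Suc l) *\<^sub>v (proj l w - vcycle_err l (proj l w))"

lemma vcycle_err_Suc:
  "vcycle_err (Suc l) x =
    (split.smooth_err l ^^ \<kappa>) (coarse_err l ((split.smooth_err l ^^ \<kappa>) x))"
  by (simp add: coarse_err_def Let_def)

declare vcycle_err.simps(2) [simp del]

lemma vcycle_err_carrier [simp]: "x \<in> carrier_vec (n l) \<Longrightarrow> vcycle_err l x \<in> carrier_vec (n l)"
  by (induction l arbitrary: x) (auto simp: vcycle_err_Suc coarse_err_def)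

lemma coarse_err_carrier [simp]:
  "x \<in> carrier_vec (n (Suc l)) \<Longrightarrow> coarse_err l x \<in> carrier_vec (n (Suc l))"
  by (simp add: coarse_err_def)

lemma coarse_err_form:
  assumes "x \<in> carrier_vec (n (Suc l))" "y \<in> carrier_vec (n (Suc l))"
  shows "form (Suc l) x (coarse_err l y) = form (Suc l) x y -
    form l (proj l x) (proj l y) + form l (proj l x) (vcycle_err l (proj l y))"
  using assms by (simp add: coarse_err_def form_diff_right prolong_form)

text \<open>\<open>coarse_err\<close> is the identity on the orthogonal complement of the coarse
  space and acts as \<open>vcycle_err l\<close> on the coarse space, so Pythagoras applies. The
  identity balances the target variances in the coarse step.\<close>

lemma coarse_err_norm:
  assumes "x \<in> carrier_vec (n (Suc l))"
  shows "form (Suc l) (coarse_err l x) (coarse_err l x) = form (Suc l) x x -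
    form l (proj l x) (proj l x) + form l (vcycle_err l (proj l x)) (vcycle_err l (proj l x))"
proof -
  let ?p = "proj l x" and ?e = "vcycle_err l (proj l x)"
  let ?z = "?p - ?e"
  have c: "?p \<in> carrier_vec (n l)" "?e \<in> carrier_vec (n l)" using assms by auto
  have "form (Suc l) (coarse_err l x) (coarse_err l x) =
      form (Suc l) x x - 2 * form l ?p ?z + form l ?z ?z"
    unfolding coarse_err_def
    using assms c quadratic_form_diff[OF A(1) split.A_sym, of x l "I (Suc l) *\<^sub>v ?z"]
    by (simp add: prolong_form[of x l ?z] galerkin)
  then show ?thesis
    using c form_commute[OF c] by (simp add: form_diff_right form_diff_left)
qed

text \<open>The cycle is a palindrome: equally many self-adjoint smoothing steps on both sides of a
  coarse correction that is self-adjoint by induction.\<close>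

lemma vcycle_err_commute:
  "\<lbrakk>x \<in> carrier_vec (n l); y \<in> carrier_vec (n l)\<rbrakk> \<Longrightarrow>
    form l x (vcycle_err l y) = form l (vcycle_err l x) y"
proof (induction l arbitrary: x y)
  case 0
  then show ?case by (simp add: mult_mat_zero_vec[OF A(1)])
next
  case (Suc l)
  let ?S = "split.smooth_err l ^^ \<kappa>"
  have c: "?S x \<in> carrier_vec (n (Suc l))" "?S y \<in> carrier_vec (n (Suc l))" using Suc.prems by auto
  have K: "form (Suc l) u (coarse_err l v) = form (Suc l) (coarse_err l u) v"
    if "u \<in> carrier_vec (n (Suc l))" "v \<in> carrier_vec (n (Suc l))" for u v
  proof -
    have "form (Suc l) (coarse_err l u) v = form (Suc l) v (coarse_err l u)"
      using that by (intro form_commute) auto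
    also have "\<dots> = form (Suc l) u (coarse_err l v)"
      using that Suc.IH[of "proj l v" "proj l u"] form_commute[of v "Suc l" u]
        form_commute[of "proj l v" l "proj l u"]
        form_commute[of "vcycle_err l (proj l v)" l "proj l u"]
      by (simp add: coarse_err_form)
    finally show ?thesis by simp
  qed
  have "form (Suc l) x (vcycle_err (Suc l) y) = form (Suc l) (?S x) (coarse_err l (?S y))"
    using Suc.prems c by (simp add: vcycle_err_Suc split.smooth_err_pow_form)
  also have "\<dots> = form (Suc l) (coarse_err l (?S x)) (?S y)"
    using K[OF c] .
  also have "\<dots> = form (Suc l) (vcycle_err (Suc l) x) y"
    using Suc.prems c by (simp add: vcycle_err_Suc split.smooth_err_pow_form)
  finally show ?case .
qed

text \<open>The value z with (1 - z) \<open>C\<^sub>A\<close> = 2 \<open>\<kappa>\<close> z. It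
  makes the bound reproduce itself from level to level; 2 \<open>\<kappa>\<close> is the total
  number of smoothing steps.\<close>

definition rate :: real where "rate = C\<^sub>A / (C\<^sub>A + 2 * real \<kappa>)"

lemma rate_pos: "0 < rate" and rate_le_1: "rate \<le> 1"
  using C\<^sub>A_pos by (auto simp: rate_def)

text \<open>Both parts concern Q of the overview. Its form at w is the squared norm of w minus its
  coarse projection, hence nonnegative; the upper bound is \<open>approx\<close> at A w.\<close>

lemma proj_defect:
  assumes w: "w \<in> carrier_vec (n (Suc l))"
  shows "form l (proj l w) (proj l w) \<le> form (Suc l) w w"
    and "form (Suc l) w w - form l (proj l w) (proj l w) \<le>
      C\<^sub>A * ((A (Suc l) *\<^sub>v w) \<bullet> (minv (M (Suc l)) *\<^sub>v (A (Suc l) *\<^sub>v w)))"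
proof -
  let ?p = "proj l w" and ?A = "A (Suc l)"
  have p: "?p \<in> carrier_vec (n l)" using w by simp
  have "0 \<le> form (Suc l) (w - I (Suc l) *\<^sub>v ?p) (w - I (Suc l) *\<^sub>v ?p)"
    using w p by (intro form_nonneg) auto
  also have "\<dots> = form (Suc l) w w - form l ?p ?p"
    using quadratic_form_diff[OF A(1) split.A_sym w prolong_carrier[OF p]]
      prolong_form[OF w p] galerkin[OF p p] by simp
  finally show "form l (proj l w) (proj l w) \<le> form (Suc l) w w" by simp
  have "(?A *\<^sub>v w) \<bullet> (minv ?A *\<^sub>v (?A *\<^sub>v w)) = form (Suc l) w w"
    using minv_mult_vec(3)[OF A w] w comm_scalar_prod[of "?A *\<^sub>v w" "n (Suc l)" w] by simp
  moreover have "((I (Suc l))\<^sup>T *\<^sub>v (?A *\<^sub>v w)) \<bullet> ?p = form l ?p ?p"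
    using w p minv_mult_vec(2)[OF A, of "(I (Suc l))\<^sup>T *\<^sub>v (?A *\<^sub>v w)" l]
      comm_scalar_prod[of "(I (Suc l))\<^sup>T *\<^sub>v (?A *\<^sub>v w)" "n l" ?p]
    by (simp add: proj_def)
  ultimately show "form (Suc l) w w - form l (proj l w) (proj l w) \<le>
      C\<^sub>A * ((?A *\<^sub>v w) \<bullet> (minv (M (Suc l)) *\<^sub>v (?A *\<^sub>v w)))"
    using approx[of "?A *\<^sub>v w" l] w by (simp add: proj_def)
qed

lemma vcycle_err_bounds:
  "x \<in> carrier_vec (n l) \<Longrightarrow>
    0 \<le> form l x (vcycle_err l x) \<and> form l x (vcycle_err l x) \<le> rate * form l x x"
proof (induction l arbitrary: x)
  case 0
  then show ?case using form_nonneg[OF 0] rate_pos by (simp add: mult_mat_zero_vec[OF A(1)])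
next
  case (Suc l)
  define w where "w = (split.smooth_err l ^^ \<kappa>) x"
  have w: "w \<in> carrier_vec (n (Suc l))" using Suc.prems by (simp add: w_def)
  define p where "p = proj l w"
  have p: "p \<in> carrier_vec (n l)" using w by (simp add: p_def)
  define d where "d = form (Suc l) w w - form l p p"
  define c where "c = (A (Suc l) *\<^sub>v w) \<bullet> (minv (M (Suc l)) *\<^sub>v (A (Suc l) *\<^sub>v w))"
  have d: "0 \<le> d" "d \<le> C\<^sub>A * c"
    using proj_defect[OF w] by (auto simp: d_def c_def p_def)
  have "form (Suc l) x (vcycle_err (Suc l) x) = form (Suc l) w (coarse_err l w)"
    using Suc.prems w by (simp add: vcycle_err_Suc split.smooth_err_pow_form w_def)
  also have "\<dots> = d + form l p (vcycle_err l p)"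
    using w by (simp add: coarse_err_form d_def p_def)
  finally have eq: "form (Suc l) x (vcycle_err (Suc l) x) = d + form l p (vcycle_err l p)" .
  have r: "1 - rate = 2 * real \<kappa> / (C\<^sub>A + 2 * real \<kappa>)"
    using C\<^sub>A_pos by (simp add: rate_def field_simps)
  have "d + form l p (vcycle_err l p) \<le> d + rate * form l p p"
    using Suc.IH[OF p] by simp
  also have "\<dots> = rate * form (Suc l) w w + (1 - rate) * d"
    by (simp add: d_def algebra_simps)
  \<comment> \<open>d is the energy of the part of w orthogonal to the coarse space, which the
    coarse correction leaves alone. Its excess weight 1 - \<open>rate\<close> is nonnegative and is
    paid for by the approximation property, then absorbed by the smoothing property.\<close>
  also have "\<dots> \<le> rate * form (Suc l) w w + (1 - rate) * (C\<^sub>A * c)"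
    using d rate_le_1 by (intro add_left_mono mult_left_mono) auto
  also have "\<dots> = rate * (form (Suc l) w w + 2 * real \<kappa> * c)"
    unfolding r by (simp add: rate_def algebra_simps)
  also have "\<dots> \<le> rate * form (Suc l) x x"
    using split.smoothing_property[OF Suc.prems, of \<kappa>] rate_pos
    by (intro mult_left_mono) (auto simp: w_def c_def)
  finally show ?case using eq d Suc.IH[OF p] by simp
qed

text \<open>From forms to norms: with e = E x, s = 1 / \<open>rate\<close> and positivity of E at x
  - s e, 2 s |e|^2 <= <x, E x> + s^2 <e, E e>. The upper bound on the form of E makes the right side
  at most \<open>rate\<close> |x|^2 + s |e|^2.\<close>

lemma vcycle_err_contraction:
  assumes x: "x \<in> carrier_vec (n l)"
  shows "form l (vcycle_err l x) (vcycle_err l x) \<le> rate\<^sup>2 * form l x x"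
proof -
  define e where "e = vcycle_err l x"
  have e: "e \<in> carrier_vec (n l)" using x by (simp add: e_def)
  define s where "s = 1 / rate"
  have s: "s * rate = 1" "0 < s" using rate_pos by (auto simp: s_def)
  define y where "y = x - s \<cdot>\<^sub>v e"
  have y: "y \<in> carrier_vec (n l)" using x e by (simp add: y_def)
  have sm: "form l u (s \<cdot>\<^sub>v v) = s * form l u v" if "u \<in> carrier_vec (n l)" "v \<in> carrier_vec (n l)" for u v
    using that A(1)[of l] by (simp add: mult_mat_vec[of _ "n l" "n l"])
  have Ey: "vcycle_err l y \<in> carrier_vec (n l)" and Ee: "vcycle_err l e \<in> carrier_vec (n l)"
    using y e by auto
  have right: "form l u y = form l u x - s * form l u e" if "u \<in> carrier_vec (n l)" for u
    unfolding y_def using form_diff_right[OF that x, of "s \<cdot>\<^sub>v e"] sm[OF that e] e by simp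
  have Eyx: "form l (vcycle_err l y) x = form l x e - s * form l e e"
    using vcycle_err_commute[OF y x] form_commute[OF y e] right[OF e] form_commute[OF e x]
    by (simp add: e_def)
  have Eye: "form l (vcycle_err l y) e = form l e e - s * form l e (vcycle_err l e)"
    using vcycle_err_commute[OF y e] form_commute[OF y Ee] right[OF Ee] form_commute[OF Ee x]
      vcycle_err_commute[OF x e] form_commute[OF Ee e] by (simp add: e_def)
  have "0 \<le> form l y (vcycle_err l y)" using vcycle_err_bounds[OF y] by simp
  also have "\<dots> = form l (vcycle_err l y) x - s * form l (vcycle_err l y) e"
    using vcycle_err_commute[OF y y] right[OF Ey] by simp
  also have "\<dots> = form l x e - s * form l e e - s * (form l e e - s * form l e (vcycle_err l e))"
    by (simp only: Eyx Eye)
  finally have "2 * s * form l e e \<le> form l x e + s\<^sup>2 * form l e (vcycle_err l e)"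
    by (simp add: algebra_simps power2_eq_square)
  then have "2 * s * form l e e \<le> form l x (vcycle_err l x) + s\<^sup>2 * form l e (vcycle_err l e)"
    by (simp only: e_def)
  also have "form l x (vcycle_err l x) + s\<^sup>2 * form l e (vcycle_err l e) \<le> rate * form l x x + s\<^sup>2 * (rate * form l e e)"
    using vcycle_err_bounds[OF x] vcycle_err_bounds[OF e] by (intro add_mono mult_left_mono) auto
  also have "s\<^sup>2 * (rate * form l e e) = s * form l e e"
    using s by (simp add: power2_eq_square algebra_simps)
  finally have "s * form l e e \<le> rate * form l x x" by simp
  then have "rate * (s * form l e e) \<le> rate * (rate * form l x x)"
    using rate_pos by simp
  moreover have "rate * (s * form l e e) = form l e e"
    using s(1) by (metis mult.assoc mult.commute mult_1)
  ultimately have "form l e e \<le> rate * (rate * form l x x)" by (simp only:)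
  then show ?thesis by (simp add: e_def power2_eq_square mult.assoc)
qed

lemma vcycle_err_pow_carrier [simp]:
  "x \<in> carrier_vec (n l) \<Longrightarrow> (vcycle_err l ^^ m) x \<in> carrier_vec (n l)"
  by (induction m) auto

lemma vcycle_err_pow_contraction:
  assumes x: "x \<in> carrier_vec (n l)"
  shows "form l ((vcycle_err l ^^ m) x) ((vcycle_err l ^^ m) x) \<le> rate ^ (2 * m) * form l x x"
proof (induction m)
  case (Suc m)
  let ?y = "(vcycle_err l ^^ m) x"
  have "form l (vcycle_err l ?y) (vcycle_err l ?y) \<le> rate\<^sup>2 * form l ?y ?y"
    using x by (intro vcycle_err_contraction) simp
  also have "\<dots> \<le> rate\<^sup>2 * (rate ^ (2 * m) * form l x x)"
    using Suc rate_pos by (intro mult_left_mono) auto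
  finally show ?case by (simp add: power_add power2_eq_square mult.assoc)
qed simp

end

section \<open>Second-order theory of random variables\<close>

text \<open>A Bochner integral is 0 where integrability fails, so \<open>covariance\<close> is
  bilinear only under a condition such as this one, and the propagation lemmas carry it
  along.\<close>

definition sq_integrable :: "'w measure \<Rightarrow> ('w \<Rightarrow> real) \<Rightarrow> bool" where
  "sq_integrable M X \<longleftrightarrow> X \<in> borel_measurable M \<and> integrable M (\<lambda>\<omega>. (X \<omega>)\<^sup>2)"

lemma sq_integrable_cong:
  assumes "\<And>\<omega>. \<omega> \<in> space M \<Longrightarrow> X \<omega> = Y \<omega>"
  shows "sq_integrable M X \<longleftrightarrow> sq_integrable M Y"
  unfolding sq_integrable_def using assms
  by (intro conj_cong measurable_cong Bochner_Integration.integrable_cong) auto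

lemma covariance_cong:
  assumes "\<And>\<omega>. \<omega> \<in> space M \<Longrightarrow> X \<omega> = X' \<omega>" "\<And>\<omega>. \<omega> \<in> space M \<Longrightarrow> Y \<omega> = Y' \<omega>"
  shows "covariance M X Y = covariance M X' Y'"
proof -
  have "(\<integral>\<omega>. X \<omega> \<partial>M) = (\<integral>\<omega>. X' \<omega> \<partial>M)" "(\<integral>\<omega>. Y \<omega> \<partial>M) = (\<integral>\<omega>. Y' \<omega> \<partial>M)"
    using assms by (auto intro: Bochner_Integration.integral_cong)
  then show ?thesis
    unfolding covariance_def using assms by (auto intro!: Bochner_Integration.integral_cong)
qed

lemma covariance_commute: "covariance M X Y = covariance M Y X"
  by (simp add: covariance_def mult.commute)

lemma covariance_self_nonneg: "0 \<le> covariance M X X"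
  unfolding covariance_def by (intro integral_nonneg_AE) auto

lemma sq_integrable_prod:
  assumes "sq_integrable M X" "sq_integrable M Y"
  shows "integrable M (\<lambda>\<omega>. X \<omega> * Y \<omega>)"
proof (rule Bochner_Integration.integrable_bound)
  show "integrable M (\<lambda>\<omega>. (X \<omega>)\<^sup>2 + (Y \<omega>)\<^sup>2)"
    using assms by (auto simp: sq_integrable_def)
  have "\<bar>x * y\<bar> \<le> x\<^sup>2 + y\<^sup>2" for x y :: real
  proof -
    have "2 * \<bar>x * y\<bar> \<le> x\<^sup>2 + y\<^sup>2"
      using sum_squares_bound[of "\<bar>x\<bar>" "\<bar>y\<bar>"] by (simp add: abs_mult mult.assoc)
    then show ?thesis by (smt (verit) abs_ge_zero)
  qed
  then show "AE \<omega> in M. norm (X \<omega> * Y \<omega>) \<le> norm ((X \<omega>)\<^sup>2 + (Y \<omega>)\<^sup>2)"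
    by auto
qed (use assms in \<open>auto simp: sq_integrable_def\<close>)

lemma sq_integrable_cmult:
  "sq_integrable M X \<Longrightarrow> sq_integrable M (\<lambda>\<omega>. c * X \<omega>)"
  by (auto simp: sq_integrable_def power_mult_distrib)

lemma sq_integrable_add:
  assumes "sq_integrable M X" "sq_integrable M Y"
  shows "sq_integrable M (\<lambda>\<omega>. X \<omega> + Y \<omega>)"
proof -
  have "integrable M (\<lambda>\<omega>. (X \<omega>)\<^sup>2 + (Y \<omega>)\<^sup>2 + 2 * (X \<omega> * Y \<omega>))"
    using assms sq_integrable_prod[OF assms] by (auto simp: sq_integrable_def)
  then show ?thesis using assms by (auto simp: sq_integrable_def power2_sum mult.assoc)
qed

context prob_space
begin

lemma sq_integrable_const: "sq_integrable M (\<lambda>_. c)"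
  by (simp add: sq_integrable_def)

lemma sq_integrable_integrable: "sq_integrable M X \<Longrightarrow> integrable M X"
  unfolding sq_integrable_def by (blast intro: square_integrable_imp_integrable)

lemma covariance_eq:
  assumes "sq_integrable M X" "sq_integrable M Y"
  shows "covariance M X Y = expectation (\<lambda>\<omega>. X \<omega> * Y \<omega>) - expectation X * expectation Y"
proof -
  note [simp] = sq_integrable_integrable[OF assms(1)] sq_integrable_integrable[OF assms(2)]
    sq_integrable_prod[OF assms]
  let ?a = "expectation X" and ?b = "expectation Y"
  have "covariance M X Y = (\<integral>\<omega>. X \<omega> * Y \<omega> - ?b * X \<omega> - ?a * Y \<omega> + ?a * ?b \<partial>M)"
    unfolding covariance_def by (intro Bochner_Integration.integral_cong) (auto simp: algebra_simps)
  also have "\<dots> = expectation (\<lambda>\<omega>. X \<omega> * Y \<omega>) - ?b * ?a - ?a * ?b + ?a * ?b"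
    by (simp add: prob_space)
  finally show ?thesis by simp
qed

lemma covariance_add_left:
  assumes "sq_integrable M X" "sq_integrable M X'" "sq_integrable M Y"
  shows "covariance M (\<lambda>\<omega>. X \<omega> + X' \<omega>) Y = covariance M X Y + covariance M X' Y"
  using assms sq_integrable_add[OF assms(1,2)] sq_integrable_integrable sq_integrable_prod[of M _ Y]
  by (simp add: covariance_eq distrib_right)

lemma covariance_cmult_left:
  assumes "sq_integrable M X" "sq_integrable M Y"
  shows "covariance M (\<lambda>\<omega>. c * X \<omega>) Y = c * covariance M X Y"
  using assms sq_integrable_cmult[OF assms(1), of c] sq_integrable_integrable sq_integrable_prod[of M _ Y]
  by (simp add: covariance_eq right_diff_distrib mult.assoc)

lemma covariance_const_left: "covariance M (\<lambda>_. c) Y = 0"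
  by (simp add: covariance_def prob_space)

lemma covariance_add_const_left:
  assumes "sq_integrable M X"
  shows "covariance M (\<lambda>\<omega>. X \<omega> + c) Y = covariance M X Y"
  using sq_integrable_integrable[OF assms] by (simp add: covariance_def prob_space)

lemma covariance_add_const:
  assumes "sq_integrable M X" "sq_integrable M Y"
  shows "covariance M (\<lambda>\<omega>. X \<omega> + c) (\<lambda>\<omega>. Y \<omega> + d) = covariance M X Y"
  using covariance_add_const_left[OF assms(1), of c "\<lambda>\<omega>. Y \<omega> + d"]
    covariance_add_const_left[OF assms(2), of d X] covariance_commute by metis

lemma covariance_add_self:
  assumes "sq_integrable M X" "sq_integrable M Y"
  shows "covariance M (\<lambda>\<omega>. X \<omega> + Y \<omega>) (\<lambda>\<omega>. X \<omega> + Y \<omega>) =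
    covariance M X X + 2 * covariance M X Y + covariance M Y Y"
proof -
  have *: "covariance M Z (\<lambda>\<omega>. X \<omega> + Y \<omega>) = covariance M X Z + covariance M Y Z"
    if "sq_integrable M Z" for Z
    using covariance_add_left[OF assms that] covariance_commute by metis
  show ?thesis
    using covariance_add_left[OF assms sq_integrable_add[OF assms]] *[OF assms(1)] *[OF assms(2)]
      covariance_commute[of M Y X] by simp
qed

text \<open>Variances of X + t Y and X - t Y are nonnegative. The free weight t replaces the square
  roots of Cauchy-Schwarz and is later matched to the decay of the variance of X.\<close>

lemma covariance_weighted_bound:
  assumes "sq_integrable M X" "sq_integrable M Y" "0 < t"
  shows "\<bar>covariance M X Y\<bar> \<le> (covariance M X X / t + t * covariance M Y Y) / 2"
proof -
  have "0 \<le> covariance M X X + 2 * (c * covariance M X Y) + c\<^sup>2 * covariance M Y Y" for c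
  proof -
    note Y = sq_integrable_cmult[OF assms(2), of c]
    have "covariance M X (\<lambda>\<omega>. c * Y \<omega>) = c * covariance M X Y"
      "covariance M (\<lambda>\<omega>. c * Y \<omega>) (\<lambda>\<omega>. c * Y \<omega>) = c\<^sup>2 * covariance M Y Y"
      using covariance_cmult_left[OF assms(2,1), of c] covariance_cmult_left[OF assms(2) Y, of c]
        covariance_cmult_left[OF assms(2,2), of c]
      by (metis covariance_commute, metis covariance_commute power2_eq_square mult.assoc)
    then show ?thesis
      using covariance_add_self[OF assms(1) Y] covariance_self_nonneg[of M "\<lambda>\<omega>. X \<omega> + c * Y \<omega>"] by simp
  qed
  from this[of t] this[of "- t"]
  have "2 * (t * \<bar>covariance M X Y\<bar>) \<le> covariance M X X + t\<^sup>2 * covariance M Y Y"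
    by (auto simp: abs_if)
  then show ?thesis using assms(3) by (simp add: field_simps power2_eq_square)
qed

end

section \<open>Gaussian laws\<close>

text \<open>One representation covers the density and the Dirac case, so later arguments need not
  distinguish zero variance.\<close>

lemma gaussian_law_affine:
  assumes "0 \<le> s"
  shows "gaussian_law m s = distr std_normal_distribution borel (\<lambda>x. m + sqrt s * x)"
proof (cases "s = 0")
  case True
  have "prob_space std_normal_distribution"
    by (rule prob_space_normal_density) simp
  from prob_space.distr_const[OF this, of m borel]
  have "distr std_normal_distribution borel (\<lambda>x. m) = return borel m" by simp
  then show ?thesis using True by (simp add: gaussian_law_def)
next
  case False
  have N: "prob_space std_normal_distribution"
    by (rule prob_space_normal_density) simp
  have "distributed std_normal_distribution lborel (\<lambda>x. x) (\<lambda>x. ennreal (std_normal_density x))"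
    by (simp add: distributed_def distr_id2)
  from prob_space.normal_density_affine[OF N this, of "sqrt s" m]
  have "distributed std_normal_distribution lborel (\<lambda>x. m + sqrt s * x)
      (\<lambda>x. ennreal (normal_density m (sqrt s) x))"
    using False assms by simp
  then have "density lborel (\<lambda>x. ennreal (normal_density m (sqrt s) x)) =
      distr std_normal_distribution lborel (\<lambda>x. m + sqrt s * x)"
    by (simp add: distributed_def)
  also have "\<dots> = distr std_normal_distribution borel (\<lambda>x. m + sqrt s * x)"
    by (rule distr_cong) auto
  finally show ?thesis using False by (simp add: gaussian_law_def)
qed

lemma std_normal_moments:
  "integrable std_normal_distribution (\<lambda>x. x)" "integrable std_normal_distribution (\<lambda>x. x\<^sup>2)"
  "(\<integral>x. x \<partial>std_normal_distribution) = 0" "(\<integral>x. x\<^sup>2 \<partial>std_normal_distribution) = 1"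
  using integrable_std_normal_distribution_moment[of 1] integrable_std_normal_distribution_moment[of 2]
    integral_std_normal_distribution_moment_odd[of 1] std_normal_distribution_even_moments(1)[of 1]
  by (auto simp: fact_numeral)

lemma gaussian_law_moments:
  assumes "prob_space M" "X \<in> borel_measurable M" "distr M borel X = gaussian_law m s" "0 \<le> s"
  shows "sq_integrable M X" "(\<integral>\<omega>. X \<omega> \<partial>M) = m" "covariance M X X = s"
proof -
  interpret prob_space M by fact
  interpret N: real_distribution std_normal_distribution by (rule real_dist_normal_dist)
  note [simp] = std_normal_moments
  have sq: "(m + sqrt s * x)\<^sup>2 = m\<^sup>2 + 2 * m * sqrt s * x + s * x\<^sup>2" for x
    using assms(4) by (simp add: power2_sum power_mult_distrib)
  have d: "distr M borel X = distr std_normal_distribution borel (\<lambda>x. m + sqrt s * x)"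
    using assms gaussian_law_affine by simp
  have "integrable (distr M borel X) (\<lambda>x. x\<^sup>2)"
    unfolding d by (subst integrable_distr_eq) (auto simp: sq)
  then show X: "sq_integrable M X"
    using assms(2) by (simp add: sq_integrable_def integrable_distr_eq)
  have "(\<integral>\<omega>. X \<omega> \<partial>M) = (\<integral>x. x \<partial>distr M borel X)"
    using assms(2) by (simp add: integral_distr)
  also have "\<dots> = m" unfolding d using N.prob_space by (subst integral_distr) auto
  finally show mean: "(\<integral>\<omega>. X \<omega> \<partial>M) = m" .
  have "(\<integral>\<omega>. (X \<omega>)\<^sup>2 \<partial>M) = (\<integral>x. x\<^sup>2 \<partial>distr M borel X)"
    using assms(2) by (simp add: integral_distr)
  also have "\<dots> = m\<^sup>2 + s" unfolding d using N.prob_space by (subst integral_distr) (auto simp: sq)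
  finally show "covariance M X X = s"
    using covariance_eq[OF X X] mean by (simp add: power2_eq_square)
qed

text \<open>All laws are images of one standard normal variable under affine maps that converge
  pointwise, so dominated convergence applies to every bounded continuous test function. The limit
  variance may be 0.\<close>

lemma weak_conv_gaussian_law:
  assumes "m \<longlonglongrightarrow> m'" "s \<longlonglongrightarrow> s'" "\<And>k. 0 \<le> s k"
  shows "weak_conv_m (\<lambda>k. gaussian_law (m k) (s k)) (gaussian_law m' s')"
proof -
  interpret N: real_distribution std_normal_distribution by (rule real_dist_normal_dist)
  have s': "0 \<le> s'" using assms by (intro LIMSEQ_le_const[of s]) auto
  have rd: "real_distribution (distr std_normal_distribution borel (\<lambda>x. a + b * x :: real))" for a b
    by (rule N.real_distribution_distr) simp
  show ?thesis
    unfolding gaussian_law_affine[OF s'] gaussian_law_affine[OF assms(3)]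
  proof (rule integral_bdd_continuous_conv_imp_weak_conv)
    fix f :: "real \<Rightarrow> real"
    assume f: "\<And>x. isCont f x" "\<And>x. \<bar>f x\<bar> \<le> 1"
    have [measurable]: "f \<in> borel_measurable borel"
      using f(1) by (intro borel_measurable_continuous_onI continuous_at_imp_continuous_on) auto
    have "(\<lambda>k. \<integral>x. f (m k + sqrt (s k) * x) \<partial>std_normal_distribution) \<longlonglongrightarrow>
        (\<integral>x. f (m' + sqrt s' * x) \<partial>std_normal_distribution)"
    proof (rule integral_dominated_convergence[where w = "\<lambda>_. 1"])
      show "AE x in std_normal_distribution. (\<lambda>k. f (m k + sqrt (s k) * x)) \<longlonglongrightarrow> f (m' + sqrt s' * x)"
        using assms f(1) by (intro AE_I2 isCont_tendsto_compose[OF f(1)] tendsto_intros) auto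
    qed (use f in auto)
    then show "(\<lambda>k. \<integral>x. f x \<partial>distr std_normal_distribution borel (\<lambda>x. m k + sqrt (s k) * x)) \<longlonglongrightarrow>
        (\<integral>x. f x \<partial>distr std_normal_distribution borel (\<lambda>x. m' + sqrt s' * x))"
      by (simp add: integral_distr)
  qed (auto intro: rd)
qed

text \<open>\<open>borel_vec\<close> is generated by the restricted coordinate map, so the
  functional is factored through it; the two agree on vectors of the right dimension.\<close>

lemma scalar_prod_measurable:
  assumes v: "v \<in> carrier_vec n"
  shows "(\<lambda>x. v \<bullet> x) \<in> borel_vec n \<rightarrow>\<^sub>M borel"
proof -
  define g :: "real vec \<Rightarrow> nat \<Rightarrow> real" where "g = (\<lambda>x. \<lambda>i\<in>{..<n}. x $ i)"
  have g: "g \<in> borel_vec n \<rightarrow>\<^sub>M (\<Pi>\<^sub>M i\<in>{..<n}. borel)"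
    unfolding borel_vec_def g_def by (rule measurable_vimage_algebra1) (auto simp: space_PiM)
  have "(\<lambda>x. \<Sum>i<n. v $ i * g x i) \<in> borel_vec n \<rightarrow>\<^sub>M borel"
    by (intro borel_measurable_sum borel_measurable_times borel_measurable_const
        measurable_compose[OF g measurable_component_singleton]) auto
  moreover have "(\<Sum>i<n. v $ i * g x i) = v \<bullet> x" if "x \<in> space (borel_vec n)" for x
    using that by (auto simp: borel_vec_def g_def scalar_prod_def atLeast0LessThan intro!: sum.cong)
  ultimately show ?thesis by (subst measurable_cong) auto
qed

lemma space_borel_vec: "space (borel_vec n) = carrier_vec n"
  by (simp add: borel_vec_def)

lemma multivariate_normal_carrier:
  "multivariate_normal M n X m C \<Longrightarrow> \<omega> \<in> space M \<Longrightarrow> X \<omega> \<in> carrier_vec n"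
  using measurable_space[of X M "borel_vec n" \<omega>]
  by (simp add: multivariate_normal_def space_borel_vec)

lemma multivariate_normal_moments:
  assumes "prob_space M" "multivariate_normal M n X m C" "v \<in> carrier_vec n"
  shows "sq_integrable M (\<lambda>\<omega>. v \<bullet> X \<omega>)" "(\<integral>\<omega>. v \<bullet> X \<omega> \<partial>M) = v \<bullet> m"
    "covariance M (\<lambda>\<omega>. v \<bullet> X \<omega>) (\<lambda>\<omega>. v \<bullet> X \<omega>) = v \<bullet> (C *\<^sub>v v)"
proof -
  have meas: "(\<lambda>\<omega>. v \<bullet> X \<omega>) \<in> borel_measurable M"
    using assms measurable_compose[OF _ scalar_prod_measurable[OF assms(3)], of X M]
    by (simp add: multivariate_normal_def)
  have "distr M borel (\<lambda>\<omega>. v \<bullet> X \<omega>) = gaussian_law (v \<bullet> m) (v \<bullet> (C *\<^sub>v v))" "0 \<le> v \<bullet> (C *\<^sub>v v)"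
    using assms by (auto simp: multivariate_normal_def sym_psd_def)
  from gaussian_law_moments[OF assms(1) meas this]
  show "sq_integrable M (\<lambda>\<omega>. v \<bullet> X \<omega>)" "(\<integral>\<omega>. v \<bullet> X \<omega> \<partial>M) = v \<bullet> m"
    "covariance M (\<lambda>\<omega>. v \<bullet> X \<omega>) (\<lambda>\<omega>. v \<bullet> X \<omega>) = v \<bullet> (C *\<^sub>v v)" by auto
qed

text \<open>The gateway for the independence hypothesis: from here on distinct draws are known
  through the vanishing covariances of their linear functionals.\<close>

lemma (in prob_space) indep_vars_uncorrelated:
  assumes ind: "indep_vars (\<lambda>d. borel_vec (N d)) R D"
    and d: "d \<in> D" "d' \<in> D" "d \<noteq> d'"
    and v: "v \<in> carrier_vec (N d)" "w \<in> carrier_vec (N d')"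
    and sq: "sq_integrable M (\<lambda>\<omega>. v \<bullet> R d \<omega>)" "sq_integrable M (\<lambda>\<omega>. w \<bullet> R d' \<omega>)"
  shows "covariance M (\<lambda>\<omega>. v \<bullet> R d \<omega>) (\<lambda>\<omega>. w \<bullet> R d' \<omega>) = 0"
proof -
  \<comment> \<open>The two functionals are merged into one family indexed by the draw, the shape in
    which independence passes to images.\<close>
  define Y where "Y e x = (if e = d then v else w) \<bullet> x" for e x
  have ind': "indep_vars (\<lambda>_. borel) (\<lambda>e \<omega>. Y e (R e \<omega>)) {d, d'}"
  proof (rule indep_vars_compose2[where X = R and Y = Y])
    show "indep_vars (\<lambda>d. borel_vec (N d)) R {d, d'}"
      using d by (intro indep_vars_subset[OF ind]) auto
    show "Y e \<in> borel_vec (N e) \<rightarrow>\<^sub>M borel" if "e \<in> {d, d'}" for e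
      using that v scalar_prod_measurable unfolding Y_def by auto
  qed
  have "integrable M (\<lambda>\<omega>. Y e (R e \<omega>))" if "e \<in> {d, d'}" for e
    using that sq_integrable_integrable[OF sq(1)] sq_integrable_integrable[OF sq(2)] d
    by (auto simp: Y_def)
  from indep_vars_lebesgue_integral[OF _ ind' this]
  have "expectation (\<lambda>\<omega>. (v \<bullet> R d \<omega>) * (w \<bullet> R d' \<omega>)) =
      expectation (\<lambda>\<omega>. v \<bullet> R d \<omega>) * expectation (\<lambda>\<omega>. w \<bullet> R d' \<omega>)"
    using d(3) by (auto simp: Y_def)
  then show ?thesis using covariance_eq[OF sq] by simp
qed

section \<open>Propagation of means and covariances through the V-cycle\<close>

text \<open>\<open>E\<close> is the error propagation of an update with noise variables \<open>G\<close> that leaves \<open>N(0, A\<^sup>-\<^sup>1)\<close>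
  invariant.  Random vectors are tested in the energy inner product, so that the self-adjointness of
  the error operators replaces transposition.\<close>

definition update_step :: "'w measure \<Rightarrow> nat \<Rightarrow> real mat \<Rightarrow> (real vec \<Rightarrow> real vec) \<Rightarrow>
    ('w \<Rightarrow> real vec) \<Rightarrow> ('w \<Rightarrow> real vec) \<Rightarrow> ('w \<Rightarrow> real) set \<Rightarrow> bool" where
  "update_step P n A E e e' G \<longleftrightarrow>
    (\<forall>\<omega>\<in>space P. e' \<omega> \<in> carrier_vec n) \<and>
    (\<forall>u\<in>carrier_vec n.
      sq_integrable P (\<lambda>\<omega>. u \<bullet> (A *\<^sub>v e' \<omega>)) \<and>
      (\<integral>\<omega>. u \<bullet> (A *\<^sub>v e' \<omega>) \<partial>P) = (\<integral>\<omega>. E u \<bullet> (A *\<^sub>v e \<omega>) \<partial>P) \<and>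
      (\<forall>Y. sq_integrable P Y \<and> (\<forall>g\<in>G. covariance P g Y = 0) \<longrightarrow>
        covariance P (\<lambda>\<omega>. u \<bullet> (A *\<^sub>v e' \<omega>)) Y = covariance P (\<lambda>\<omega>. E u \<bullet> (A *\<^sub>v e \<omega>)) Y) \<and>
      covariance P (\<lambda>\<omega>. u \<bullet> (A *\<^sub>v e' \<omega>)) (\<lambda>\<omega>. u \<bullet> (A *\<^sub>v e' \<omega>)) - u \<bullet> (A *\<^sub>v u) =
        covariance P (\<lambda>\<omega>. E u \<bullet> (A *\<^sub>v e \<omega>)) (\<lambda>\<omega>. E u \<bullet> (A *\<^sub>v e \<omega>)) - E u \<bullet> (A *\<^sub>v E u))"

definition second_order :: "'w measure \<Rightarrow> nat \<Rightarrow> real mat \<Rightarrow> ('w \<Rightarrow> real vec) \<Rightarrow> bool" where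
  "second_order P n A e \<longleftrightarrow> (\<forall>\<omega>\<in>space P. e \<omega> \<in> carrier_vec n) \<and>
    (\<forall>u\<in>carrier_vec n. sq_integrable P (\<lambda>\<omega>. u \<bullet> (A *\<^sub>v e \<omega>)))"

text \<open>The second-order trace of independence between a state and the draws that are still to
  come.\<close>

definition uncorrelated :: "'w measure \<Rightarrow> nat \<Rightarrow> real mat \<Rightarrow> ('w \<Rightarrow> real vec) \<Rightarrow>
    ('w \<Rightarrow> real) set \<Rightarrow> bool" where
  "uncorrelated P n A e G \<longleftrightarrow>
    (\<forall>u\<in>carrier_vec n. \<forall>g\<in>G. covariance P (\<lambda>\<omega>. u \<bullet> (A *\<^sub>v e \<omega>)) g = 0)"

lemma update_step_second_order: "update_step P n A E e e' G \<Longrightarrow> second_order P n A e'"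
  by (simp add: update_step_def second_order_def)

lemma update_step_id: "second_order P n A e \<Longrightarrow> update_step P n A id e e {}"
  by (simp add: update_step_def second_order_def)

lemma update_step_mono: "update_step P n A E e e' G \<Longrightarrow> G \<subseteq> G' \<Longrightarrow> update_step P n A E e e' G'"
  unfolding update_step_def by (meson subsetD)

text \<open>Vector identities between errors rest on carrier membership, known only on
  \<open>space P\<close>. The functions are therefore not equal and cannot simply be
  rewritten.\<close>

lemma update_step_cong:
  assumes "\<And>\<omega>. \<omega> \<in> space P \<Longrightarrow> e1 \<omega> = e2 \<omega>" "\<And>\<omega>. \<omega> \<in> space P \<Longrightarrow> e1' \<omega> = e2' \<omega>"
    and st: "update_step P n A E e1 e1' G"
  shows "update_step P n A E e2 e2' G"
proof -
  have "sq_integrable P (\<lambda>\<omega>. u \<bullet> (A *\<^sub>v e1' \<omega>)) = sq_integrable P (\<lambda>\<omega>. u \<bullet> (A *\<^sub>v e2' \<omega>))"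
    "(\<integral>\<omega>. u \<bullet> (A *\<^sub>v e1' \<omega>) \<partial>P) = (\<integral>\<omega>. u \<bullet> (A *\<^sub>v e2' \<omega>) \<partial>P)"
    "(\<integral>\<omega>. u \<bullet> (A *\<^sub>v e1 \<omega>) \<partial>P) = (\<integral>\<omega>. u \<bullet> (A *\<^sub>v e2 \<omega>) \<partial>P)"
    "covariance P (\<lambda>\<omega>. u \<bullet> (A *\<^sub>v e1' \<omega>)) Y = covariance P (\<lambda>\<omega>. u \<bullet> (A *\<^sub>v e2' \<omega>)) Y"
    "covariance P (\<lambda>\<omega>. u \<bullet> (A *\<^sub>v e1 \<omega>)) Y = covariance P (\<lambda>\<omega>. u \<bullet> (A *\<^sub>v e2 \<omega>)) Y"
    "covariance P (\<lambda>\<omega>. u \<bullet> (A *\<^sub>v e1' \<omega>)) (\<lambda>\<omega>. u \<bullet> (A *\<^sub>v e1' \<omega>)) =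
      covariance P (\<lambda>\<omega>. u \<bullet> (A *\<^sub>v e2' \<omega>)) (\<lambda>\<omega>. u \<bullet> (A *\<^sub>v e2' \<omega>))"
    "covariance P (\<lambda>\<omega>. u \<bullet> (A *\<^sub>v e1 \<omega>)) (\<lambda>\<omega>. u \<bullet> (A *\<^sub>v e1 \<omega>)) =
      covariance P (\<lambda>\<omega>. u \<bullet> (A *\<^sub>v e2 \<omega>)) (\<lambda>\<omega>. u \<bullet> (A *\<^sub>v e2 \<omega>))" for u Y
    using assms by (intro sq_integrable_cong Bochner_Integration.integral_cong covariance_cong; simp)+
  moreover have "(\<forall>\<omega>\<in>space P. e1' \<omega> \<in> carrier_vec n) = (\<forall>\<omega>\<in>space P. e2' \<omega> \<in> carrier_vec n)"
    using assms by simp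
  ultimately show ?thesis using st unfolding update_step_def by (simp only:)
qed

lemma second_order_cong:
  assumes "\<And>\<omega>. \<omega> \<in> space P \<Longrightarrow> e1 \<omega> = e2 \<omega>"
  shows "second_order P n A e1 = second_order P n A e2"
proof -
  have "sq_integrable P (\<lambda>\<omega>. u \<bullet> (A *\<^sub>v e1 \<omega>)) = sq_integrable P (\<lambda>\<omega>. u \<bullet> (A *\<^sub>v e2 \<omega>))" for u
    using assms by (intro sq_integrable_cong) simp
  then show ?thesis using assms by (simp add: second_order_def)
qed

lemma uncorrelated_cong:
  assumes "\<And>\<omega>. \<omega> \<in> space P \<Longrightarrow> e1 \<omega> = e2 \<omega>"
  shows "uncorrelated P n A e1 G = uncorrelated P n A e2 G"
proof -
  have "covariance P (\<lambda>\<omega>. u \<bullet> (A *\<^sub>v e1 \<omega>)) Y = covariance P (\<lambda>\<omega>. u \<bullet> (A *\<^sub>v e2 \<omega>)) Y" for u Y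
    using assms by (intro covariance_cong) simp_all
  then show ?thesis by (simp add: uncorrelated_def)
qed

text \<open>The operators act on test vectors, so the last update is applied first. The third clause
  chains because Y is assumed uncorrelated with the noise of both updates.\<close>

lemma update_step_compose:
  assumes 1: "update_step P n A E1 e e1 G1" and 2: "update_step P n A E2 e1 e2 G2"
    and E2: "\<And>u. u \<in> carrier_vec n \<Longrightarrow> E2 u \<in> carrier_vec n"
  shows "update_step P n A (E1 \<circ> E2) e e2 (G1 \<union> G2)"
  unfolding update_step_def
proof (intro conjI ballI allI impI)
  fix u :: "real vec"
  assume u: "u \<in> carrier_vec n"
  note s2 = 2[unfolded update_step_def, THEN conjunct2, rule_format, OF u]
  note s1 = 1[unfolded update_step_def, THEN conjunct2, rule_format, OF E2[OF u]]
  show "sq_integrable P (\<lambda>\<omega>. u \<bullet> (A *\<^sub>v e2 \<omega>))" using s2 by blast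
  show "(\<integral>\<omega>. u \<bullet> (A *\<^sub>v e2 \<omega>) \<partial>P) = (\<integral>\<omega>. (E1 \<circ> E2) u \<bullet> (A *\<^sub>v e \<omega>) \<partial>P)"
    using s1 s2 by simp
  show "covariance P (\<lambda>\<omega>. u \<bullet> (A *\<^sub>v e2 \<omega>)) (\<lambda>\<omega>. u \<bullet> (A *\<^sub>v e2 \<omega>)) - u \<bullet> (A *\<^sub>v u) =
      covariance P (\<lambda>\<omega>. (E1 \<circ> E2) u \<bullet> (A *\<^sub>v e \<omega>)) (\<lambda>\<omega>. (E1 \<circ> E2) u \<bullet> (A *\<^sub>v e \<omega>)) -
      (E1 \<circ> E2) u \<bullet> (A *\<^sub>v (E1 \<circ> E2) u)"
    using s1 s2 by simp
  fix Y assume Y: "sq_integrable P Y \<and> (\<forall>g\<in>G1 \<union> G2. covariance P g Y = 0)"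
  then have "covariance P (\<lambda>\<omega>. u \<bullet> (A *\<^sub>v e2 \<omega>)) Y = covariance P (\<lambda>\<omega>. E2 u \<bullet> (A *\<^sub>v e1 \<omega>)) Y"
    using s2 by blast
  also have "\<dots> = covariance P (\<lambda>\<omega>. E1 (E2 u) \<bullet> (A *\<^sub>v e \<omega>)) Y" using s1 Y by blast
  finally show "covariance P (\<lambda>\<omega>. u \<bullet> (A *\<^sub>v e2 \<omega>)) Y =
      covariance P (\<lambda>\<omega>. (E1 \<circ> E2) u \<bullet> (A *\<^sub>v e \<omega>)) Y" by simp
qed (use 2 in \<open>simp add: update_step_def\<close>)

lemma update_step_uncorrelated:
  assumes st: "update_step P n A E e e' G" and un: "uncorrelated P n A e H"
    and E: "\<And>u. u \<in> carrier_vec n \<Longrightarrow> E u \<in> carrier_vec n"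
    and H: "\<And>h. h \<in> H \<Longrightarrow> sq_integrable P h" "\<And>g h. g \<in> G \<Longrightarrow> h \<in> H \<Longrightarrow> covariance P g h = 0"
  shows "uncorrelated P n A e' H"
  unfolding uncorrelated_def
proof (intro ballI)
  fix u :: "real vec" and h
  assume u: "u \<in> carrier_vec n" and h: "h \<in> H"
  have "covariance P (\<lambda>\<omega>. u \<bullet> (A *\<^sub>v e' \<omega>)) h = covariance P (\<lambda>\<omega>. E u \<bullet> (A *\<^sub>v e \<omega>)) h"
    using st[unfolded update_step_def, THEN conjunct2, rule_format, OF u] H h by blast
  also have "\<dots> = 0" using un E[OF u] h by (simp add: uncorrelated_def)
  finally show "covariance P (\<lambda>\<omega>. u \<bullet> (A *\<^sub>v e' \<omega>)) h = 0" .
qed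

lemma uncorrelated_mono: "uncorrelated P n A e G \<Longrightarrow> G' \<subseteq> G \<Longrightarrow> uncorrelated P n A e G'"
  unfolding uncorrelated_def by blast

text \<open>What is kept of the law N(0, C) of a noise vector.\<close>

definition centered :: "'w measure \<Rightarrow> nat \<Rightarrow> ('w \<Rightarrow> real vec) \<Rightarrow> real mat \<Rightarrow> bool" where
  "centered P n X C \<longleftrightarrow> (\<forall>\<omega>\<in>space P. X \<omega> \<in> carrier_vec n) \<and>
    (\<forall>z\<in>carrier_vec n. sq_integrable P (\<lambda>\<omega>. z \<bullet> X \<omega>) \<and> (\<integral>\<omega>. z \<bullet> X \<omega> \<partial>P) = 0 \<and>
      covariance P (\<lambda>\<omega>. z \<bullet> X \<omega>) (\<lambda>\<omega>. z \<bullet> X \<omega>) = z \<bullet> (C *\<^sub>v z))"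

context spd_splitting
begin

lemma smoother_error:
  assumes c: "f \<in> carrier_vec n" "\<xi> \<in> carrier_vec n" "\<theta> \<in> carrier_vec n"
  shows "random_smoother A M f \<xi> \<theta> - minv A *\<^sub>v f =
    smooth_err (\<theta> - minv A *\<^sub>v f) + minv M *\<^sub>v \<xi>"
proof -
  let ?x = "minv A *\<^sub>v f"
  note x = minv_mult_vec[OF A c(1)]
  have Mi: "minv M \<in> carrier_mat n n" using sym_pos_def_inverse[OF M(1) M_pos_def] by simp
  have "f + \<xi> - A *\<^sub>v \<theta> = \<xi> - A *\<^sub>v (\<theta> - ?x)"
    using c x A by (subst mult_minus_distrib_mat_vec[of _ n n]) (auto intro!: eq_vecI)
  then have "minv M *\<^sub>v (f + \<xi> - A *\<^sub>v \<theta>) = minv M *\<^sub>v \<xi> - correction (\<theta> - ?x)"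
    using c x A Mi by (simp add: correction_def mult_minus_distrib_mat_vec[of "minv M" n n])
  moreover have "minv M *\<^sub>v \<xi> \<in> carrier_vec n" "correction (\<theta> - ?x) \<in> carrier_vec n"
    using c x Mi by auto
  moreover have "\<theta> + (a - b) - x = \<theta> - x - b + a"
    if "a \<in> carrier_vec n" "b \<in> carrier_vec n" "x \<in> carrier_vec n" for a b x
    using that c by (intro eq_vecI) auto
  ultimately show ?thesis
    using x by (simp only: random_smoother_def smooth_err_def)
qed

text \<open>The noise covariance M + M^T - A is tuned to invariance: tested with X u it gives 2 <u,
  X u> - |X u|^2, exactly the energy |u|^2 - |S u|^2 lost by smoothing.\<close>

lemma smoother_step:
  assumes P: "prob_space P" and e: "second_order P n A e"
    and \<xi>: "centered P n \<xi> (M + M\<^sup>T - A)"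
    and un: "uncorrelated P n A e {\<lambda>\<omega>. z \<bullet> \<xi> \<omega> | z. z \<in> carrier_vec n}"
  shows "update_step P n A smooth_err e (\<lambda>\<omega>. smooth_err (e \<omega>) + minv M *\<^sub>v \<xi> \<omega>)
    {\<lambda>\<omega>. z \<bullet> \<xi> \<omega> | z. z \<in> carrier_vec n}"
proof -
  interpret prob_space P by fact
  have ec: "e \<omega> \<in> carrier_vec n" and xc: "\<xi> \<omega> \<in> carrier_vec n" if "\<omega> \<in> space P" for \<omega>
    using e \<xi> that by (auto simp: second_order_def centered_def)
  have Mi: "minv M *\<^sub>v x \<in> carrier_vec n" if "x \<in> carrier_vec n" for x
    using minv_mult_vec(1)[OF M(1) M_pos_def that] .
  define e' where "e' = (\<lambda>\<omega>. smooth_err (e \<omega>) + minv M *\<^sub>v \<xi> \<omega>)"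
  have split: "u \<bullet> (A *\<^sub>v e' \<omega>) = smooth_err u \<bullet> (A *\<^sub>v e \<omega>) + correction u \<bullet> \<xi> \<omega>"
    if u: "u \<in> carrier_vec n" and w: "\<omega> \<in> space P" for u \<omega>
  proof -
    have Au: "A *\<^sub>v u \<in> carrier_vec n" using A u by simp
    have "u \<bullet> (A *\<^sub>v e' \<omega>) = u \<bullet> (A *\<^sub>v smooth_err (e \<omega>)) + u \<bullet> (A *\<^sub>v (minv M *\<^sub>v \<xi> \<omega>))"
      unfolding e'_def using u A ec[OF w] Mi[OF xc[OF w]]
      by (simp add: mult_add_distrib_mat_vec[of _ n n] scalar_prod_add_distrib[of _ n])
    also have "u \<bullet> (A *\<^sub>v (minv M *\<^sub>v \<xi> \<omega>)) = (A *\<^sub>v u) \<bullet> (minv M *\<^sub>v \<xi> \<omega>)"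
      using symmetric_form_left[OF A(1) A_sym u Mi[OF xc[OF w]]] by simp
    also have "\<dots> = correction u \<bullet> \<xi> \<omega>"
      unfolding correction_def
      using minv_form_commute[OF M(1) M_pos_def Au xc[OF w]]
        comm_scalar_prod[OF xc[OF w] Mi[OF Au]] by simp
    also have "u \<bullet> (A *\<^sub>v smooth_err (e \<omega>)) = smooth_err u \<bullet> (A *\<^sub>v e \<omega>)"
      using u ec[OF w] by (simp add: smooth_err_form smooth_err_form_left)
    finally show ?thesis .
  qed
  show ?thesis
    unfolding e'_def[symmetric] update_step_def
  proof (intro conjI ballI allI impI)
    fix \<omega> assume "\<omega> \<in> space P"
    then show "e' \<omega> \<in> carrier_vec n" using ec xc Mi by (simp add: e'_def)
  next
    fix u :: "real vec"
  assume u: "u \<in> carrier_vec n"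
    define a where "a = (\<lambda>\<omega>. smooth_err u \<bullet> (A *\<^sub>v e \<omega>))"
    define b where "b = (\<lambda>\<omega>. correction u \<bullet> \<xi> \<omega>)"
    have z: "correction u \<in> carrier_vec n" using u by simp
    have sa: "sq_integrable P a" using e u by (simp add: second_order_def a_def)
    have b: "sq_integrable P b" "expectation b = 0"
      "covariance P b b = correction u \<bullet> ((M + M\<^sup>T - A) *\<^sub>v correction u)"
      using \<xi> z by (auto simp: centered_def b_def)
    have ab: "covariance P a b = 0"
      unfolding a_def b_def
      by (rule un[unfolded uncorrelated_def, rule_format, OF smooth_err_carrier[OF u]]) (use z in blast)
    have cg: "sq_integrable P (\<lambda>\<omega>. u \<bullet> (A *\<^sub>v e' \<omega>)) \<longleftrightarrow> sq_integrable P (\<lambda>\<omega>. a \<omega> + b \<omega>)"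
      by (rule sq_integrable_cong) (simp add: split[OF u] a_def b_def)
    then show "sq_integrable P (\<lambda>\<omega>. u \<bullet> (A *\<^sub>v e' \<omega>))" using sq_integrable_add[OF sa b(1)] by simp
    have "expectation (\<lambda>\<omega>. u \<bullet> (A *\<^sub>v e' \<omega>)) = expectation (\<lambda>\<omega>. a \<omega> + b \<omega>)"
      by (rule Bochner_Integration.integral_cong) (auto simp: split[OF u] a_def b_def)
    also have "\<dots> = expectation a"
      using b sq_integrable_integrable[OF sa] sq_integrable_integrable[OF b(1)] by simp
    finally show "expectation (\<lambda>\<omega>. u \<bullet> (A *\<^sub>v e' \<omega>)) = expectation (\<lambda>\<omega>. smooth_err u \<bullet> (A *\<^sub>v e \<omega>))"
      by (simp add: a_def)
    have "covariance P (\<lambda>\<omega>. u \<bullet> (A *\<^sub>v e' \<omega>)) (\<lambda>\<omega>. u \<bullet> (A *\<^sub>v e' \<omega>)) =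
        covariance P (\<lambda>\<omega>. a \<omega> + b \<omega>) (\<lambda>\<omega>. a \<omega> + b \<omega>)"
      by (rule covariance_cong) (auto simp: split[OF u] a_def b_def)
    also have "\<dots> = covariance P a a + covariance P b b"
      using covariance_add_self[OF sa b(1)] ab by simp
    finally have var: "covariance P (\<lambda>\<omega>. u \<bullet> (A *\<^sub>v e' \<omega>)) (\<lambda>\<omega>. u \<bullet> (A *\<^sub>v e' \<omega>)) =
      covariance P a a + covariance P b b" .
    let ?z = "correction u"
    have Mz: "?z \<bullet> (M *\<^sub>v ?z) = u \<bullet> (A *\<^sub>v ?z)"
      using M_correction[OF u] A_form_commute[OF u z] by simp
    have "?z \<bullet> ((M + M\<^sup>T - A) *\<^sub>v ?z) = 2 * (?z \<bullet> (M *\<^sub>v ?z)) - ?z \<bullet> (A *\<^sub>v ?z)"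
      using z M A by (simp add: minus_mult_distrib_mat_vec[of _ n n] add_mult_distrib_mat_vec[of _ n n]
          scalar_prod_minus_distrib[of _ n] scalar_prod_add_distrib[of _ n])
    moreover have "smooth_err u \<bullet> (A *\<^sub>v smooth_err u) =
        u \<bullet> (A *\<^sub>v u) - 2 * (u \<bullet> (A *\<^sub>v ?z)) + ?z \<bullet> (A *\<^sub>v ?z)"
      unfolding smooth_err_def using quadratic_form_diff[OF A(1) A_sym u z] .
    ultimately show "covariance P (\<lambda>\<omega>. u \<bullet> (A *\<^sub>v e' \<omega>)) (\<lambda>\<omega>. u \<bullet> (A *\<^sub>v e' \<omega>)) - u \<bullet> (A *\<^sub>v u) =
        covariance P (\<lambda>\<omega>. smooth_err u \<bullet> (A *\<^sub>v e \<omega>)) (\<lambda>\<omega>. smooth_err u \<bullet> (A *\<^sub>v e \<omega>)) -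
        smooth_err u \<bullet> (A *\<^sub>v smooth_err u)"
      using var b(3) Mz by (simp add: a_def)
    fix Y assume Y: "sq_integrable P Y \<and> (\<forall>g\<in>{\<lambda>\<omega>. z \<bullet> \<xi> \<omega> | z. z \<in> carrier_vec n}. covariance P g Y = 0)"
    then have "covariance P b Y = 0" using z unfolding b_def by blast
    have "covariance P (\<lambda>\<omega>. u \<bullet> (A *\<^sub>v e' \<omega>)) Y = covariance P (\<lambda>\<omega>. a \<omega> + b \<omega>) Y"
      by (rule covariance_cong) (auto simp: split[OF u] a_def b_def)
    also have "\<dots> = covariance P a Y"
      using covariance_add_left[OF sa b(1)] Y \<open>covariance P b Y = 0\<close> by simp
    finally show "covariance P (\<lambda>\<omega>. u \<bullet> (A *\<^sub>v e' \<omega>)) Y =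
        covariance P (\<lambda>\<omega>. smooth_err u \<bullet> (A *\<^sub>v e \<omega>)) Y" by (simp add: a_def)
  qed
qed

end

context galerkin_hierarchy
begin

text \<open>Step (2) of the V-cycle: the coarse update starts from \<open>0\<close>, so that its error is \<open>proj l e\<close> before
  the update and \<open>\<psi>\<close> afterwards.\<close>

lemma coarse_step:
  assumes P: "prob_space P" and e: "second_order P (n (Suc l)) (A (Suc l)) e"
    and un: "uncorrelated P (n (Suc l)) (A (Suc l)) e G"
    and st: "update_step P (n l) (A l) (vcycle_err l) (\<lambda>\<omega>. proj l (e \<omega>)) \<psi> G"
    and G: "\<And>g. g \<in> G \<Longrightarrow> sq_integrable P g"
  shows "update_step P (n (Suc l)) (A (Suc l)) (coarse_err l) e
    (\<lambda>\<omega>. e \<omega> + I (Suc l) *\<^sub>v (\<psi> \<omega> - proj l (e \<omega>))) G"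
proof -
  interpret prob_space P by fact
  have ec: "e \<omega> \<in> carrier_vec (n (Suc l))" and pc: "\<psi> \<omega> \<in> carrier_vec (n l)"
    if "\<omega> \<in> space P" for \<omega>
    using e st that by (auto simp: second_order_def update_step_def)
  define e' where "e' = (\<lambda>\<omega>. e \<omega> + I (Suc l) *\<^sub>v (\<psi> \<omega> - proj l (e \<omega>)))"
  show ?thesis
    unfolding e'_def[symmetric] update_step_def
  proof (intro conjI ballI allI impI)
    fix \<omega> assume "\<omega> \<in> space P"
    then show "e' \<omega> \<in> carrier_vec (n (Suc l))" using ec pc by (simp add: e'_def)
  next
    fix u :: "real vec"
  assume u: "u \<in> carrier_vec (n (Suc l))"
    define p where "p = proj l u"
    define q where "q = vcycle_err l p"
    have p: "p \<in> carrier_vec (n l)" "q \<in> carrier_vec (n l)" using u by (auto simp: p_def q_def)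
    \<comment> \<open>a tests the state with the part of u orthogonal to the coarse space, b tests
      the coarse result with p, and c tests the coarse initial error with q = E p. The new
      functional is a + b and the pulled-back one a + c, so only b has to be traded for c.\<close>
    define a where "a = (\<lambda>\<omega>. form (Suc l) (u - I (Suc l) *\<^sub>v p) (e \<omega>))"
    define b where "b = (\<lambda>\<omega>. form l p (\<psi> \<omega>))"
    define c where "c = (\<lambda>\<omega>. form l q (proj l (e \<omega>)))"
    have split: "form (Suc l) u (e' \<omega>) = a \<omega> + b \<omega>" if w: "\<omega> \<in> space P" for \<omega>
    proof -
      have "form (Suc l) u (e' \<omega>) = form (Suc l) u (e \<omega>) + (form l p (\<psi> \<omega>) - form l p (proj l (e \<omega>)))"
        unfolding e'_def using u ec[OF w] pc[OF w] p
        by (simp add: form_add_right form_diff_right prolong_form flip: p_def)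
      also have "form l p (proj l (e \<omega>)) = form (Suc l) (I (Suc l) *\<^sub>v p) (e \<omega>)"
        using proj_form[OF ec[OF w] p(1)] .
      finally show ?thesis
        using u p ec[OF w] by (simp add: a_def b_def form_diff_left)
    qed
    have split': "form (Suc l) (coarse_err l u) (e \<omega>) = a \<omega> + c \<omega>" if w: "\<omega> \<in> space P" for \<omega>
    proof -
      have "form (Suc l) (coarse_err l u) (e \<omega>) =
          form (Suc l) u (e \<omega>) - form l (p - q) (proj l (e \<omega>))"
        using proj_form[OF ec[OF w], of "p - q"] u p ec[OF w]
        by (simp add: coarse_err_def form_diff_left flip: p_def q_def)
      also have "form l (p - q) (proj l (e \<omega>)) = form (Suc l) (I (Suc l) *\<^sub>v p) (e \<omega>) - c \<omega>"
        using p ec[OF w] proj_form[OF ec[OF w] p(1)] by (simp add: form_diff_left c_def)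
      finally show ?thesis using u p ec[OF w] by (simp add: a_def form_diff_left)
    qed
    have c_eq: "c \<omega> = form (Suc l) (I (Suc l) *\<^sub>v q) (e \<omega>)" if w: "\<omega> \<in> space P" for \<omega>
      using proj_form[OF ec[OF w] p(2)] by (simp add: c_def)
    have sa: "sq_integrable P a" using e u p by (simp add: second_order_def a_def)
    have "sq_integrable P c \<longleftrightarrow> sq_integrable P (\<lambda>\<omega>. form (Suc l) (I (Suc l) *\<^sub>v q) (e \<omega>))"
      by (rule sq_integrable_cong) (rule c_eq)
    then have sc: "sq_integrable P c" using e p by (simp add: second_order_def)
    have uc: "u - I (Suc l) *\<^sub>v p \<in> carrier_vec (n (Suc l))" using u p by simp
    have aG: "covariance P g a = 0" if "g \<in> G" for g
      using un uc that unfolding uncorrelated_def a_def by (metis covariance_commute)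
    note s = st[unfolded update_step_def, THEN conjunct2, rule_format, OF p(1),
        folded q_def, folded b_def c_def]
    have sb: "sq_integrable P b" using s by blast
    have "sq_integrable P (\<lambda>\<omega>. form (Suc l) u (e' \<omega>)) \<longleftrightarrow> sq_integrable P (\<lambda>\<omega>. a \<omega> + b \<omega>)"
      by (rule sq_integrable_cong) (rule split)
    then show "sq_integrable P (\<lambda>\<omega>. form (Suc l) u (e' \<omega>))" using sq_integrable_add[OF sa sb] by simp
    have "expectation (\<lambda>\<omega>. form (Suc l) u (e' \<omega>)) = expectation (\<lambda>\<omega>. a \<omega> + b \<omega>)"
      by (rule Bochner_Integration.integral_cong) (auto simp: split)
    also have "\<dots> = expectation (\<lambda>\<omega>. a \<omega> + c \<omega>)"
      using s sq_integrable_integrable[OF sa] sq_integrable_integrable[OF sb]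
        sq_integrable_integrable[OF sc] by simp
    also have "\<dots> = expectation (\<lambda>\<omega>. form (Suc l) (coarse_err l u) (e \<omega>))"
      by (rule Bochner_Integration.integral_cong) (auto simp: split')
    finally show "expectation (\<lambda>\<omega>. form (Suc l) u (e' \<omega>)) =
      expectation (\<lambda>\<omega>. form (Suc l) (coarse_err l u) (e \<omega>))" .
    have "covariance P (\<lambda>\<omega>. form (Suc l) u (e' \<omega>)) (\<lambda>\<omega>. form (Suc l) u (e' \<omega>)) =
        covariance P (\<lambda>\<omega>. a \<omega> + b \<omega>) (\<lambda>\<omega>. a \<omega> + b \<omega>)"
      by (rule covariance_cong) (auto simp: split)
    also have "\<dots> = covariance P a a + 2 * covariance P a b + covariance P b b"
      by (rule covariance_add_self[OF sa sb])
    \<comment> \<open>a depends on the state before the coarse update and is uncorrelated with its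
      noise, so it may serve as Y in \<open>st\<close>.\<close>
    also have "covariance P a b = covariance P a c"
      using s sa aG by (metis covariance_commute)
    also have "covariance P b b = covariance P c c + form l p p - form l q q"
      using s by simp
    also have "covariance P a a + 2 * covariance P a c + (covariance P c c + form l p p - form l q q) =
        covariance P (\<lambda>\<omega>. a \<omega> + c \<omega>) (\<lambda>\<omega>. a \<omega> + c \<omega>) + form l p p - form l q q"
      using covariance_add_self[OF sa sc] by simp
    also have "covariance P (\<lambda>\<omega>. a \<omega> + c \<omega>) (\<lambda>\<omega>. a \<omega> + c \<omega>) =
        covariance P (\<lambda>\<omega>. form (Suc l) (coarse_err l u) (e \<omega>)) (\<lambda>\<omega>. form (Suc l) (coarse_err l u) (e \<omega>))"
      by (rule covariance_cong) (auto simp: split')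
    finally show "covariance P (\<lambda>\<omega>. form (Suc l) u (e' \<omega>)) (\<lambda>\<omega>. form (Suc l) u (e' \<omega>)) - form (Suc l) u u =
        covariance P (\<lambda>\<omega>. form (Suc l) (coarse_err l u) (e \<omega>)) (\<lambda>\<omega>. form (Suc l) (coarse_err l u) (e \<omega>)) -
        form (Suc l) (coarse_err l u) (coarse_err l u)"
      using coarse_err_norm[OF u] by (simp add: p_def q_def)
    fix Y assume Y: "sq_integrable P Y \<and> (\<forall>g\<in>G. covariance P g Y = 0)"
    have "covariance P (\<lambda>\<omega>. form (Suc l) u (e' \<omega>)) Y = covariance P (\<lambda>\<omega>. a \<omega> + b \<omega>) Y"
      by (rule covariance_cong) (auto simp: split)
    also have "\<dots> = covariance P (\<lambda>\<omega>. a \<omega> + c \<omega>) Y"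
      using covariance_add_left[OF sa sb, of Y] covariance_add_left[OF sa sc, of Y] Y s by simp
    also have "\<dots> = covariance P (\<lambda>\<omega>. form (Suc l) (coarse_err l u) (e \<omega>)) Y"
      by (rule covariance_cong) (auto simp: split')
    finally show "covariance P (\<lambda>\<omega>. form (Suc l) u (e' \<omega>)) Y =
        covariance P (\<lambda>\<omega>. form (Suc l) (coarse_err l u) (e \<omega>)) Y" .
  qed
qed

end

section \<open>The random draws of one chain and the propagation of errors through an update\<close>

locale mgmc_draws = galerkin_hierarchy n A M I \<kappa> C\<^sub>A + prob_space P
  for n :: "nat \<Rightarrow> nat" and A M I :: "nat \<Rightarrow> real mat" and \<kappa> :: nat and C\<^sub>A :: real
    and P :: "'w measure" +
  fixes L :: nat and f :: "real vec" and R :: "draw \<Rightarrow> 'w \<Rightarrow> real vec"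
  assumes f: "f \<in> carrier_vec (n L)"
    and smooth_noise: "\<lbrakk>1 \<le> l; l \<le> L; k < 2 * \<kappa>\<rbrakk> \<Longrightarrow>
      centered P (n l) (R (Smooth m l k)) (M l + (M l)\<^sup>T - A l)"
    and coarse_noise: "centered P (n 0) (R (Coarse m)) (minv (A 0))"
    and init: "\<omega> \<in> space P \<Longrightarrow> R Init \<omega> \<in> carrier_vec (n L)"
      "v \<in> carrier_vec (n L) \<Longrightarrow> sq_integrable P (\<lambda>\<omega>. v \<bullet> R Init \<omega>)"
    and draws_uncorrelated: "\<lbrakk>d \<in> draws (2 * \<kappa>) L; d' \<in> draws (2 * \<kappa>) L; d \<noteq> d';
      v \<in> carrier_vec (draw_dim n L d); w \<in> carrier_vec (draw_dim n L d')\<rbrakk> \<Longrightarrow>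
      covariance P (\<lambda>\<omega>. v \<bullet> R d \<omega>) (\<lambda>\<omega>. w \<bullet> R d' \<omega>) = 0"
begin

definition noise :: "draw set \<Rightarrow> ('w \<Rightarrow> real) set" where
  "noise D = {\<lambda>\<omega>. w \<bullet> R d \<omega> | d w. d \<in> D \<and> w \<in> carrier_vec (draw_dim n L d)}"

definition smooth_draws :: "nat \<Rightarrow> nat \<Rightarrow> nat \<Rightarrow> nat \<Rightarrow> draw set" where
  "smooth_draws m l a b = {Smooth m l k | k. a \<le> k \<and> k < b}"

definition update_draws :: "nat \<Rightarrow> nat \<Rightarrow> draw set" where
  "update_draws m l = insert (Coarse m) {Smooth m j k | j k. 1 \<le> j \<and> j \<le> l \<and> k < 2 * \<kappa>}"

lemma noise_Un: "noise (D \<union> D') = noise D \<union> noise D'"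
  unfolding noise_def by blast

lemma noise_sq_integrable:
  assumes "D \<subseteq> draws (2 * \<kappa>) L" "g \<in> noise D"
  shows "sq_integrable P g"
proof -
  obtain d w where g: "g = (\<lambda>\<omega>. w \<bullet> R d \<omega>)" "d \<in> D" "w \<in> carrier_vec (draw_dim n L d)"
    using assms(2) unfolding noise_def by blast
  then have "d \<in> draws (2 * \<kappa>) L" using assms(1) by blast
  then show ?thesis
    using g init(2) smooth_noise coarse_noise unfolding draws_def
    by (auto simp: draw_dim_def centered_def)
qed

lemma noise_uncorrelated:
  assumes "D \<subseteq> draws (2 * \<kappa>) L" "D' \<subseteq> draws (2 * \<kappa>) L" "D \<inter> D' = {}" "g \<in> noise D" "h \<in> noise D'"
  shows "covariance P g h = 0"
proof -
  obtain d w where g: "g = (\<lambda>\<omega>. w \<bullet> R d \<omega>)" "d \<in> D" "w \<in> carrier_vec (draw_dim n L d)"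
    using assms(4) unfolding noise_def by blast
  obtain d' w' where h: "h = (\<lambda>\<omega>. w' \<bullet> R d' \<omega>)" "d' \<in> D'" "w' \<in> carrier_vec (draw_dim n L d')"
    using assms(5) unfolding noise_def by blast
  show ?thesis
    unfolding g(1) h(1) by (rule draws_uncorrelated) (use g h assms in auto)
qed

lemma noise_Smooth: "noise {Smooth m l k} = {\<lambda>\<omega>. z \<bullet> R (Smooth m l k) \<omega> | z. z \<in> carrier_vec (n l)}"
  by (auto simp: noise_def draw_dim_def)

lemma smooth_draws_subset: "Suc l \<le> L \<Longrightarrow> b \<le> 2 * \<kappa> \<Longrightarrow> smooth_draws m (Suc l) a b \<subseteq> draws (2 * \<kappa>) L"
  by (auto simp: smooth_draws_def draws_def)

lemma update_draws_subset: "l \<le> L \<Longrightarrow> update_draws m l \<subseteq> draws (2 * \<kappa>) L"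
  by (auto simp: update_draws_def draws_def)

text \<open>The right-hand side g is allowed to be random because on coarse levels it is a
  restricted residual. The offset a serves both sweeps: a = 0 before the coarse correction and a =
  \<open>\<kappa>\<close> after it.\<close>

lemma smoothing_sweep_step:
  fixes g \<theta> :: "'w \<Rightarrow> real vec"
    and l m a j :: nat
  defines "e \<equiv> \<lambda>\<omega>. \<theta> \<omega> - minv (A (Suc l)) *\<^sub>v g \<omega>"
  assumes l: "Suc l \<le> L" and j: "a + j \<le> 2 * \<kappa>"
    and c: "\<And>\<omega>. \<omega> \<in> space P \<Longrightarrow> g \<omega> \<in> carrier_vec (n (Suc l))"
      "\<And>\<omega>. \<omega> \<in> space P \<Longrightarrow> \<theta> \<omega> \<in> carrier_vec (n (Suc l))"
    and so: "second_order P (n (Suc l)) (A (Suc l)) e"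
    and un: "uncorrelated P (n (Suc l)) (A (Suc l)) e (noise (smooth_draws m (Suc l) a (a + j)))"
  defines "\<theta>' \<equiv> \<lambda>\<omega>. fold (\<lambda>k. random_smoother (A (Suc l)) (M (Suc l)) (g \<omega>) (R (Smooth m (Suc l) k) \<omega>))
      [a..<a + j] (\<theta> \<omega>)"
  shows "(\<forall>\<omega>\<in>space P. \<theta>' \<omega> \<in> carrier_vec (n (Suc l))) \<and>
    update_step P (n (Suc l)) (A (Suc l)) (split.smooth_err l ^^ j) e
      (\<lambda>\<omega>. \<theta>' \<omega> - minv (A (Suc l)) *\<^sub>v g \<omega>) (noise (smooth_draws m (Suc l) a (a + j)))"
  using j un unfolding \<theta>'_def
proof (induction j)
  case 0
  show ?case
    using c update_step_mono[OF update_step_id[OF so]] by (simp add: e_def id_def)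
next
  case (Suc j)
  let ?l = "Suc l"
  let ?sm = "\<lambda>\<omega> k. random_smoother (A ?l) (M ?l) (g \<omega>) (R (Smooth m ?l k) \<omega>)"
  define \<theta>1 where "\<theta>1 \<omega> = fold (?sm \<omega>) [a..<a + j] (\<theta> \<omega>)" for \<omega>
  define e1 where "e1 \<omega> = \<theta>1 \<omega> - minv (A ?l) *\<^sub>v g \<omega>" for \<omega>
  let ?\<xi> = "R (Smooth m ?l (a + j))"
  let ?D = "smooth_draws m ?l a (a + j)" and ?d = "{Smooth m ?l (a + j)}"
  have D: "smooth_draws m ?l a (a + Suc j) = ?D \<union> ?d"
    by (auto simp: smooth_draws_def less_Suc_eq)
  have sub: "?D \<subseteq> draws (2 * \<kappa>) L" "?d \<subseteq> draws (2 * \<kappa>) L"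
    using l Suc.prems by (auto simp: smooth_draws_def draws_def)
  have un: "uncorrelated P (n ?l) (A ?l) e (noise ?D)" "uncorrelated P (n ?l) (A ?l) e (noise ?d)"
    using Suc.prems(2)[unfolded D noise_Un] by (rule uncorrelated_mono, blast)+
  have IH: "\<forall>\<omega>\<in>space P. \<theta>1 \<omega> \<in> carrier_vec (n ?l)"
    "update_step P (n ?l) (A ?l) (split.smooth_err l ^^ j) e e1 (noise ?D)"
    using Suc.IH Suc.prems un by (auto simp: \<theta>1_def e1_def[abs_def])
  have ce: "centered P (n ?l) ?\<xi> (M ?l + (M ?l)\<^sup>T - A ?l)"
    using Suc.prems l by (intro smooth_noise) auto
  \<comment> \<open>After j steps the error has picked up only earlier draws of the sweep, all
    uncorrelated with the next one.\<close>
  have "uncorrelated P (n ?l) (A ?l) e1 (noise ?d)"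
  proof (rule update_step_uncorrelated[OF IH(2) un(2)])
    show "covariance P g h = 0" if "g \<in> noise ?D" "h \<in> noise ?d" for g h
      by (rule noise_uncorrelated[OF sub _ that]) (auto simp: smooth_draws_def)
  qed (use noise_sq_integrable[OF sub(2)] in auto)
  then have st: "update_step P (n ?l) (A ?l) (split.smooth_err l) e1
      (\<lambda>\<omega>. split.smooth_err l (e1 \<omega>) + minv (M ?l) *\<^sub>v ?\<xi> \<omega>) (noise ?d)"
    unfolding noise_Smooth
    by (intro split.smoother_step[OF prob_space_axioms update_step_second_order[OF IH(2)] ce])
  have eq: "split.smooth_err l (e1 \<omega>) + minv (M ?l) *\<^sub>v ?\<xi> \<omega> =
      fold (?sm \<omega>) [a..<a + Suc j] (\<theta> \<omega>) - minv (A ?l) *\<^sub>v g \<omega>" if w: "\<omega> \<in> space P" for \<omega>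
    using split.smoother_error[OF c(1)[OF w], of "?\<xi> \<omega>" "\<theta>1 \<omega>"] w IH(1) ce
    by (simp add: centered_def e1_def \<theta>1_def)
  have "update_step P (n ?l) (A ?l) ((split.smooth_err l ^^ j) \<circ> split.smooth_err l) e
      (\<lambda>\<omega>. fold (?sm \<omega>) [a..<a + Suc j] (\<theta> \<omega>) - minv (A ?l) *\<^sub>v g \<omega>) (noise ?D \<union> noise ?d)"
    by (rule update_step_compose[OF IH(2) update_step_cong[OF refl eq st]]) auto
  moreover have "fold (?sm \<omega>) [a..<a + Suc j] (\<theta> \<omega>) \<in> carrier_vec (n ?l)" if w: "\<omega> \<in> space P" for \<omega>
  proof -
    have "fold (?sm \<omega>) [a..<a + Suc j] (\<theta> \<omega>) = ?sm \<omega> (a + j) (\<theta>1 \<omega>)"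
      by (simp add: \<theta>1_def)
    also have "\<dots> \<in> carrier_vec (n ?l)"
      using IH(1) c(1) ce w minv_mult_vec(1)[OF split.M(1) split.M_pos_def]
      by (auto simp: random_smoother_def centered_def)
    finally show ?thesis .
  qed
  ultimately show ?case by (simp only: D noise_Un funpow_Suc_right) blast
qed

text \<open>Only the error is assumed to be second order and uncorrelated with the noise of the
  update; g itself is constrained by its dimension alone. In this form the induction hypothesis
  applies to the random coarse problem.\<close>

lemma mgmc_step:
  fixes g \<theta> :: "'w \<Rightarrow> real vec"
  assumes "l \<le> L"
    and "\<And>\<omega>. \<omega> \<in> space P \<Longrightarrow> g \<omega> \<in> carrier_vec (n l)"
      "\<And>\<omega>. \<omega> \<in> space P \<Longrightarrow> \<theta> \<omega> \<in> carrier_vec (n l)"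
    and "second_order P (n l) (A l) (\<lambda>\<omega>. \<theta> \<omega> - minv (A l) *\<^sub>v g \<omega>)"
    and "uncorrelated P (n l) (A l) (\<lambda>\<omega>. \<theta> \<omega> - minv (A l) *\<^sub>v g \<omega>) (noise (update_draws m l))"
  shows "(\<forall>\<omega>\<in>space P. mgmc A M I \<kappa> \<kappa> (\<lambda>l k. R (Smooth m l k) \<omega>) (R (Coarse m) \<omega>) l (g \<omega>) (\<theta> \<omega>)
      \<in> carrier_vec (n l)) \<and>
    update_step P (n l) (A l) (vcycle_err l) (\<lambda>\<omega>. \<theta> \<omega> - minv (A l) *\<^sub>v g \<omega>)
    (\<lambda>\<omega>. mgmc A M I \<kappa> \<kappa> (\<lambda>l k. R (Smooth m l k) \<omega>) (R (Coarse m) \<omega>) l (g \<omega>) (\<theta> \<omega>)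
      - minv (A l) *\<^sub>v g \<omega>) (noise (update_draws m l))"
  using assms
proof (induction l arbitrary: g \<theta>)
  case 0
  let ?x = "\<lambda>\<omega>. minv (A 0) *\<^sub>v g \<omega>" and ?\<zeta> = "R (Coarse m)"
  have xc: "?x \<omega> \<in> carrier_vec (n 0)" and zc: "?\<zeta> \<omega> \<in> carrier_vec (n 0)" if "\<omega> \<in> space P" for \<omega>
    using 0 that minv_mult_vec(1)[OF A] coarse_noise[of m] by (auto simp: centered_def)
  \<comment> \<open>After exact sampling the error is the fresh noise alone. Tested in the energy
    product it has mean 0 and the target variance, so the step holds with error operator 0.\<close>
  have st: "update_step P (n 0) (A 0) (vcycle_err 0) (\<lambda>\<omega>. \<theta> \<omega> - ?x \<omega>) ?\<zeta> (noise (update_draws m 0))"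
    unfolding update_step_def
  proof (intro conjI ballI allI impI)
    fix u :: "real vec"
    assume u: "u \<in> carrier_vec (n 0)"
    have Au: "A 0 *\<^sub>v u \<in> carrier_vec (n 0)" using u by simp
    have eq: "form 0 u (?\<zeta> \<omega>) = (A 0 *\<^sub>v u) \<bullet> ?\<zeta> \<omega>" if "\<omega> \<in> space P" for \<omega>
      using symmetric_form_left[OF A(1) _ u zc[OF that]] A(2) by (simp add: sym_pos_def_def)
    have z: "form 0 (0\<^sub>v (n 0)) (\<theta> \<omega> - ?x \<omega>) = 0" if "\<omega> \<in> space P" for \<omega>
      using xc[OF that] 0(3)[OF that] by simp
    note co = coarse_noise[of m, unfolded centered_def, THEN conjunct2, rule_format, OF Au]
    have "sq_integrable P (\<lambda>\<omega>. form 0 u (?\<zeta> \<omega>)) = sq_integrable P (\<lambda>\<omega>. (A 0 *\<^sub>v u) \<bullet> ?\<zeta> \<omega>)"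
      by (rule sq_integrable_cong) (rule eq)
    then show "sq_integrable P (\<lambda>\<omega>. form 0 u (?\<zeta> \<omega>))" using co by simp
    have "expectation (\<lambda>\<omega>. form 0 u (?\<zeta> \<omega>)) = expectation (\<lambda>\<omega>. (A 0 *\<^sub>v u) \<bullet> ?\<zeta> \<omega>)"
      by (rule Bochner_Integration.integral_cong) (auto simp: eq)
    also have "\<dots> = expectation (\<lambda>\<omega>. 0)" using co by simp
    also have "\<dots> = expectation (\<lambda>\<omega>. form 0 (vcycle_err 0 u) (\<theta> \<omega> - ?x \<omega>))"
      by (rule Bochner_Integration.integral_cong) (auto simp: z)
    finally show "expectation (\<lambda>\<omega>. form 0 u (?\<zeta> \<omega>)) =
        expectation (\<lambda>\<omega>. form 0 (vcycle_err 0 u) (\<theta> \<omega> - ?x \<omega>))" .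
    have cz: "covariance P (\<lambda>\<omega>. form 0 (vcycle_err 0 u) (\<theta> \<omega> - ?x \<omega>)) Y = 0" for Y
    proof -
      have "covariance P (\<lambda>\<omega>. form 0 (vcycle_err 0 u) (\<theta> \<omega> - ?x \<omega>)) Y = covariance P (\<lambda>\<omega>. 0) Y"
        by (rule covariance_cong) (auto simp: z)
      then show ?thesis by (simp add: covariance_const_left)
    qed
    have "covariance P (\<lambda>\<omega>. form 0 u (?\<zeta> \<omega>)) (\<lambda>\<omega>. form 0 u (?\<zeta> \<omega>)) =
        (A 0 *\<^sub>v u) \<bullet> (minv (A 0) *\<^sub>v (A 0 *\<^sub>v u))"
      using co covariance_cong[of P "\<lambda>\<omega>. form 0 u (?\<zeta> \<omega>)", OF eq eq] by simp
    also have "\<dots> = form 0 u u"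
      using minv_mult_vec(3)[OF A u] comm_scalar_prod[OF Au u] by simp
    finally show "covariance P (\<lambda>\<omega>. form 0 u (?\<zeta> \<omega>)) (\<lambda>\<omega>. form 0 u (?\<zeta> \<omega>)) - form 0 u u =
        covariance P (\<lambda>\<omega>. form 0 (vcycle_err 0 u) (\<theta> \<omega> - ?x \<omega>))
          (\<lambda>\<omega>. form 0 (vcycle_err 0 u) (\<theta> \<omega> - ?x \<omega>)) - form 0 (vcycle_err 0 u) (vcycle_err 0 u)"
      using cz by (simp add: mult_mat_zero_vec[OF A(1)])
    fix Y assume Y: "sq_integrable P Y \<and> (\<forall>g\<in>noise (update_draws m 0). covariance P g Y = 0)"
    have "(\<lambda>\<omega>. (A 0 *\<^sub>v u) \<bullet> ?\<zeta> \<omega>) \<in> noise (update_draws m 0)"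
      using Au unfolding noise_def update_draws_def by (auto simp: draw_dim_def)
    then have "covariance P (\<lambda>\<omega>. (A 0 *\<^sub>v u) \<bullet> ?\<zeta> \<omega>) Y = 0" using Y by blast
    then show "covariance P (\<lambda>\<omega>. form 0 u (?\<zeta> \<omega>)) Y =
        covariance P (\<lambda>\<omega>. form 0 (vcycle_err 0 u) (\<theta> \<omega> - ?x \<omega>)) Y"
      using covariance_cong[of P "\<lambda>\<omega>. form 0 u (?\<zeta> \<omega>)", OF eq refl] cz by simp
  qed (use zc in simp)
  have eq: "?\<zeta> \<omega> = ?x \<omega> + ?\<zeta> \<omega> - ?x \<omega>" if "\<omega> \<in> space P" for \<omega>
  proof -
    have "z = x + z - x" if "x \<in> carrier_vec (n 0)" "z \<in> carrier_vec (n 0)" for x z :: "real vec"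
      using that by (intro eq_vecI) auto
    then show ?thesis using xc[OF that] zc[OF that] .
  qed
  have "update_step P (n 0) (A 0) (vcycle_err 0) (\<lambda>\<omega>. \<theta> \<omega> - ?x \<omega>)
      (\<lambda>\<omega>. ?x \<omega> + ?\<zeta> \<omega> - ?x \<omega>) (noise (update_draws m 0))"
    by (rule update_step_cong[OF refl eq st])
  then show ?case using xc zc by (simp del: vcycle_err.simps(1))
next
  case (Suc l)
  let ?l = "Suc l"
  let ?x = "\<lambda>\<omega>. minv (A ?l) *\<^sub>v g \<omega>"
  let ?sm = "\<lambda>\<omega> k. random_smoother (A ?l) (M ?l) (g \<omega>) (R (Smooth m ?l k) \<omega>)"
  define e0 where "e0 \<omega> = \<theta> \<omega> - ?x \<omega>" for \<omega>
  define \<theta>1 where "\<theta>1 \<omega> = fold (?sm \<omega>) [0..<\<kappa>] (\<theta> \<omega>)" for \<omega>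
  define e1 where "e1 \<omega> = \<theta>1 \<omega> - ?x \<omega>" for \<omega>
  define gc where "gc \<omega> = (I ?l)\<^sup>T *\<^sub>v (g \<omega> - A ?l *\<^sub>v \<theta>1 \<omega>)" for \<omega>
  define \<psi> where "\<psi> \<omega> = mgmc A M I \<kappa> \<kappa> (\<lambda>l k. R (Smooth m l k) \<omega>) (R (Coarse m) \<omega>) l (gc \<omega>) (0\<^sub>v (n l))" for \<omega>
  define \<theta>2 where "\<theta>2 \<omega> = \<theta>1 \<omega> + I ?l *\<^sub>v \<psi> \<omega>" for \<omega>
  define e2 where "e2 \<omega> = \<theta>2 \<omega> - ?x \<omega>" for \<omega>
  define \<theta>3 where "\<theta>3 \<omega> = fold (?sm \<omega>) [\<kappa>..<\<kappa> + \<kappa>] (\<theta>2 \<omega>)" for \<omega>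
  define e3 where "e3 \<omega> = \<theta>3 \<omega> - ?x \<omega>" for \<omega>
  let ?D1 = "smooth_draws m ?l 0 \<kappa>" and ?D2 = "update_draws m l"
    and ?D3 = "smooth_draws m ?l \<kappa> (\<kappa> + \<kappa>)"
  have D: "update_draws m ?l = ?D1 \<union> ?D2 \<union> ?D3"
    by (auto simp: update_draws_def smooth_draws_def le_Suc_eq)
  have l: "l \<le> L" "?l \<le> L" using Suc.prems by auto
  have sub: "?D1 \<subseteq> draws (2 * \<kappa>) L" "?D2 \<subseteq> draws (2 * \<kappa>) L" "?D3 \<subseteq> draws (2 * \<kappa>) L"
    using smooth_draws_subset[OF l(2)] update_draws_subset[OF l(1)] by auto
  have disj: "?D1 \<inter> ?D2 = {}" "?D1 \<inter> ?D3 = {}" "?D2 \<inter> ?D3 = {}"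
    by (auto simp: update_draws_def smooth_draws_def)
  have mg: "mgmc A M I \<kappa> \<kappa> (\<lambda>l k. R (Smooth m l k) \<omega>) (R (Coarse m) \<omega>) ?l (g \<omega>) (\<theta> \<omega>) = \<theta>3 \<omega>" for \<omega>
    using A(1)[of l]
    by (simp add: Let_def \<theta>3_def \<theta>2_def \<psi>_def gc_def \<theta>1_def)
  have un0: "uncorrelated P (n ?l) (A ?l) e0 (noise ?D1)" "uncorrelated P (n ?l) (A ?l) e0 (noise ?D2)"
    "uncorrelated P (n ?l) (A ?l) e0 (noise ?D3)"
    using Suc.prems(5)[unfolded D noise_Un] unfolding e0_def[abs_def]
    by (rule uncorrelated_mono, blast)+
  have so0: "second_order P (n ?l) (A ?l) e0" using Suc.prems(4) by (simp add: e0_def[abs_def])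
  have xc: "?x \<omega> \<in> carrier_vec (n ?l)" if "\<omega> \<in> space P" for \<omega>
    using minv_mult_vec(1)[OF A Suc.prems(2)[OF that]] .
  have 1: "\<forall>\<omega>\<in>space P. \<theta>1 \<omega> \<in> carrier_vec (n ?l)"
    "update_step P (n ?l) (A ?l) (split.smooth_err l ^^ \<kappa>) e0 e1 (noise ?D1)"
    using smoothing_sweep_step[where g = g and \<theta> = \<theta> and a = 0 and j = \<kappa> and m = m, OF l(2) _ Suc.prems(2,3)] so0 un0(1)
    by (auto simp: e0_def[abs_def] e1_def[abs_def] \<theta>1_def[abs_def])
  have so1: "second_order P (n ?l) (A ?l) e1" by (rule update_step_second_order[OF 1(2)])
  have un1: "uncorrelated P (n ?l) (A ?l) e1 (noise ?D2)" "uncorrelated P (n ?l) (A ?l) e1 (noise ?D3)"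
    using noise_uncorrelated[OF sub(1,2) disj(1)] noise_uncorrelated[OF sub(1,3) disj(2)]
      noise_sq_integrable[OF sub(2)] noise_sq_integrable[OF sub(3)]
    by (auto intro!: update_step_uncorrelated[OF 1(2)] un0)
  have e1c: "e1 \<omega> \<in> carrier_vec (n ?l)" if "\<omega> \<in> space P" for \<omega>
    using so1 that by (simp add: second_order_def)
  have gcc: "gc \<omega> \<in> carrier_vec (n l)" if "\<omega> \<in> space P" for \<omega>
    using that Suc.prems(2) 1(1) by (simp add: gc_def)
  \<comment> \<open>The residual of \<open>\<theta>1\<close> is minus A applied to
    \<open>e1\<close>, so the exact coarse solution is minus \<open>proj l (e1 \<omega>)\<close>.
    This is why starting the coarse update at 0 means starting with error
    \<open>proj l (e1 \<omega>)\<close>.\<close>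
  have gce: "0\<^sub>v (n l) - minv (A l) *\<^sub>v gc \<omega> = proj l (e1 \<omega>)" if w: "\<omega> \<in> space P" for \<omega>
  proof -
    have gw: "g \<omega> \<in> carrier_vec (n ?l)" using Suc.prems(2)[OF w] .
    have "g \<omega> - A ?l *\<^sub>v \<theta>1 \<omega> = 0\<^sub>v (n ?l) - A ?l *\<^sub>v e1 \<omega>"
      using gw w 1(1) xc[OF w] A(1)[of ?l] minv_mult_vec(2)[OF A gw]
      unfolding e1_def by (subst mult_minus_distrib_mat_vec[of _ "n ?l" "n ?l"]) (auto intro!: eq_vecI)
    note diff = this
    have neg: "T *\<^sub>v (0\<^sub>v k - z) = 0\<^sub>v j - T *\<^sub>v z" if "T \<in> carrier_mat j k" "z \<in> carrier_vec k"
      for T :: "real mat" and j k z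
      using mult_minus_distrib_mat_vec[OF that(1) zero_carrier_vec that(2)] mult_mat_zero_vec[OF that(1)]
      by (simp only:)
    have "gc \<omega> = 0\<^sub>v (n l) - (I ?l)\<^sup>T *\<^sub>v (A ?l *\<^sub>v e1 \<omega>)"
      unfolding gc_def diff using I[of l] e1c[OF w] by (intro neg) auto
    then have "minv (A l) *\<^sub>v gc \<omega> = 0\<^sub>v (n l) - proj l (e1 \<omega>)"
      unfolding proj_def using e1c[OF w] by (simp only:) (intro neg sym_pos_def_inverse(1)[OF A], simp)
    then show ?thesis using proj_carrier[OF e1c[OF w]] by (auto intro!: eq_vecI)
  qed
  \<comment> \<open>Testing the projected error with z amounts to testing \<open>e1\<close> with the
    prolongation of z, so moments and missing correlations carry over to the coarse level.\<close>
  have pso: "second_order P (n l) (A l) (\<lambda>\<omega>. proj l (e1 \<omega>))"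
    unfolding second_order_def
  proof (intro conjI ballI)
    fix z :: "real vec" assume z: "z \<in> carrier_vec (n l)"
    have "sq_integrable P (\<lambda>\<omega>. form l z (proj l (e1 \<omega>))) =
        sq_integrable P (\<lambda>\<omega>. form ?l (I ?l *\<^sub>v z) (e1 \<omega>))"
      by (rule sq_integrable_cong) (rule proj_form[OF e1c z])
    then show "sq_integrable P (\<lambda>\<omega>. form l z (proj l (e1 \<omega>)))"
      using so1 z by (simp add: second_order_def)
  qed (use e1c in auto)
  have pun: "uncorrelated P (n l) (A l) (\<lambda>\<omega>. proj l (e1 \<omega>)) (noise ?D2)"
    unfolding uncorrelated_def
  proof (intro ballI)
    fix z :: "real vec" and h assume z: "z \<in> carrier_vec (n l)" and h: "h \<in> noise ?D2"
    have "covariance P (\<lambda>\<omega>. form l z (proj l (e1 \<omega>))) h =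
        covariance P (\<lambda>\<omega>. form ?l (I ?l *\<^sub>v z) (e1 \<omega>)) h"
      by (rule covariance_cong[OF proj_form[OF e1c z] refl])
    then show "covariance P (\<lambda>\<omega>. form l z (proj l (e1 \<omega>))) h = 0"
      using un1(1) z h by (simp add: uncorrelated_def)
  qed
  have IH: "(\<forall>\<omega>\<in>space P. \<psi> \<omega> \<in> carrier_vec (n l)) \<and>
    update_step P (n l) (A l) (vcycle_err l) (\<lambda>\<omega>. 0\<^sub>v (n l) - minv (A l) *\<^sub>v gc \<omega>)
      (\<lambda>\<omega>. \<psi> \<omega> - minv (A l) *\<^sub>v gc \<omega>) (noise ?D2)"
    unfolding \<psi>_def
  proof (rule Suc.IH[OF l(1) gcc])
    show "second_order P (n l) (A l) (\<lambda>\<omega>. 0\<^sub>v (n l) - minv (A l) *\<^sub>v gc \<omega>)"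
      using second_order_cong[of P "\<lambda>\<omega>. proj l (e1 \<omega>)", OF gce[symmetric]] pso by simp
    show "uncorrelated P (n l) (A l) (\<lambda>\<omega>. 0\<^sub>v (n l) - minv (A l) *\<^sub>v gc \<omega>) (noise ?D2)"
      using uncorrelated_cong[of P "\<lambda>\<omega>. proj l (e1 \<omega>)", OF gce[symmetric]] pun by simp
  qed auto
  have cst: "update_step P (n l) (A l) (vcycle_err l) (\<lambda>\<omega>. proj l (e1 \<omega>))
      (\<lambda>\<omega>. \<psi> \<omega> - minv (A l) *\<^sub>v gc \<omega>) (noise ?D2)"
    by (rule update_step_cong[OF gce refl conjunct2[OF IH]])
  have e2eq: "e1 \<omega> + I ?l *\<^sub>v (\<psi> \<omega> - minv (A l) *\<^sub>v gc \<omega> - proj l (e1 \<omega>)) = e2 \<omega>"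
    if w: "\<omega> \<in> space P" for \<omega>
  proof -
    have pc: "\<psi> \<omega> \<in> carrier_vec (n l)" "minv (A l) *\<^sub>v gc \<omega> \<in> carrier_vec (n l)"
      using IH w minv_mult_vec(1)[OF A gcc[OF w]] by auto
    have "a - b - (0\<^sub>v (n l) - b) = a" if "a \<in> carrier_vec (n l)" "b \<in> carrier_vec (n l)"
      for a b :: "real vec"
      using that by (intro eq_vecI) auto
    from this[OF pc] have "\<psi> \<omega> - minv (A l) *\<^sub>v gc \<omega> - proj l (e1 \<omega>) = \<psi> \<omega>"
      by (simp only: gce[OF w])
    moreover have "t - x + p = t + p - x"
      if "t \<in> carrier_vec (n ?l)" "x \<in> carrier_vec (n ?l)" "p \<in> carrier_vec (n ?l)" for t x p :: "real vec"
      using that by (intro eq_vecI) auto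
    ultimately show ?thesis
      using pc xc[OF w] 1(1) w unfolding e1_def e2_def \<theta>2_def by simp
  qed
  have 2: "update_step P (n ?l) (A ?l) (coarse_err l) e1 e2 (noise ?D2)"
    by (rule update_step_cong[OF refl e2eq
          coarse_step[OF prob_space_axioms so1 un1(1) cst noise_sq_integrable[OF sub(2)]]])
  have so2: "second_order P (n ?l) (A ?l) e2" by (rule update_step_second_order[OF 2])
  have un2: "uncorrelated P (n ?l) (A ?l) e2 (noise ?D3)"
    using noise_uncorrelated[OF sub(2,3) disj(3)] noise_sq_integrable[OF sub(3)]
    by (auto intro!: update_step_uncorrelated[OF 2] un1)
  have \<theta>2c: "\<theta>2 \<omega> \<in> carrier_vec (n ?l)" if "\<omega> \<in> space P" for \<omega>
    using that 1(1) IH by (simp add: \<theta>2_def)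
  have 3: "\<forall>\<omega>\<in>space P. \<theta>3 \<omega> \<in> carrier_vec (n ?l)"
    "update_step P (n ?l) (A ?l) (split.smooth_err l ^^ \<kappa>) e2 e3 (noise ?D3)"
    using smoothing_sweep_step[where g = g and \<theta> = \<theta>2 and a = \<kappa> and j = \<kappa> and m = m, OF l(2) _ Suc.prems(2) \<theta>2c] so2 un2
    by (auto simp: e2_def[abs_def] e3_def[abs_def] \<theta>3_def[abs_def])
  \<comment> \<open>Composition lists the operators in test-vector order; the cycle being a
    palindrome, the result is \<open>vcycle_err\<close> again.\<close>
  have "update_step P (n ?l) (A ?l)
      (((split.smooth_err l ^^ \<kappa>) \<circ> coarse_err l) \<circ> (split.smooth_err l ^^ \<kappa>)) e0 e3
      (noise ?D1 \<union> noise ?D2 \<union> noise ?D3)"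
    by (rule update_step_compose[OF update_step_compose[OF 1(2) 2] 3(2)]) auto
  moreover have "((split.smooth_err l ^^ \<kappa>) \<circ> coarse_err l) \<circ> (split.smooth_err l ^^ \<kappa>) = vcycle_err ?l"
    by (rule ext) (simp add: vcycle_err_Suc)
  ultimately show ?case
    using 3(1) unfolding mg D noise_Un by (simp only: e0_def[abs_def] e3_def[abs_def])
qed

end

section \<open>Moments and autocovariances of the chain\<close>

context mgmc_draws
begin

definition chain :: "nat \<Rightarrow> 'w \<Rightarrow> real vec" where
  "chain = mgmc_chain A M I \<kappa> \<kappa> L f R"

definition chain_err :: "nat \<Rightarrow> 'w \<Rightarrow> real vec" where
  "chain_err m \<omega> = chain m \<omega> - minv (A L) *\<^sub>v f"

lemma target_mean_carrier: "minv (A L) *\<^sub>v f \<in> carrier_vec (n L)"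
  by (rule minv_mult_vec(1)[OF A f])

lemma form_chain_err_0:
  assumes "u \<in> carrier_vec (n L)" "\<omega> \<in> space P"
  shows "form L u (chain_err 0 \<omega>) = (A L *\<^sub>v u) \<bullet> R Init \<omega> + - form L u (minv (A L) *\<^sub>v f)"
  using assms init(1) target_mean_carrier form_commute[of u L "R Init \<omega>"]
    comm_scalar_prod[of "R Init \<omega>" "n L" "A L *\<^sub>v u"]
  by (simp add: chain_err_def chain_def form_diff_right)

lemma chain_err_0_second_order: "second_order P (n L) (A L) (chain_err 0)"
  unfolding second_order_def
proof (intro conjI ballI)
  fix u :: "real vec" assume u: "u \<in> carrier_vec (n L)"
  have "sq_integrable P (\<lambda>\<omega>. form L u (chain_err 0 \<omega>)) =
      sq_integrable P (\<lambda>\<omega>. (A L *\<^sub>v u) \<bullet> R Init \<omega> + - form L u (minv (A L) *\<^sub>v f))"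
    by (rule sq_integrable_cong) (rule form_chain_err_0[OF u])
  then show "sq_integrable P (\<lambda>\<omega>. form L u (chain_err 0 \<omega>))"
    using sq_integrable_add[OF init(2)[OF A_carrier_vec[OF u]] sq_integrable_const] by (simp only:)
qed (use init(1) target_mean_carrier in \<open>simp add: chain_err_def chain_def\<close>)

lemma covariance_chain_err_0:
  assumes "u \<in> carrier_vec (n L)"
  shows "covariance P (\<lambda>\<omega>. form L u (chain_err 0 \<omega>)) Y = covariance P (\<lambda>\<omega>. (A L *\<^sub>v u) \<bullet> R Init \<omega>) Y"
proof -
  have "covariance P (\<lambda>\<omega>. form L u (chain_err 0 \<omega>)) Y =
      covariance P (\<lambda>\<omega>. (A L *\<^sub>v u) \<bullet> R Init \<omega> + - form L u (minv (A L) *\<^sub>v f)) Y"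
    by (rule covariance_cong) (auto simp: form_chain_err_0[OF assms])
  also have "\<dots> = covariance P (\<lambda>\<omega>. (A L *\<^sub>v u) \<bullet> R Init \<omega>) Y"
    using assms by (intro covariance_add_const_left init(2)) simp
  finally show ?thesis .
qed

lemma chain_err_0_uncorrelated: "uncorrelated P (n L) (A L) (chain_err 0) (noise (update_draws m L))"
  unfolding uncorrelated_def
proof (intro ballI)
  fix u :: "real vec" and g
  assume u: "u \<in> carrier_vec (n L)" and g: "g \<in> noise (update_draws m L)"
  have "(\<lambda>\<omega>. (A L *\<^sub>v u) \<bullet> R Init \<omega>) \<in> noise {Init}"
    using u A_carrier_vec[OF u] unfolding noise_def by (auto simp: draw_dim_def)
  then have "covariance P (\<lambda>\<omega>. (A L *\<^sub>v u) \<bullet> R Init \<omega>) g = 0"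
    by (rule noise_uncorrelated[rotated 3, OF _ g])
      (auto simp: draws_def update_draws_def)
  then show "covariance P (\<lambda>\<omega>. form L u (chain_err 0 \<omega>)) g = 0"
    by (simp add: covariance_chain_err_0[OF u])
qed

text \<open>The invariant covers the noise of all updates m' >= m, since a state must still be
  uncorrelated with the draws of updates far ahead. The step at m needs the invariant at m, and the
  invariant at m + 1 comes from that step.\<close>

lemma chain_invariant:
  "(\<forall>\<omega>\<in>space P. chain m \<omega> \<in> carrier_vec (n L)) \<and> second_order P (n L) (A L) (chain_err m) \<and>
    (\<forall>m'\<ge>m. uncorrelated P (n L) (A L) (chain_err m) (noise (update_draws m' L)))"
  and chain_step: "update_step P (n L) (A L) (vcycle_err L) (chain_err m) (chain_err (Suc m))
    (noise (update_draws m L))"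
proof -
  let ?inv = "\<lambda>m. (\<forall>\<omega>\<in>space P. chain m \<omega> \<in> carrier_vec (n L)) \<and> second_order P (n L) (A L) (chain_err m) \<and>
    (\<forall>m'\<ge>m. uncorrelated P (n L) (A L) (chain_err m) (noise (update_draws m' L)))"
  have st: "(\<forall>\<omega>\<in>space P. chain (Suc m) \<omega> \<in> carrier_vec (n L)) \<and>
      update_step P (n L) (A L) (vcycle_err L) (chain_err m) (chain_err (Suc m)) (noise (update_draws m L))"
    if "?inv m" for m
    using mgmc_step[of L "\<lambda>_. f" "chain m" m] that f by (simp add: chain_err_def[abs_def] chain_def)
  have inv: "?inv m" for m
  proof (induction m)
    case 0
    show ?case
      using init(1) chain_err_0_second_order chain_err_0_uncorrelated by (simp add: chain_def)
  next
    case (Suc m)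
    note s = st[OF Suc]
    have "uncorrelated P (n L) (A L) (chain_err (Suc m)) (noise (update_draws m' L))" if "Suc m \<le> m'" for m'
    proof (rule update_step_uncorrelated[OF conjunct2[OF s]])
      show "uncorrelated P (n L) (A L) (chain_err m) (noise (update_draws m' L))" using Suc that by simp
      show "sq_integrable P h" if "h \<in> noise (update_draws m' L)" for h
        using noise_sq_integrable[OF update_draws_subset that] by simp
      show "covariance P g h = 0" if "g \<in> noise (update_draws m L)" "h \<in> noise (update_draws m' L)" for g h
        by (rule noise_uncorrelated[OF update_draws_subset update_draws_subset _ that])
          (use \<open>Suc m \<le> m'\<close> in \<open>auto simp: update_draws_def\<close>)
    qed simp
    then show ?case using s update_step_second_order by blast
  qed
  show "?inv m" by (rule inv)
  show "update_step P (n L) (A L) (vcycle_err L) (chain_err m) (chain_err (Suc m)) (noise (update_draws m L))"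
    using st[OF inv] by blast
qed

lemma chain_sq_integrable:
  "u \<in> carrier_vec (n L) \<Longrightarrow> sq_integrable P (\<lambda>\<omega>. form L u (chain_err m \<omega>))"
  using chain_invariant[of m] by (simp add: second_order_def)

lemmas chain_step_unfolded = chain_step[unfolded update_step_def, THEN conjunct2, rule_format]

abbreviation chain_var :: "nat \<Rightarrow> real vec \<Rightarrow> real" where
  "chain_var m u \<equiv> covariance P (\<lambda>\<omega>. form L u (chain_err m \<omega>)) (\<lambda>\<omega>. form L u (chain_err m \<omega>))"

text \<open>Each update replaces u by E u and lowers the time by one. What is transported is the
  difference to the target variance, because the fresh noise restores precisely the energy lost in
  passing from u to E u.\<close>

lemma chain_moments:
  assumes "u \<in> carrier_vec (n L)"
  shows "expectation (\<lambda>\<omega>. form L u (chain_err m \<omega>)) =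
      expectation (\<lambda>\<omega>. form L ((vcycle_err L ^^ m) u) (chain_err 0 \<omega>)) \<and>
    chain_var m u - form L u u = chain_var 0 ((vcycle_err L ^^ m) u) -
      form L ((vcycle_err L ^^ m) u) ((vcycle_err L ^^ m) u)"
  using assms
proof (induction m arbitrary: u)
  case (Suc m)
  have Eu: "vcycle_err L u \<in> carrier_vec (n L)" using Suc.prems by simp
  have "expectation (\<lambda>\<omega>. form L u (chain_err (Suc m) \<omega>)) =
      expectation (\<lambda>\<omega>. form L (vcycle_err L u) (chain_err m \<omega>))"
    and "chain_var (Suc m) u - form L u u =
      chain_var m (vcycle_err L u) - form L (vcycle_err L u) (vcycle_err L u)"
    using chain_step_unfolded[OF Suc.prems, of m] by blast+
  then show ?case
    using Suc.IH[OF Eu] by (simp add: funpow_Suc_right del: funpow.simps)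
qed simp

text \<open>The functional at time m is uncorrelated with the noise of all later updates and so acts
  as Y in each of the s steps. The second vector w is kept apart since only u changes in the
  induction.\<close>

lemma chain_autocovariance:
  assumes "u \<in> carrier_vec (n L)" "w \<in> carrier_vec (n L)"
  shows "covariance P (\<lambda>\<omega>. form L u (chain_err (m + s) \<omega>)) (\<lambda>\<omega>. form L w (chain_err m \<omega>)) =
    covariance P (\<lambda>\<omega>. form L ((vcycle_err L ^^ s) u) (chain_err m \<omega>)) (\<lambda>\<omega>. form L w (chain_err m \<omega>))"
  using assms(1)
proof (induction s arbitrary: u)
  case (Suc s)
  have Eu: "vcycle_err L u \<in> carrier_vec (n L)" using Suc.prems by simp
  let ?Y = "\<lambda>\<omega>. form L w (chain_err m \<omega>)"
  have "uncorrelated P (n L) (A L) (chain_err m) (noise (update_draws (m + s) L))"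
    using chain_invariant[of m] by simp
  then have "covariance P g ?Y = 0" if "g \<in> noise (update_draws (m + s) L)" for g
    using that assms(2) unfolding covariance_commute[of P g] by (simp add: uncorrelated_def)
  then have "covariance P (\<lambda>\<omega>. form L u (chain_err (Suc (m + s)) \<omega>)) ?Y =
      covariance P (\<lambda>\<omega>. form L (vcycle_err L u) (chain_err (m + s) \<omega>)) ?Y"
    using chain_step_unfolded[OF Suc.prems, of "m + s"] chain_sq_integrable[OF assms(2)] by blast
  then show ?case using Suc.IH[OF Eu] by (simp add: funpow_Suc_right del: funpow.simps)
qed simp

end

section \<open>Explicit bounds for linear functionals of the chain\<close>

locale mgmc_bounded_init = mgmc_draws n A M I \<kappa> C\<^sub>A P L f R
  for n :: "nat \<Rightarrow> nat" and A M I :: "nat \<Rightarrow> real mat" and \<kappa> :: nat and C\<^sub>A :: real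
    and P :: "'w measure" and L :: nat and f :: "real vec" and R :: "draw \<Rightarrow> 'w \<Rightarrow> real vec" +
  fixes C\<^sub>0 :: real
  assumes \<kappa>_pos: "0 < \<kappa>"
    and init_mean: "u \<in> carrier_vec (n L) \<Longrightarrow>
      \<bar>expectation (\<lambda>\<omega>. (A L *\<^sub>v u) \<bullet> R Init \<omega>)\<bar> \<le> C\<^sub>0 * sqrt (u \<bullet> (A L *\<^sub>v u))"
    and init_var: "u \<in> carrier_vec (n L) \<Longrightarrow>
      covariance P (\<lambda>\<omega>. (A L *\<^sub>v u) \<bullet> R Init \<omega>) (\<lambda>\<omega>. (A L *\<^sub>v u) \<bullet> R Init \<omega>) \<le> C\<^sub>0 * (u \<bullet> (A L *\<^sub>v u))"
    and C\<^sub>0_nonneg: "0 \<le> C\<^sub>0"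
begin

lemma rate_less_1: "rate < 1"
  using C\<^sub>A_pos \<kappa>_pos by (simp add: rate_def)

lemma form_Cauchy_Schwarz:
  assumes "u \<in> carrier_vec (n L)" "w \<in> carrier_vec (n L)"
  shows "\<bar>form L u w\<bar> \<le> sqrt (form L u u) * sqrt (form L w w)"
  using psd_form_Cauchy_Schwarz[OF A(1) sym_pos_def_imp_sym_psd[OF A] assms]
    msqrt_form[OF A(1) sym_pos_def_imp_sym_psd[OF A]] assms
  by (simp add: euclidean_norm_def)

lemma chain_var_0:
  assumes "u \<in> carrier_vec (n L)"
  shows "0 \<le> chain_var 0 u" "chain_var 0 u \<le> C\<^sub>0 * form L u u"
proof -
  have "chain_var 0 u =
      covariance P (\<lambda>\<omega>. (A L *\<^sub>v u) \<bullet> R Init \<omega>) (\<lambda>\<omega>. (A L *\<^sub>v u) \<bullet> R Init \<omega>)"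
    using covariance_chain_err_0[OF assms] covariance_commute by metis
  then show "0 \<le> chain_var 0 u" "chain_var 0 u \<le> C\<^sub>0 * form L u u"
    using init_var[OF assms] covariance_self_nonneg by auto
qed

text \<open>The initial error is the initial state minus the target mean. The energy norms of their
  expectations are bounded by \<open>C\<^sub>0\<close> and by the square root of the form of A^-1 at
  f, and the test vector E^m v supplies the factor \<open>rate ^ m\<close>.\<close>

lemma chain_mean_bound:
  assumes v: "v \<in> carrier_vec (n L)"
  shows "\<bar>expectation (\<lambda>\<omega>. form L v (chain_err m \<omega>))\<bar> \<le>
    (C\<^sub>0 + sqrt (f \<bullet> (minv (A L) *\<^sub>v f))) * rate ^ m * sqrt (form L v v)"
proof -
  let ?x = "minv (A L) *\<^sub>v f"
  define u where "u = (vcycle_err L ^^ m) v"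
  have u: "u \<in> carrier_vec (n L)" using v by (simp add: u_def)
  have Au: "A L *\<^sub>v u \<in> carrier_vec (n L)" using u by simp
  have "expectation (\<lambda>\<omega>. form L v (chain_err m \<omega>)) = expectation (\<lambda>\<omega>. form L u (chain_err 0 \<omega>))"
    using chain_moments[OF v, of m] by (simp add: u_def)
  also have "\<dots> = expectation (\<lambda>\<omega>. (A L *\<^sub>v u) \<bullet> R Init \<omega> + - form L u ?x)"
    by (rule Bochner_Integration.integral_cong) (auto simp: form_chain_err_0[OF u])
  also have "\<dots> = expectation (\<lambda>\<omega>. (A L *\<^sub>v u) \<bullet> R Init \<omega>) - form L u ?x"
    using sq_integrable_integrable[OF init(2)[OF Au]] by (simp add: prob_space)
  finally have "\<bar>expectation (\<lambda>\<omega>. form L v (chain_err m \<omega>))\<bar> \<le>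
      C\<^sub>0 * sqrt (form L u u) + sqrt (form L u u) * sqrt (form L ?x ?x)"
    using init_mean[OF u] form_Cauchy_Schwarz[OF u target_mean_carrier] by linarith
  also have "form L ?x ?x = f \<bullet> ?x"
    using minv_mult_vec(2)[OF A f] comm_scalar_prod[OF f target_mean_carrier] by simp
  also have "C\<^sub>0 * sqrt (form L u u) + sqrt (form L u u) * sqrt (f \<bullet> ?x) =
      (C\<^sub>0 + sqrt (f \<bullet> ?x)) * sqrt (form L u u)" by (simp add: algebra_simps)
  also have "\<dots> \<le> (C\<^sub>0 + sqrt (f \<bullet> ?x)) * (rate ^ m * sqrt (form L v v))"
  proof (rule mult_left_mono)
    have "sqrt (form L u u) \<le> sqrt ((rate ^ m)\<^sup>2 * form L v v)"
      using vcycle_err_pow_contraction[OF v, of m] by (simp add: u_def power_mult mult.commute flip: power_mult)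
    also have "\<dots> = rate ^ m * sqrt (form L v v)"
      using rate_pos by (simp add: real_sqrt_mult)
    finally show "sqrt (form L u u) \<le> rate ^ m * sqrt (form L v v)" .
    show "0 \<le> C\<^sub>0 + sqrt (f \<bullet> ?x)" using C\<^sub>0_nonneg minv_form_nonneg[OF A f] by simp
  qed
  finally show ?thesis by (simp add: mult.assoc)
qed

text \<open>The difference to the target variance is the initial variance at E^m v minus the energy
  of E^m v, both nonnegative; dropping either of the two leaves one of the bounds.\<close>

lemma chain_var_bounds:
  assumes v: "v \<in> carrier_vec (n L)"
  shows "form L v v - rate ^ (2 * m) * form L v v \<le> chain_var m v"
    and "chain_var m v \<le> form L v v + C\<^sub>0 * rate ^ (2 * m) * form L v v"
proof -
  define u where "u = (vcycle_err L ^^ m) v"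
  have u: "u \<in> carrier_vec (n L)" using v by (simp add: u_def)
  have eq: "chain_var m v - form L v v = chain_var 0 u - form L u u"
    using chain_moments[OF v, of m] by (simp add: u_def)
  have con: "form L u u \<le> rate ^ (2 * m) * form L v v"
    using vcycle_err_pow_contraction[OF v, of m] by (simp add: u_def)
  show "form L v v - rate ^ (2 * m) * form L v v \<le> chain_var m v"
    using eq con chain_var_0(1)[OF u] by linarith
  have "C\<^sub>0 * form L u u \<le> C\<^sub>0 * (rate ^ (2 * m) * form L v v)"
    using con C\<^sub>0_nonneg by (rule mult_left_mono)
  then show "chain_var m v \<le> form L v v + C\<^sub>0 * rate ^ (2 * m) * form L v v"
    using eq chain_var_0(2)[OF u] form_nonneg[OF u] by (simp add: mult.assoc)
qed

lemma chain_var_upper: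
  assumes v: "v \<in> carrier_vec (n L)"
  shows "chain_var m v \<le> (1 + C\<^sub>0) * form L v v"
proof -
  have "rate ^ (2 * m) \<le> 1" using rate_pos rate_le_1 by (intro power_le_one) auto
  then have "C\<^sub>0 * rate ^ (2 * m) * form L v v \<le> C\<^sub>0 * form L v v"
    using C\<^sub>0_nonneg form_nonneg[OF v] by (intro mult_right_mono mult_left_le) auto
  then show ?thesis using chain_var_bounds(2)[OF v, of m] by (simp add: algebra_simps)
qed

lemma chain_autocovariance_bound:
  assumes v: "v \<in> carrier_vec (n L)"
  shows "\<bar>covariance P (\<lambda>\<omega>. form L v (chain_err (m + s) \<omega>)) (\<lambda>\<omega>. form L v (chain_err m \<omega>))\<bar>
    \<le> (1 + C\<^sub>0) * rate ^ s * form L v v"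
proof -
  define u where "u = (vcycle_err L ^^ s) v"
  have u: "u \<in> carrier_vec (n L)" using v by (simp add: u_def)
  \<comment> \<open>The weight of the covariance bound: the variance at E^s v carries a factor r^2,
    so dividing by r and multiplying the variance at v by r gives two terms of the same
    size.\<close>
  define r where "r = rate ^ s"
  have r: "0 < r" using rate_pos by (simp add: r_def)
  have con: "form L u u \<le> r\<^sup>2 * form L v v"
    using vcycle_err_pow_contraction[OF v, of s]
    by (simp add: u_def r_def power_mult mult.commute flip: power_mult)
  have "chain_var m u / r \<le> (1 + C\<^sub>0) * (r\<^sup>2 * form L v v) / r"
    using chain_var_upper[OF u, of m] con C\<^sub>0_nonneg r
    by (intro divide_right_mono order.trans[OF chain_var_upper[OF u]] mult_left_mono) auto
  also have "\<dots> = (1 + C\<^sub>0) * r * form L v v" using r by (simp add: power2_eq_square)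
  finally have 1: "chain_var m u / r \<le> (1 + C\<^sub>0) * r * form L v v" .
  have 2: "r * chain_var m v \<le> r * ((1 + C\<^sub>0) * form L v v)"
    using chain_var_upper[OF v] r by (intro mult_left_mono) auto
  show ?thesis
    unfolding chain_autocovariance[OF v v] u_def[symmetric] r_def[symmetric]
    using covariance_weighted_bound[OF chain_sq_integrable[OF u] chain_sq_integrable[OF v] r, of m m] 1 2
    by (simp add: mult_ac)
qed

text \<open>1 + C_0 bounds the autocovariances, 1 - \<open>rate\<close>^2 the variance from below
  for m >= 1, both relative to the target variance. The last factor is the geometric series started
  at lag 1.\<close>

definition iact_bound :: real where
  "iact_bound = 1 + 2 * ((1 + C\<^sub>0) / (1 - rate\<^sup>2) * (rate / (1 - rate)))"

text \<open>A functional \<open>F\<close> is \<open>\<langle>v, \<cdot>\<rangle>\<close> in the energy inner product for \<open>v = A\<^sup>-\<^sup>1 F\<close>.\<close>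

context
  fixes F :: "real vec"
  assumes F: "F \<in> carrier_vec (n L)"
begin

lemma functional_chain:
  assumes "\<omega> \<in> space P"
  shows "F \<bullet> chain m \<omega> = form L (minv (A L) *\<^sub>v F) (chain_err m \<omega>) + F \<bullet> (minv (A L) *\<^sub>v f)"
proof -
  let ?v = "minv (A L) *\<^sub>v F"
  have v: "?v \<in> carrier_vec (n L)" "A L *\<^sub>v ?v = F" using minv_mult_vec[OF A F] by auto
  have c: "chain m \<omega> \<in> carrier_vec (n L)" using chain_invariant[of m] assms by simp
  then have ce: "chain_err m \<omega> \<in> carrier_vec (n L)" using target_mean_carrier by (simp add: chain_err_def)
  have "form L ?v (chain_err m \<omega>) = F \<bullet> chain_err m \<omega>"
    using form_commute[OF v(1) ce] comm_scalar_prod[OF F ce] v(2) by simp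
  then show ?thesis
    using F c target_mean_carrier by (simp add: chain_err_def scalar_prod_minus_distrib[of _ "n L"])
qed

lemma functional_form: "form L (minv (A L) *\<^sub>v F) (minv (A L) *\<^sub>v F) = F \<bullet> (minv (A L) *\<^sub>v F)"
  using minv_mult_vec[OF A F] comm_scalar_prod[OF F minv_mult_vec(1)[OF A F]] by simp

lemma functional_expectation:
  "\<bar>expectation (\<lambda>\<omega>. F \<bullet> chain m \<omega>) - F \<bullet> (minv (A L) *\<^sub>v f)\<bar> \<le>
    (C\<^sub>0 + sqrt (f \<bullet> (minv (A L) *\<^sub>v f))) * rate ^ m * sqrt (F \<bullet> (minv (A L) *\<^sub>v F))"
proof -
  note v = minv_mult_vec(1)[OF A F]
  have "expectation (\<lambda>\<omega>. F \<bullet> chain m \<omega>) =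
      expectation (\<lambda>\<omega>. form L (minv (A L) *\<^sub>v F) (chain_err m \<omega>) + F \<bullet> (minv (A L) *\<^sub>v f))"
    by (rule Bochner_Integration.integral_cong) (auto simp: functional_chain)
  also have "\<dots> = expectation (\<lambda>\<omega>. form L (minv (A L) *\<^sub>v F) (chain_err m \<omega>)) + F \<bullet> (minv (A L) *\<^sub>v f)"
    using sq_integrable_integrable[OF chain_sq_integrable[OF v]] by (simp add: prob_space)
  finally show ?thesis using chain_mean_bound[OF v, of m] by (simp add: functional_form)
qed

lemma functional_covariance:
  "covariance P (\<lambda>\<omega>. F \<bullet> chain m \<omega>) (\<lambda>\<omega>. F \<bullet> chain m' \<omega>) =
    covariance P (\<lambda>\<omega>. form L (minv (A L) *\<^sub>v F) (chain_err m \<omega>))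
      (\<lambda>\<omega>. form L (minv (A L) *\<^sub>v F) (chain_err m' \<omega>))"
proof -
  note v = minv_mult_vec(1)[OF A F]
  let ?c = "F \<bullet> (minv (A L) *\<^sub>v f)"
  have "covariance P (\<lambda>\<omega>. F \<bullet> chain m \<omega>) (\<lambda>\<omega>. F \<bullet> chain m' \<omega>) =
      covariance P (\<lambda>\<omega>. form L (minv (A L) *\<^sub>v F) (chain_err m \<omega>) + ?c)
        (\<lambda>\<omega>. form L (minv (A L) *\<^sub>v F) (chain_err m' \<omega>) + ?c)"
    by (rule covariance_cong) (auto simp: functional_chain)
  then show ?thesis
    using covariance_add_const[OF chain_sq_integrable[OF v] chain_sq_integrable[OF v]] by simp
qed

lemma functional_variance:
  "\<bar>variance (\<lambda>\<omega>. F \<bullet> chain m \<omega>) - F \<bullet> (minv (A L) *\<^sub>v F)\<bar> \<le>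
    (1 + C\<^sub>0) * rate ^ (2 * m) * (F \<bullet> (minv (A L) *\<^sub>v F))"
proof -
  note v = minv_mult_vec(1)[OF A F]
  let ?q = "F \<bullet> (minv (A L) *\<^sub>v F)"
  have q: "0 \<le> ?q" by (rule minv_form_nonneg[OF A F])
  have "variance (\<lambda>\<omega>. F \<bullet> chain m \<omega>) = chain_var m (minv (A L) *\<^sub>v F)"
    using functional_covariance[of m m] by (simp add: covariance_def power2_eq_square)
  moreover have "0 \<le> rate ^ (2 * m) * ?q" "0 \<le> C\<^sub>0 * rate ^ (2 * m) * ?q"
    using q rate_pos C\<^sub>0_nonneg by auto
  ultimately show ?thesis
    using chain_var_bounds[OF v, of m] by (simp add: functional_form algebra_simps abs_le_iff)
qed

text \<open>For m >= 1 the lower variance bound is at least 1 - \<open>rate\<close>^2 times the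
  target variance; at m = 0 it would be 0. The target variance q cancels in the quotient and is
  positive because F is not zero.\<close>

lemma functional_autocorrelation:
  assumes "F \<noteq> 0\<^sub>v (n L)" "1 \<le> m"
  shows "\<bar>autocorrelation P (\<lambda>m \<omega>. F \<bullet> chain m \<omega>) m s\<bar> \<le> (1 + C\<^sub>0) / (1 - rate\<^sup>2) * rate ^ s"
proof -
  note v = minv_mult_vec(1)[OF A F]
  let ?v = "minv (A L) *\<^sub>v F"
  define q where "q = F \<bullet> ?v"
  have "?v \<noteq> 0\<^sub>v (n L)"
    using assms(1) minv_mult_vec(2)[OF A F] mult_mat_zero_vec[OF A(1)] by auto
  then have q: "0 < q" "form L ?v ?v = q"
    using sym_pos_def_form_pos[OF A v] functional_form by (auto simp: q_def)
  have r: "0 < 1 - rate\<^sup>2" using rate_pos rate_less_1 by (simp add: power_less_one_iff abs_square_less_1)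
  have "rate ^ (2 * m) \<le> rate ^ 2"
    using assms(2) rate_pos rate_le_1 by (intro power_decreasing) auto
  then have "rate ^ (2 * m) * q \<le> rate\<^sup>2 * q" using q by simp
  then have var: "(1 - rate\<^sup>2) * q \<le> chain_var m ?v"
    using chain_var_bounds(1)[OF v, of m] unfolding q(2) by (simp only: left_diff_distrib mult_1)
  have num: "\<bar>covariance P (\<lambda>\<omega>. form L ?v (chain_err (m + s) \<omega>)) (\<lambda>\<omega>. form L ?v (chain_err m \<omega>))\<bar>
      \<le> (1 + C\<^sub>0) * rate ^ s * q"
    using chain_autocovariance_bound[OF v, of m s] q by simp
  have "\<bar>autocorrelation P (\<lambda>m \<omega>. F \<bullet> chain m \<omega>) m s\<bar> =
      \<bar>covariance P (\<lambda>\<omega>. form L ?v (chain_err (m + s) \<omega>)) (\<lambda>\<omega>. form L ?v (chain_err m \<omega>))\<bar> / chain_var m ?v"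
    by (simp add: autocorrelation_def functional_covariance abs_divide
        abs_of_nonneg[OF covariance_self_nonneg])
  also have "\<dots> \<le> ((1 + C\<^sub>0) * rate ^ s * q) / ((1 - rate\<^sup>2) * q)"
    using num var q r rate_pos C\<^sub>0_nonneg by (intro frac_le) auto
  also have "\<dots> = (1 + C\<^sub>0) / (1 - rate\<^sup>2) * rate ^ s" using q by simp
  finally show ?thesis .
qed

lemma functional_iact:
  assumes "F \<noteq> 0\<^sub>v (n L)" "1 \<le> m"
  shows "summable (\<lambda>s. autocorrelation P (\<lambda>m \<omega>. F \<bullet> chain m \<omega>) m (Suc s))"
    and "\<bar>integrated_autocorrelation_time P (\<lambda>m \<omega>. F \<bullet> chain m \<omega>) m\<bar> \<le> iact_bound"
proof -
  let ?a = "\<lambda>s. autocorrelation P (\<lambda>m \<omega>. F \<bullet> chain m \<omega>) m (Suc s)"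
  let ?K = "(1 + C\<^sub>0) / (1 - rate\<^sup>2)"
  have le: "norm (?a s) \<le> ?K * (rate * rate ^ s)" for s
    using functional_autocorrelation[OF assms, of "Suc s"] by simp
  have "(\<lambda>s. rate ^ s) sums (1 / (1 - rate))"
    using rate_pos rate_less_1 by (intro geometric_sums) auto
  then have sums: "(\<lambda>s. ?K * (rate * rate ^ s)) sums (?K * (rate * (1 / (1 - rate))))"
    by (intro sums_mult)
  have abs: "summable (\<lambda>s. norm (?a s))"
    by (rule summable_comparison_test'[OF sums_summable[OF sums]]) (use le in auto)
  then show "summable ?a" by (rule summable_norm_cancel)
  have "\<bar>\<Sum>s. ?a s\<bar> \<le> (\<Sum>s. \<bar>?a s\<bar>)" using summable_norm[OF abs] by simp
  also have "\<dots> \<le> ?K * (rate * (1 / (1 - rate)))"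
    using suminf_le[OF le abs sums_summable[OF sums]] sums_unique[OF sums] by simp
  finally show "\<bar>integrated_autocorrelation_time P (\<lambda>m \<omega>. F \<bullet> chain m \<omega>) m\<bar> \<le> iact_bound"
    unfolding integrated_autocorrelation_time_def iact_bound_def by simp
qed

end

end

section \<open>Elliptic operators and the posterior operator\<close>

text \<open>The representer is the minimiser of J x = |x|^2 - 2 phi x, which is bounded below
  because phi is bounded.\<close>

lemma riesz_representation:
  fixes \<phi> :: "'h::{real_inner, complete_space} \<Rightarrow> real"
  assumes "bounded_linear \<phi>"
  shows "\<exists>z. \<forall>x. \<phi> x = inner x z"
proof -
  interpret bounded_linear \<phi> by fact
  define J where "J x = inner x x - 2 * \<phi> x" for x
  obtain K where K: "\<And>x. norm (\<phi> x) \<le> norm x * K" using bounded by blast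
  have low: "- K\<^sup>2 \<le> J x" for x
  proof -
    have "0 \<le> (norm x - K)\<^sup>2" by simp
    then have "2 * (norm x * K) \<le> (norm x)\<^sup>2 + K\<^sup>2" by (simp add: power2_diff algebra_simps)
    then show ?thesis using K[of x] by (simp add: J_def power2_norm_eq_inner)
  qed
  define m where "m = (INF x. J x)"
  have bdd: "bdd_below (range J)" using low by (intro bdd_belowI2[of _ "- K\<^sup>2"]) auto
  have m: "m \<le> J x" for x unfolding m_def by (intro cINF_lower bdd) simp
  have "\<exists>x. J x < m + inverse (real (Suc k))" for k
    using cINF_less_iff[OF _ bdd, of "m + inverse (real (Suc k))"] by (auto simp: m_def)
  then obtain s where s: "\<And>k. J (s k) < m + inverse (real (Suc k))" by metis
  \<comment> \<open>The parallelogram identity: when x and y nearly minimise J, their midpoint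
    cannot do much better, so x and y are close and a minimising sequence is Cauchy.\<close>
  have par: "inner (x - y) (x - y) = 2 * (J x + J y - 2 * J ((1/2) *\<^sub>R (x + y)))" for x y
    by (simp add: J_def inner_diff inner_add scale add inner_commute algebra_simps)
  have close: "(norm (s i - s j))\<^sup>2 \<le> 4 * inverse (real (Suc k))" if "k \<le> i" "k \<le> j" for i j k
  proof -
    have "inverse (real (Suc i)) \<le> inverse (real (Suc k))" "inverse (real (Suc j)) \<le> inverse (real (Suc k))"
      using that by (auto simp: le_imp_inverse_le)
    then have "J (s i) + J (s j) - 2 * J ((1/2) *\<^sub>R (s i + s j)) \<le> 2 * inverse (real (Suc k))"
      using s[of i] s[of j] m[of "(1/2) *\<^sub>R (s i + s j)"] by linarith
    from mult_left_mono[OF this, of 2] show ?thesis unfolding power2_norm_eq_inner par by simp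
  qed
  have "Cauchy s"
  proof (rule metric_CauchyI)
    fix e :: real assume e: "0 < e"
    then obtain k where k: "inverse (real (Suc k)) < e\<^sup>2 / 4"
      using reals_Archimedean[of "e\<^sup>2 / 4"] by auto
    have "dist (s i) (s j) < e" if "k \<le> i" "k \<le> j" for i j
    proof -
      have "(norm (s i - s j))\<^sup>2 < e\<^sup>2" using close[OF that] k by simp
      then show ?thesis using e by (simp add: dist_norm power_less_imp_less_base)
    qed
    then show "\<exists>M. \<forall>i\<ge>M. \<forall>j\<ge>M. dist (s i) (s j) < e" by blast
  qed
  then obtain z where z: "s \<longlonglongrightarrow> z" using Cauchy_convergent_iff convergent_def by blast
  have "(\<lambda>k. J (s k)) \<longlonglongrightarrow> J z"
    unfolding J_def by (intro tendsto_intros z tendsto)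
  moreover have "(\<lambda>k. m + inverse (real (Suc k))) \<longlonglongrightarrow> m + 0"
    by (intro tendsto_intros LIMSEQ_inverse_real_of_nat)
  ultimately have "J z \<le> m + 0"
    by (rule LIMSEQ_le) (use s in \<open>auto intro: less_imp_le\<close>)
  then have min: "J z \<le> J x" for x using m[of x] by simp
  have "\<phi> y = inner y z" for y
  proof (cases "y = 0")
    case True
    then show ?thesis by (simp add: zero)
  next
    case False
    define c where "c = inner y z - \<phi> y"
    have "J (z + t *\<^sub>R y) = J z + t\<^sup>2 * inner y y + 2 * t * c" for t
      by (simp add: J_def c_def inner_add scale add inner_commute algebra_simps power2_eq_square)
    then have "0 \<le> t\<^sup>2 * inner y y + 2 * t * c" for t
      using min[of "z + t *\<^sub>R y"] by (simp add: algebra_simps)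
    \<comment> \<open>The step length minimising the quadratic in t; it would lower J by c^2 /
      |y|^2.\<close>
    from this[of "- (c / inner y y)"] have "0 \<le> - (c\<^sup>2 / inner y y)"
      using False by (simp add: power2_eq_square field_simps)
    moreover have "0 < inner y y" using False by simp
    ultimately have "c\<^sup>2 \<le> 0" by (simp add: divide_le_0_iff)
    then have "c = 0" by simp
    then show ?thesis by (simp add: c_def)
  qed
  then show ?thesis by blast
qed

text \<open>\<open>adjoint\<close> is a choice, which the Riesz representation of x -> <B x, y>
  justifies for bounded B on a complete space.\<close>

lemma inner_adjoint:
  fixes B :: "'h::{real_inner, complete_space} \<Rightarrow> 'e::real_inner"
  assumes "bounded_linear B"
  shows "inner (B x) y = inner x (adjoint B y)"
proof -
  have "\<exists>z. \<forall>x. inner (B x) y = inner x z" for y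
    by (intro riesz_representation bounded_linear_compose[OF bounded_linear_inner_left assms])
  then have "\<exists>f. \<forall>x y. inner (B x) y = inner x (f y)" by metis
  from someI_ex[OF this] show ?thesis unfolding adjoint_def by blast
qed

lemma linear_adjoint:
  fixes B :: "'h::{real_inner, complete_space} \<Rightarrow> 'e::real_inner"
  assumes "bounded_linear B"
  shows "linear (adjoint B)"
proof (rule linearI)
  fix a b c
  have "inner x (adjoint B (a + b)) = inner x (adjoint B a + adjoint B b)"
    "inner x (adjoint B (c *\<^sub>R a)) = inner x (c *\<^sub>R adjoint B a)" for x
    by (simp_all add: inner_add_right flip: inner_adjoint[OF assms])
  then show "adjoint B (a + b) = adjoint B a + adjoint B b" "adjoint B (c *\<^sub>R a) = c *\<^sub>R adjoint B a"
    using vector_eq_ldot by blast+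
qed

section \<open>The operator, its inverse and its energy space\<close>

locale elliptic_operator =
  fixes D V :: "'h::{real_inner, complete_space} set" and \<A> S :: "'h \<Rightarrow> 'h"
  assumes self_adjoint: "self_adjoint_op D \<A>" and positive: "positive_definite_op D \<A>"
    and compact_inverse: "has_compact_inverse D \<A>" and square_root: "positive_sqrt_op D \<A> V S"
begin

definition T :: "'h \<Rightarrow> 'h" where "T = inv_into D \<A>"

lemma V_subspace: "subspace V" and S_add: "\<And>x y. x \<in> V \<Longrightarrow> y \<in> V \<Longrightarrow> S (x + y) = S x + S y"
  and S_scale: "\<And>c x. x \<in> V \<Longrightarrow> S (c *\<^sub>R x) = c *\<^sub>R S x"
  and S_sym: "\<And>x y. x \<in> V \<Longrightarrow> y \<in> V \<Longrightarrow> inner (S x) y = inner x (S y)"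
  using square_root by (auto simp: positive_sqrt_op_def self_adjoint_op_def densely_defined_op_def)

lemma D_subspace: "subspace D" and \<A>_add: "\<And>x y. x \<in> D \<Longrightarrow> y \<in> D \<Longrightarrow> \<A> (x + y) = \<A> x + \<A> y"
  and \<A>_scale: "\<And>c x. x \<in> D \<Longrightarrow> \<A> (c *\<^sub>R x) = c *\<^sub>R \<A> x"
  using self_adjoint by (auto simp: self_adjoint_op_def densely_defined_op_def)

lemma D_iff: "x \<in> D \<longleftrightarrow> x \<in> V \<and> S x \<in> V" and \<A>_eq: "x \<in> D \<Longrightarrow> \<A> x = S (S x)"
  using square_root by (auto simp: positive_sqrt_op_def)

lemma T_in_D: "T g \<in> D" and \<A>_T: "\<A> (T g) = g"
proof -
  have "g \<in> \<A> ` D" using compact_inverse by (auto simp: has_compact_inverse_def bij_betw_def)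
  then show "T g \<in> D" "\<A> (T g) = g" by (auto simp: T_def inv_into_into f_inv_into_f)
qed

lemma T_\<A>: "x \<in> D \<Longrightarrow> T (\<A> x) = x"
  using compact_inverse by (auto simp: T_def has_compact_inverse_def bij_betw_def)

lemma linear_T: "linear T"
proof (rule linearI)
  fix x y c
  show "T (x + y) = T x + T y"
    using T_\<A>[of "T x + T y"] \<A>_add[OF T_in_D T_in_D] \<A>_T subspace_add[OF D_subspace T_in_D T_in_D]
    by simp
  show "T (c *\<^sub>R x) = c *\<^sub>R T x"
    using T_\<A>[of "c *\<^sub>R T x"] \<A>_scale[OF T_in_D] \<A>_T subspace_scale[OF D_subspace T_in_D] by simp
qed

text \<open>S x = 0 lies in V, so x belongs to D and is mapped to 0 by the positive definite
  operator.\<close>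

lemma S_eq_0:
  assumes "x \<in> V" "S x = 0"
  shows "x = 0"
proof -
  have S0: "S 0 = 0" using S_scale[of x 0] assms(1) by simp
  have x: "x \<in> D" using assms subspace_0[OF V_subspace] by (simp add: D_iff)
  have "\<A> x = 0" using \<A>_eq[OF x] assms S0 by simp
  then show ?thesis using positive x by (fastforce simp: positive_definite_op_def)
qed

lemma energy_T:
  assumes "v \<in> V"
  shows "energy S (T g) v = inner g v"
  using S_sym[of "S (T g)" v] assms T_in_D[of g] \<A>_eq[OF T_in_D, of g] \<A>_T[of g]
  by (simp add: D_iff energy_def)

text \<open>A relatively compact image of the unit ball is bounded, so |T g| <= K |g|. For g = S v
  the vector S (T g) has the same image under S as v, hence equals v, and |v|^2 = <g, T g> <= K |S
  v|^2.\<close>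

lemma coercive:
  obtains c where "0 < c" "\<And>v. v \<in> V \<Longrightarrow> norm v \<le> c * energy_norm S v"
proof -
  have "bounded (T ` cball 0 1)"
    using compact_inverse bounded_subset[OF compact_imp_bounded closure_subset, of "T ` cball 0 1"]
    by (simp add: has_compact_inverse_def T_def)
  then obtain K where "0 < K" "\<forall>x\<in>T ` cball 0 1. norm x \<le> K"
    unfolding bounded_pos by blast
  then have K: "norm g \<le> 1 \<Longrightarrow> norm (T g) \<le> K" "0 < K" for g by auto
  have T_bound: "norm (T g) \<le> K * norm g" for g
  proof (cases "g = 0")
    case True
    then show ?thesis using linear_0[OF linear_T] by simp
  next
    case False
    have "norm (T ((1 / norm g) *\<^sub>R g)) \<le> K" using False by (intro K) simp
    then show ?thesis using False by (simp add: linear_scale[OF linear_T] field_simps)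
  qed
  have "norm v \<le> sqrt K * energy_norm S v" if v: "v \<in> V" for v
  proof -
    define g where "g = S v"
    define w where "w = S (T g)"
    have w: "w \<in> V" "S w = g" using T_in_D[of g] \<A>_eq[OF T_in_D, of g] \<A>_T[of g]
      by (auto simp: w_def D_iff)
    have "S (w + (-1) *\<^sub>R v) = 0"
      using S_add[OF w(1) subspace_scale[OF V_subspace v], of "-1"] S_scale[OF v, of "-1"] w(2)
      by (simp add: g_def)
    then have "w + (-1) *\<^sub>R v = 0"
      by (rule S_eq_0[rotated]) (intro subspace_add subspace_scale V_subspace w v)
    then have wv: "w = v" by simp
    have "(norm v)\<^sup>2 = inner (S (T g)) (S (T g))" using wv by (simp add: w_def power2_norm_eq_inner)
    also have "\<dots> = inner g (T g)" using energy_T[of "T g" g] T_in_D[of g] by (simp add: energy_def D_iff)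
    also have "\<dots> \<le> norm g * norm (T g)" by (rule norm_cauchy_schwarz)
    also have "\<dots> \<le> norm g * (K * norm g)" by (intro mult_left_mono T_bound) simp
    also have "\<dots> = (sqrt K * norm g)\<^sup>2" using K(2) by (simp add: power_mult_distrib power2_eq_square)
    finally have "norm v \<le> sqrt K * norm g"
      by (rule power2_le_imp_le) (use K(2) in simp)
    then show ?thesis by (simp add: energy_norm_def energy_def g_def norm_eq_sqrt_inner)
  qed
  then show thesis using K(2) by (intro that[of "sqrt K"]) auto
qed

lemma energy_add_left: "x \<in> V \<Longrightarrow> y \<in> V \<Longrightarrow> energy S (x + y) z = energy S x z + energy S y z"
  by (simp add: energy_def S_add inner_add_left)

lemma energy_scale_left: "x \<in> V \<Longrightarrow> energy S (c *\<^sub>R x) z = c * energy S x z"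
  by (simp add: energy_def S_scale)

lemma S_sum:
  "finite J \<Longrightarrow> (\<And>j. j \<in> J \<Longrightarrow> v j \<in> V) \<Longrightarrow> S (\<Sum>j\<in>J. c j *\<^sub>R v j) = (\<Sum>j\<in>J. c j *\<^sub>R S (v j))"
proof (induction J rule: finite_induct)
  case empty
  show ?case using S_scale[OF subspace_0[OF V_subspace], of 0] by simp
next
  case (insert j J)
  have "(\<Sum>j\<in>J. c j *\<^sub>R v j) \<in> V"
    using insert by (intro subspace_sum[OF V_subspace] subspace_scale[OF V_subspace]) auto
  then show ?case
    using insert S_add[OF subspace_scale[OF V_subspace, of "v j" "c j"]] S_scale[of "v j"] by simp
qed

end

text \<open>\<open>matrix_inv\<close> is a choice; a trivial kernel gives a left inverse, which for
  square matrices is two-sided.\<close>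

lemma pos_def_matrix_inv:
  fixes \<Gamma> :: "real ^ 'b ^ 'b::finite"
  assumes sym: "transpose \<Gamma> = \<Gamma>" and pos: "\<forall>x. x \<noteq> 0 \<longrightarrow> 0 < inner x (\<Gamma> *v x)"
  shows "\<Gamma> *v (matrix_inv \<Gamma> *v x) = x" "matrix_inv \<Gamma> *v (\<Gamma> *v x) = x"
    "inner (matrix_inv \<Gamma> *v x) y = inner x (matrix_inv \<Gamma> *v y)"
    "0 \<le> inner x (matrix_inv \<Gamma> *v x)"
proof -
  have "x = 0" if "\<Gamma> *v x = 0" for x using pos that by force
  then have "\<exists>G. G ** \<Gamma> = Finite_Cartesian_Product.mat 1" using matrix_left_invertible_ker by blast
  then have "\<exists>G. \<Gamma> ** G = Finite_Cartesian_Product.mat 1 \<and> G ** \<Gamma> = Finite_Cartesian_Product.mat 1" using matrix_left_right_inverse by blast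
  from someI_ex[OF this] have inv: "\<Gamma> ** matrix_inv \<Gamma> = Finite_Cartesian_Product.mat 1" "matrix_inv \<Gamma> ** \<Gamma> = Finite_Cartesian_Product.mat 1"
    unfolding matrix_inv_def by auto
  show 1: "\<Gamma> *v (matrix_inv \<Gamma> *v x) = x" for x by (simp add: matrix_vector_mul_assoc inv)
  show "matrix_inv \<Gamma> *v (\<Gamma> *v x) = x" by (simp add: matrix_vector_mul_assoc inv)
  have S: "inner (\<Gamma> *v a) b = inner a (\<Gamma> *v b)" for a b
    using dot_lmul_matrix[of a \<Gamma> b] vector_transpose_matrix[of a \<Gamma>] sym by metis
  show "inner (matrix_inv \<Gamma> *v x) y = inner x (matrix_inv \<Gamma> *v y)"
    using S[of "matrix_inv \<Gamma> *v x" "matrix_inv \<Gamma> *v y"] 1 by simp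
  show "0 \<le> inner x (matrix_inv \<Gamma> *v x)"
  proof (cases "x = 0")
    case False
    then have "matrix_inv \<Gamma> *v x \<noteq> 0" using 1[of x] by auto
    then have "0 < inner (matrix_inv \<Gamma> *v x) (\<Gamma> *v (matrix_inv \<Gamma> *v x))" using pos by blast
    then show ?thesis by (simp add: 1 inner_commute)
  qed simp
qed

section \<open>The posterior operator and its variational form\<close>

locale bayesian_problem = elliptic_operator D V \<A> S
  for D V :: "'h::{real_inner, complete_space} set" and \<A> S :: "'h \<Rightarrow> 'h" +
  fixes \<B> :: "'h \<Rightarrow> real ^ 'b::finite" and \<Gamma> :: "real ^ 'b ^ 'b"
  assumes bounded_\<B>: "bounded_linear \<B>"
    and \<Gamma>_sym: "transpose \<Gamma> = \<Gamma>" and \<Gamma>_pos: "\<forall>x. x \<noteq> 0 \<longrightarrow> 0 < inner x (\<Gamma> *v x)"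
begin

abbreviation G :: "real ^ 'b \<Rightarrow> real ^ 'b" where "G x \<equiv> matrix_inv \<Gamma> *v x"

lemmas G_props = pos_def_matrix_inv[OF \<Gamma>_sym \<Gamma>_pos]

definition post_form :: "'h \<Rightarrow> 'h \<Rightarrow> real" where
  "post_form u v = energy S u v + inner (\<B> u) (G (\<B> v))"

lemma \<B>_add: "\<B> (x + y) = \<B> x + \<B> y" and \<B>_scale: "\<B> (c *\<^sub>R x) = c *\<^sub>R \<B> x"
  and \<B>_sum: "\<B> (sum g J) = (\<Sum>j\<in>J. \<B> (g j))"
  using bounded_\<B> by (auto simp: bounded_linear.linear linear_add linear_scale linear_sum)

lemma post_form_commute: "post_form u v = post_form v u"
  using G_props(3)[of "\<B> u" "\<B> v"] by (simp add: post_form_def energy_def inner_commute)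

lemma post_form_add_left:
  "x \<in> V \<Longrightarrow> y \<in> V \<Longrightarrow> post_form (x + y) z = post_form x z + post_form y z"
  by (simp add: post_form_def energy_add_left \<B>_add inner_add_left)

lemma post_form_scale_left: "x \<in> V \<Longrightarrow> post_form (c *\<^sub>R x) z = c * post_form x z"
  by (simp add: post_form_def energy_scale_left \<B>_scale algebra_simps)

lemma post_form_diff_left:
  "x \<in> V \<Longrightarrow> y \<in> V \<Longrightarrow> post_form (x - y) z = post_form x z - post_form y z"
  using post_form_add_left[of x "(-1) *\<^sub>R y" z] post_form_scale_left[of y "-1" z]
    subspace_scale[OF V_subspace, of y "-1"] by simp

lemma energy_le_post_form: "(energy_norm S v)\<^sup>2 \<le> post_form v v"
  using G_props(4) by (simp add: post_form_def energy_norm_def energy_def)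

lemma post_form_nonneg: "0 \<le> post_form v v"
  using energy_le_post_form[of v] by (meson order.trans zero_le_power2)

lemma post_form_pos: "v \<in> V \<Longrightarrow> v \<noteq> 0 \<Longrightarrow> 0 < post_form v v"
  using S_eq_0[of v] energy_le_post_form[of v]
  by (smt (verit) energy_def energy_norm_def inner_gt_zero_iff real_sqrt_gt_zero zero_less_power)

text \<open>The observation term is bounded in the norm of H, and coercivity turns that norm into
  the energy norm.\<close>

lemma post_form_le_energy:
  obtains C where "0 < C" "\<And>v. v \<in> V \<Longrightarrow> post_form v v \<le> C * (energy_norm S v)\<^sup>2"
proof -
  obtain c where c: "0 < c" "\<And>v. v \<in> V \<Longrightarrow> norm v \<le> c * energy_norm S v" using coercive by blast
  have "bounded_linear (\<lambda>v. G (\<B> v))"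
    by (intro bounded_linear_compose[OF matrix_vector_mul_bounded_linear bounded_\<B>])
  then obtain K where K: "0 < K" "\<And>v. norm (G (\<B> v)) \<le> norm v * K"
    using bounded_linear.pos_bounded by blast
  obtain K' where K': "0 < K'" "\<And>v. norm (\<B> v) \<le> norm v * K'"
    using bounded_linear.pos_bounded[OF bounded_\<B>] by blast
  have "post_form v v \<le> (1 + K' * K * c\<^sup>2) * (energy_norm S v)\<^sup>2" if v: "v \<in> V" for v
  proof -
    have e: "0 \<le> energy_norm S v" by (simp add: energy_norm_def energy_def)
    have "inner (\<B> v) (G (\<B> v)) \<le> norm (\<B> v) * norm (G (\<B> v))" by (rule norm_cauchy_schwarz)
    also have "\<dots> \<le> (norm v * K') * (norm v * K)" using K K' by (intro mult_mono) auto
    also have "\<dots> = K' * K * (norm v)\<^sup>2" by (simp add: power2_eq_square algebra_simps)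
    also have "\<dots> \<le> K' * K * (c * energy_norm S v)\<^sup>2"
      using K K' c v by (intro mult_left_mono power_mono) auto
    finally show ?thesis
      by (simp add: post_form_def energy_norm_def energy_def algebra_simps power_mult_distrib)
  qed
  moreover have "0 < 1 + K' * K * c\<^sup>2" using K K' c by (intro add_pos_nonneg) auto
  ultimately show thesis by (rule that[rotated])
qed

text \<open>Solving \<open>(\<A> + \<B>\<^sup>* \<Gamma>\<^sup>-\<^sup>1 \<B>) u = g\<close> reduces to the finite-dimensional system
  \<open>(\<Gamma> + \<B> \<A>\<^sup>-\<^sup>1 \<B>\<^sup>*) w = \<B> \<A>\<^sup>-\<^sup>1 g\<close> for \<open>w = \<Gamma>\<^sup>-\<^sup>1 \<B> u\<close>.\<close>

lemma posterior_op_surj: "\<exists>u\<in>D. posterior_op \<A> \<B> \<Gamma> u = g"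
proof -
  let ?B' = "adjoint \<B>"
  note lB' = linear_adjoint[OF bounded_\<B>]
  define \<Phi> where "\<Phi> w = \<Gamma> *v w + \<B> (T (?B' w))" for w
  have lin: "linear \<Phi>"
    unfolding \<Phi>_def
    by (intro linearI)
      (simp_all add: matrix_vector_right_distrib matrix_vector_mult_scaleR linear_add[OF lB'] linear_scale[OF lB']
        linear_add[OF linear_T] linear_scale[OF linear_T] \<B>_add \<B>_scale scaleR_add_right)
  \<comment> \<open>The added term is nonnegative: its inner product with w is the energy of T
    applied to the adjoint image of w. So the form of the system dominates that of
    \<open>\<Gamma>\<close>.\<close>
  have "w = 0" if "\<Phi> w = 0" for w
  proof (rule ccontr)
    assume "w \<noteq> 0"
    have "inner w (\<B> (T (?B' w))) = inner (T (?B' w)) (?B' w)"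
      using inner_adjoint[OF bounded_\<B>] by (metis inner_commute)
    also have "\<dots> = energy S (T (?B' w)) (T (?B' w))"
      using energy_T[of "T (?B' w)" "?B' w"] T_in_D by (simp add: D_iff inner_commute)
    also have "\<dots> \<ge> 0" by (simp add: energy_def)
    finally have "0 < inner w (\<Phi> w)"
      using \<Gamma>_pos \<open>w \<noteq> 0\<close> by (simp add: \<Phi>_def inner_add_right add_pos_nonneg)
    then show False using that by simp
  qed
  then have "inj \<Phi>" using linear_injective_0[OF lin] by blast
  then obtain w where w: "\<Phi> w = \<B> (T g)"
    using linear_injective_imp_surjective[OF lin] by (metis surjD)
  \<comment> \<open>Chosen so that the operator maps u to g minus the adjoint image of w. It remains
    to see that \<open>G (\<B> u)\<close> is this w, and that is the finite-dimensional
    equation.\<close>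
  define u where "u = T (g - ?B' w)"
  have "\<B> u = \<B> (T g) - \<B> (T (?B' w))"
    by (simp add: u_def linear_diff[OF linear_T] linear_diff[OF bounded_linear.linear[OF bounded_\<B>]])
  also have "\<dots> = \<Gamma> *v w" using w by (simp add: \<Phi>_def algebra_simps)
  finally have "G (\<B> u) = w" using G_props(2) by simp
  then have "posterior_op \<A> \<B> \<Gamma> u = g"
    by (simp add: posterior_op_def u_def \<A>_T)
  then show ?thesis using T_in_D unfolding u_def by blast
qed

definition post_inv :: "'h \<Rightarrow> 'h" where "post_inv = posterior_op_inv D \<A> \<B> \<Gamma>"

lemma post_inv_in_D: "post_inv g \<in> D" and posterior_op_post_inv: "posterior_op \<A> \<B> \<Gamma> (post_inv g) = g"
proof -
  have "g \<in> posterior_op \<A> \<B> \<Gamma> ` D" using posterior_op_surj[of g] by blast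
  then show "post_inv g \<in> D" "posterior_op \<A> \<B> \<Gamma> (post_inv g) = g"
    unfolding post_inv_def posterior_op_inv_def by (auto intro: inv_into_into simp: f_inv_into_f)
qed

lemma post_inv_in_V: "post_inv g \<in> V"
  using post_inv_in_D by (simp add: D_iff)

text \<open>The right-hand side for which the prior operator has the same solution; through it the
  regularity assumed for the prior operator reaches posterior solutions.\<close>

definition residual :: "'h \<Rightarrow> 'h" where
  "residual g = g - adjoint \<B> (G (\<B> (post_inv g)))"

lemma post_inv_eq_T: "post_inv g = T (residual g)"
proof -
  have "\<A> (post_inv g) = residual g"
    using posterior_op_post_inv[of g] by (simp add: posterior_op_def residual_def algebra_simps)
  then show ?thesis using T_\<A>[OF post_inv_in_D, of g] by simp
qed

lemma post_inv_weak:
  assumes "v \<in> V"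
  shows "post_form (post_inv g) v = inner g v"
proof -
  have "energy S (post_inv g) v = inner (residual g) v"
    using energy_T[OF assms, of "residual g"] post_inv_eq_T[of g] by simp
  moreover have "inner (\<B> (post_inv g)) (G (\<B> v)) = inner v (adjoint \<B> (G (\<B> (post_inv g))))"
    using G_props(3)[of "\<B> (post_inv g)" "\<B> v"]
      inner_adjoint[OF bounded_\<B>, of v "G (\<B> (post_inv g))"] by (metis inner_commute)
  ultimately show ?thesis
    by (simp add: post_form_def residual_def inner_diff_left
        inner_commute[of v "adjoint \<B> (G (\<B> (post_inv g)))"])
qed

end

section \<open>Galerkin discretisation\<close>

locale bayesian_discretisation = bayesian_problem D V \<A> S \<B> \<Gamma>
  for D V :: "'h::{real_inner, complete_space} set" and \<A> S :: "'h \<Rightarrow> 'h"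
    and \<B> :: "'h \<Rightarrow> real ^ 'b::finite" and \<Gamma> :: "real ^ 'b ^ 'b" +
  fixes \<phi> :: "nat \<Rightarrow> nat \<Rightarrow> 'h" and n :: "nat \<Rightarrow> nat"
  assumes basis: "level_basis \<phi> n l"
    and nested: "level_space \<phi> n l \<subseteq> level_space \<phi> n (Suc l)"
    and conforming: "level_space \<phi> n l \<subseteq> V"
begin

abbreviation P :: "nat \<Rightarrow> real vec \<Rightarrow> 'h" where "P l \<equiv> coord_map \<phi> n l"
abbreviation Amat :: "nat \<Rightarrow> real mat" where "Amat \<equiv> posterior_mat S \<B> \<Gamma> \<phi> n"
abbreviation Fvec :: "'h \<Rightarrow> nat \<Rightarrow> real vec" where "Fvec g \<equiv> functional_vec g \<phi> n"

lemma basis_in_V: "j < n l \<Longrightarrow> \<phi> l j \<in> V"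
  using conforming[of l] span_base[of "\<phi> l j" "\<phi> l ` {..<n l}"] by (auto simp: level_space_def)

lemma coord_map_in_level_space: "P l x \<in> level_space \<phi> n l"
  unfolding coord_map_def level_space_def
  by (intro span_sum span_scale span_base) auto

lemma coord_map_in_V: "P l x \<in> V"
  using coord_map_in_level_space conforming by blast

lemma coord_map_eq_0:
  assumes x: "x \<in> carrier_vec (n l)" and "P l x = 0"
  shows "x = 0\<^sub>v (n l)"
proof -
  have inj: "inj_on (\<phi> l) {..<n l}" and ind: "independent (\<phi> l ` {..<n l})"
    using basis[of l] by (auto simp: level_basis_def)
  define u where "u b = x $ (the_inv_into {..<n l} (\<phi> l) b)" for b
  have u: "u (\<phi> l j) = x $ j" if "j < n l" for j
    using inj that by (simp add: u_def the_inv_into_f_f)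
  have "(\<Sum>b\<in>\<phi> l ` {..<n l}. u b *\<^sub>R b) = P l x"
    using inj u by (simp add: sum.reindex coord_map_def)
  then have "\<forall>b\<in>\<phi> l ` {..<n l}. u b = 0"
    using ind assms(2) dependent_finite[of "\<phi> l ` {..<n l}"] by auto
  then show ?thesis using u x by (intro eq_vecI) auto
qed

lemma coord_map_surj:
  assumes "v \<in> level_space \<phi> n l"
  shows "\<exists>x\<in>carrier_vec (n l). P l x = v"
proof -
  have inj: "inj_on (\<phi> l) {..<n l}" using basis[of l] by (auto simp: level_basis_def)
  obtain u where u: "v = (\<Sum>b\<in>\<phi> l ` {..<n l}. u b *\<^sub>R b)"
    using assms by (auto simp: level_space_def span_finite)
  have "P l (Matrix.vec (n l) (\<lambda>j. u (\<phi> l j))) = v"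
    using inj by (simp add: u sum.reindex coord_map_def)
  then show ?thesis by (intro bexI[of _ "Matrix.vec (n l) (\<lambda>j. u (\<phi> l j))"]) auto
qed

lemma coord_inv:
  assumes "v \<in> level_space \<phi> n l"
  shows "coord_inv \<phi> n l v \<in> carrier_vec (n l)" "P l (coord_inv \<phi> n l v) = v"
proof -
  have "v \<in> P l ` carrier_vec (n l)" using coord_map_surj[OF assms] by blast
  then show "coord_inv \<phi> n l v \<in> carrier_vec (n l)" "P l (coord_inv \<phi> n l v) = v"
    by (auto simp: coord_inv_def intro: inv_into_into f_inv_into_f)
qed

lemma coord_map_unit: "j < n l \<Longrightarrow> P l (unit_vec (n l) j) = \<phi> l j"
  by (simp add: coord_map_def if_distrib[of "\<lambda>c. c *\<^sub>R _"] sum.delta' cong: if_cong)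

lemma prolongation_carrier: "prolongation \<phi> n (Suc l) \<in> carrier_mat (n (Suc l)) (n l)"
  by (simp add: prolongation_def)

text \<open>By nestedness each coarse basis vector lies in the fine space, so column j of the matrix
  holds its true fine coordinates.\<close>

lemma coord_map_prolongation:
  assumes x: "x \<in> carrier_vec (n l)"
  shows "P (Suc l) (prolongation \<phi> n (Suc l) *\<^sub>v x) = P l x"
proof -
  define c where "c j = coord_inv \<phi> n (Suc l) (\<phi> l j)" for j
  have c: "P (Suc l) (c j) = \<phi> l j" if "j < n l" for j
    using that coord_inv(2)[of "\<phi> l j" "Suc l"] nested[of l] coord_map_in_level_space[of l "unit_vec (n l) j"]
    by (auto simp: c_def coord_map_unit)
  have "P (Suc l) (prolongation \<phi> n (Suc l) *\<^sub>v x) =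
      (\<Sum>i<n (Suc l). (\<Sum>j<n l. c j $ i * x $ j) *\<^sub>R \<phi> (Suc l) i)"
    unfolding coord_map_def using x
    by (intro sum.cong refl)
      (simp add: prolongation_def scalar_prod_def atLeast0LessThan coord_map_unit c_def)
  also have "\<dots> = (\<Sum>j<n l. x $ j *\<^sub>R (\<Sum>i<n (Suc l). c j $ i *\<^sub>R \<phi> (Suc l) i))"
    by (simp add: scaleR_sum_left scaleR_sum_right mult.commute) (rule sum.swap)
  also have "\<dots> = (\<Sum>j<n l. x $ j *\<^sub>R \<phi> l j)"
    using c by (intro sum.cong refl) (simp add: coord_map_def)
  finally show ?thesis by (simp add: coord_map_def)
qed

lemma Amat_carrier: "Amat l \<in> carrier_mat (n l) (n l)"
  by (simp add: posterior_mat_def stiffness_mat_def)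

lemma S_coord_map: "S (P l x) = (\<Sum>j<n l. x $ j *\<^sub>R S (\<phi> l j))"
  unfolding coord_map_def by (rule S_sum) (auto intro: basis_in_V)

text \<open>The bridge between matrices and operators: positive definiteness, the Galerkin relation
  and the moment formulas are all read off from \<open>post_form\<close>.\<close>

lemma Amat_form:
  assumes "x \<in> carrier_vec (n l)" "y \<in> carrier_vec (n l)"
  shows "x \<bullet> (Amat l *\<^sub>v y) = post_form (P l x) (P l y)"
proof -
  have "x \<bullet> (Amat l *\<^sub>v y) = (\<Sum>j<n l. \<Sum>k<n l. x $ j * (y $ k * post_form (\<phi> l j) (\<phi> l k)))"
    using assms
    by (simp add: scalar_prod_def posterior_mat_def stiffness_mat_def obs_row_def post_form_def
        atLeast0LessThan sum_distrib_left ac_simps)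
  also have "\<dots> = (\<Sum>j<n l. \<Sum>k<n l. x $ j * (y $ k * energy S (\<phi> l j) (\<phi> l k))) +
      (\<Sum>j<n l. \<Sum>k<n l. x $ j * (y $ k * inner (\<B> (\<phi> l j)) (G (\<B> (\<phi> l k)))))"
    by (simp add: post_form_def distrib_left sum.distrib)
  also have "(\<Sum>j<n l. \<Sum>k<n l. x $ j * (y $ k * energy S (\<phi> l j) (\<phi> l k))) = energy S (P l x) (P l y)"
    unfolding energy_def S_coord_map inner_sum_left by (simp add: inner_sum_right sum_distrib_left mult.left_commute)
  also have "(\<Sum>j<n l. \<Sum>k<n l. x $ j * (y $ k * inner (\<B> (\<phi> l j)) (G (\<B> (\<phi> l k))))) =
      inner (\<B> (P l x)) (G (\<B> (P l y)))"
  proof -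
    have "\<B> (P l z) = (\<Sum>j<n l. z $ j *\<^sub>R \<B> (\<phi> l j))" for z
      by (simp add: coord_map_def \<B>_sum \<B>_scale)
    then show ?thesis
      by (simp only: linear_sum[OF matrix_vector_mul_linear] matrix_vector_mult_scaleR inner_sum_left)
        (simp add: inner_sum_right sum_distrib_left mult.left_commute)
  qed
  finally show ?thesis by (simp add: post_form_def)
qed

lemma Amat_sym_pos_def: "sym_pos_def (Amat l)"
  unfolding sym_pos_def_def
proof (intro conjI ballI impI)
  have "Amat l $$ (i, j) = Amat l $$ (j, i)" if ij: "i < n l" "j < n l" for i j
    using that Amat_form[of "unit_vec (n l) i" l "unit_vec (n l) j"]
      Amat_form[of "unit_vec (n l) j" l "unit_vec (n l) i"] post_form_commute
      unit_form[OF Amat_carrier ij] unit_form[OF Amat_carrier ij(2,1)] by simp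
  then show "(Amat l)\<^sup>T = Amat l" using Amat_carrier[of l] by (intro eq_matI) auto
  fix x :: "real vec"
  assume "x \<in> carrier_vec (dim_col (Amat l))" "x \<noteq> 0\<^sub>v (dim_col (Amat l))"
  then have x: "x \<in> carrier_vec (n l)" "x \<noteq> 0\<^sub>v (n l)" using Amat_carrier[of l] by auto
  then have "P l x \<noteq> 0" using coord_map_eq_0 by blast
  then show "0 < x \<bullet> (Amat l *\<^sub>v x)"
    using Amat_form[OF x(1) x(1)] post_form_pos[OF coord_map_in_V] by simp
qed

lemma Amat_galerkin:
  assumes "x \<in> carrier_vec (n l)" "y \<in> carrier_vec (n l)"
  shows "(prolongation \<phi> n (Suc l) *\<^sub>v x) \<bullet> (Amat (Suc l) *\<^sub>v (prolongation \<phi> n (Suc l) *\<^sub>v y)) =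
    x \<bullet> (Amat l *\<^sub>v y)"
  using assms prolongation_carrier[of l]
  by (simp add: Amat_form coord_map_prolongation)

lemma Fvec_carrier: "Fvec g l \<in> carrier_vec (n l)"
  by (simp add: functional_vec_def)

lemma Fvec_form: "x \<in> carrier_vec (n l) \<Longrightarrow> Fvec g l \<bullet> x = inner (P l x) g"
  by (simp add: functional_vec_def coord_map_def scalar_prod_def atLeast0LessThan inner_sum_left mult.commute)

text \<open>The right-hand side is itself the vector of a functional on H, so the target mean and
  the target variance are handled by the same Galerkin statements.\<close>

lemma posterior_rhs_eq: "posterior_rhs \<B> \<Gamma> y \<phi> n l = Fvec (adjoint \<B> (G y)) l"
  by (intro eq_vecI) (simp_all add: posterior_rhs_def functional_vec_def obs_row_def inner_adjoint[OF bounded_\<B>])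

section \<open>Stability and convergence of Galerkin solutions\<close>

definition galerkin_solution :: "nat \<Rightarrow> 'h \<Rightarrow> 'h" where
  "galerkin_solution l g = P l (minv (Amat l) *\<^sub>v Fvec g l)"

lemma solve_carrier: "minv (Amat l) *\<^sub>v Fvec g l \<in> carrier_vec (n l)"
  by (rule minv_mult_vec(1)[OF Amat_carrier Amat_sym_pos_def Fvec_carrier])

lemma Fvec_solve: "Fvec \<chi> l \<bullet> (minv (Amat l) *\<^sub>v Fvec g l) = inner (galerkin_solution l g) \<chi>"
  unfolding galerkin_solution_def by (rule Fvec_form[OF solve_carrier])

lemma galerkin_solution_weak:
  assumes "w \<in> level_space \<phi> n l"
  shows "post_form (galerkin_solution l g) w = inner g w"
proof -
  obtain z where z: "z \<in> carrier_vec (n l)" "w = P l z" using coord_map_surj[OF assms] by blast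
  have "post_form w (galerkin_solution l g) = z \<bullet> (Amat l *\<^sub>v (minv (Amat l) *\<^sub>v Fvec g l))"
    unfolding galerkin_solution_def z(2) by (rule Amat_form[OF z(1) solve_carrier, symmetric])
  also have "\<dots> = Fvec g l \<bullet> z"
    using minv_mult_vec(2)[OF Amat_carrier Amat_sym_pos_def Fvec_carrier] comm_scalar_prod[OF z(1) Fvec_carrier]
    by simp
  also have "\<dots> = inner g w" using Fvec_form[OF z(1)] z(2) by (simp add: inner_commute)
  finally show ?thesis by (simp add: post_form_commute)
qed

lemma galerkin_solution_in: "galerkin_solution l g \<in> level_space \<phi> n l"
  unfolding galerkin_solution_def by (rule coord_map_in_level_space)

text \<open>Testing the Galerkin equation with its solution u gives q = <g, u> <= |g| c sqrt q for
  its posterior energy q. The constant comes from coercivity and so does not depend on the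
  level.\<close>

lemma solve_bound:
  obtains c where "0 < c" "\<And>l g. Fvec g l \<bullet> (minv (Amat l) *\<^sub>v Fvec g l) \<le> (c * norm g)\<^sup>2"
proof -
  obtain c where c: "0 < c" "\<And>v. v \<in> V \<Longrightarrow> norm v \<le> c * energy_norm S v" using coercive by blast
  have "Fvec g l \<bullet> (minv (Amat l) *\<^sub>v Fvec g l) \<le> (c * norm g)\<^sup>2" for l g
  proof -
    let ?u = "galerkin_solution l g"
    have uV: "?u \<in> V" using galerkin_solution_in conforming by blast
    define q where "q = post_form ?u ?u"
    have q: "0 \<le> q" "energy_norm S ?u \<le> sqrt q"
      using post_form_nonneg energy_le_post_form[of ?u] by (auto simp: q_def intro: real_le_rsqrt)
    have "q = inner g ?u" unfolding q_def by (rule galerkin_solution_weak[OF galerkin_solution_in])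
    also have "\<dots> \<le> norm g * norm ?u" by (rule norm_cauchy_schwarz)
    also have "\<dots> \<le> norm g * (c * sqrt q)"
      using c(1) q(2) order.trans[OF c(2)[OF uV] mult_left_mono[OF q(2), of c]]
      by (intro mult_left_mono) auto
    finally have "sqrt q * sqrt q \<le> (c * norm g) * sqrt q" using q(1) by (simp add: mult_ac)
    then have "sqrt q \<le> c * norm g"
      using q(1) c(1) mult_right_le_imp_le[of "sqrt q" "sqrt q" "c * norm g"] by (cases "q = 0") auto
    then have "q \<le> (c * norm g)\<^sup>2" using q(1) by (simp add: sqrt_le_D)
    moreover have "Fvec g l \<bullet> (minv (Amat l) *\<^sub>v Fvec g l) = q"
      unfolding Fvec_solve q_def using galerkin_solution_weak[OF galerkin_solution_in] by (simp add: inner_commute)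
    ultimately show ?thesis by simp
  qed
  then show thesis using c(1) that by blast
qed

text \<open>Galerkin orthogonality makes the discrete solution the best approximation in the
  posterior form (Cea). Equivalence with the energy form costs sqrt C, and passing to the norm of H
  costs c.\<close>

lemma galerkin_quasi_optimal:
  obtains C where "0 < C" "\<And>l g w. w \<in> level_space \<phi> n l \<Longrightarrow>
    norm (post_inv g - galerkin_solution l g) \<le> C * energy_norm S (post_inv g - w)"
proof -
  obtain c where c: "0 < c" "\<And>v. v \<in> V \<Longrightarrow> norm v \<le> c * energy_norm S v" using coercive by blast
  obtain C where C: "0 < C" "\<And>v. v \<in> V \<Longrightarrow> post_form v v \<le> C * (energy_norm S v)\<^sup>2"
    using post_form_le_energy by blast
  have "norm (post_inv g - galerkin_solution l g) \<le> (c * sqrt C) * energy_norm S (post_inv g - w)"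
    if w: "w \<in> level_space \<phi> n l" for l g w
  proof -
    let ?u = "post_inv g" and ?v = "galerkin_solution l g"
    have V: "?u \<in> V" "?v \<in> V" "w \<in> V"
      using post_inv_in_V galerkin_solution_in conforming w by blast+
    note Vd = subspace_diff[OF V_subspace]
    have ls: "?v - w \<in> level_space \<phi> n l"
      using galerkin_solution_in w unfolding level_space_def by (rule span_diff)
    define e where "e = ?u - ?v"
    define d where "d = ?v - w"
    have ed: "e \<in> V" "d \<in> V" "?u - w \<in> V" "?u - w = e + d" using V Vd by (auto simp: e_def d_def)
    have "post_form e d = 0"
      using ls post_inv_weak[OF ed(2), of g] galerkin_solution_weak[of d l g] V
      by (simp add: e_def d_def post_form_diff_left)
    then have orth: "post_form d e = 0" by (simp add: post_form_commute)
    have "post_form (e + d) (e + d) = post_form e (e + d) + post_form d (e + d)"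
      using ed by (simp add: post_form_add_left)
    also have "\<dots> = post_form e e + post_form d d"
      using post_form_add_left[OF ed(1,2), of e] post_form_add_left[OF ed(1,2), of d] orth
        \<open>post_form e d = 0\<close> post_form_commute[of e "e + d"] post_form_commute[of d "e + d"] by simp
    finally have "post_form e e \<le> post_form (?u - w) (?u - w)"
      using post_form_nonneg[of d] ed(4) by simp
    then have "(energy_norm S e)\<^sup>2 \<le> C * (energy_norm S (?u - w))\<^sup>2"
      using energy_le_post_form[of e] C(2)[OF ed(3)] by linarith
    then have "energy_norm S e \<le> sqrt (C * (energy_norm S (?u - w))\<^sup>2)" by (rule real_le_rsqrt)
    also have "\<dots> = sqrt C * energy_norm S (?u - w)"
      by (simp add: real_sqrt_mult energy_norm_def energy_def)
    finally have "c * energy_norm S e \<le> c * (sqrt C * energy_norm S (?u - w))"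
      using c(1) by simp
    then show ?thesis using c(2)[OF ed(1)] by (simp add: e_def mult.assoc)
  qed
  then show thesis using c(1) C(1) that[of "c * sqrt C"] by simp
qed

text \<open>The posterior solution solves the prior problem with right-hand side
  \<open>residual g\<close>, hence lies in W. For this fixed element N is a constant, and
  quasi-optimality with the approximation rate gives convergence in H.\<close>

lemma galerkin_convergence:
  assumes reg: "\<And>g u. u \<in> V \<Longrightarrow> (\<forall>v\<in>V. energy S u v = inner g v) \<Longrightarrow> u \<in> W"
    and approx: "\<And>l w. w \<in> W \<Longrightarrow>
      (INF v\<in>level_space \<phi> n l. energy_norm S (w - v)) \<le> sqrt (\<Psi> l) * N w"
    and \<Psi>: "\<Psi> \<longlonglongrightarrow> 0"
  shows "(\<lambda>l. inner (galerkin_solution l g) \<chi>) \<longlonglongrightarrow> inner (post_inv g) \<chi>"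
proof -
  let ?u = "post_inv g"
  have uW: "?u \<in> W"
    using energy_T[of _ "residual g"] post_inv_in_V by (intro reg[of _ "residual g"]) (auto simp flip: post_inv_eq_T)
  obtain C where C: "0 < C" "\<And>l g w. w \<in> level_space \<phi> n l \<Longrightarrow>
    norm (post_inv g - galerkin_solution l g) \<le> C * energy_norm S (post_inv g - w)"
    using galerkin_quasi_optimal by blast
  have bound: "norm (?u - galerkin_solution l g) \<le> C * (sqrt (\<Psi> l) * N ?u)" for l
  proof -
    have "norm (?u - galerkin_solution l g) / C \<le> (INF v\<in>level_space \<phi> n l. energy_norm S (?u - v))"
      using C galerkin_solution_in[of l g] by (intro cINF_greatest) (auto simp: field_simps)
    also have "\<dots> \<le> sqrt (\<Psi> l) * N ?u" by (rule approx[OF uW])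
    finally show ?thesis using C(1) by (simp add: field_simps)
  qed
  have "(\<lambda>l. C * (sqrt (\<Psi> l) * N ?u)) \<longlonglongrightarrow> C * (sqrt 0 * N ?u)"
    by (intro tendsto_intros \<Psi>)
  then have "(\<lambda>l. C * (sqrt (\<Psi> l) * N ?u)) \<longlonglongrightarrow> 0" by simp
  then have "(\<lambda>l. ?u - galerkin_solution l g) \<longlonglongrightarrow> 0"
    by (rule Lim_null_comparison[rotated]) (use bound in auto)
  then have "(\<lambda>l. ?u - (?u - galerkin_solution l g)) \<longlonglongrightarrow> ?u - 0"
    by (intro tendsto_intros)
  then have "(\<lambda>l. galerkin_solution l g) \<longlonglongrightarrow> ?u" by simp
  then show ?thesis by (intro tendsto_intros)
qed

end

section \<open>Cost of an update\<close>

lemma nnz_le: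
  assumes "row_nnz_le A s"
  shows "nnz A \<le> dim_row A * s"
proof -
  have "{(i, j). i < dim_row A \<and> j < dim_col A \<and> A $$ (i, j) \<noteq> 0} =
      Sigma {..<dim_row A} (\<lambda>i. {j. j < dim_col A \<and> A $$ (i, j) \<noteq> 0})" by auto
  then have "nnz A = (\<Sum>i<dim_row A. card {j. j < dim_col A \<and> A $$ (i, j) \<noteq> 0})"
    by (simp add: nnz_def card_SigmaI)
  also have "\<dots> \<le> (\<Sum>i<dim_row A. s)"
    using assms by (intro sum_mono) (simp add: row_nnz_le_def)
  finally show ?thesis by simp
qed

text \<open>The additive constants of the levels sum up to \<open>a L\<close>, which is also \<open>O(n L)\<close>: once positive,
  the integers \<open>n l\<close> increase strictly. The first levels may have dimension \<open>0\<close>.\<close>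

lemma mgmc_cost_linear:
  fixes n :: "nat \<Rightarrow> nat" and \<rho> a b :: real
  assumes \<rho>: "\<rho> < 1" and grow: "\<And>l. real (n l) \<le> \<rho> * real (n (Suc l))" and ab: "0 \<le> a" "0 \<le> b"
    and level: "\<And>l. real (\<nu>1 * smoother_ops K (Suc l) + residual_ops K (Suc l) + restriction_ops K (Suc l) +
      prolongation_ops K (Suc l) + \<nu>2 * smoother_ops K (Suc l)) \<le> a + b * real (n (Suc l))"
  shows "\<exists>C. \<forall>L. 0 < n L \<longrightarrow> real (mgmc_cost K \<nu>1 \<nu>2 L) \<le> C * real (n L)"
proof (cases "\<exists>l. 0 < n l")
  case True
  define l0 where "l0 = (LEAST l. 0 < n l)"
  have l0: "0 < n l0" unfolding l0_def using True by (rule LeastI_ex)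
  have incr: "n l < n (Suc l)" if "0 < n l" for l
  proof -
    have pos: "0 < n (Suc l)"
    proof (rule ccontr)
      assume "\<not> 0 < n (Suc l)"
      then show False using grow[of l] that by simp
    qed
    have "real (n l) \<le> \<rho> * real (n (Suc l))" by (rule grow)
    also have "\<dots> < 1 * real (n (Suc l))" using \<rho> pos by (intro mult_strict_right_mono) auto
    finally show ?thesis by simp
  qed
  \<comment> \<open>From the first nonzero dimension on, integer dimensions grow by at least 1 per
    level.\<close>
  have large: "0 < n (l0 + k) \<and> k \<le> n (l0 + k)" for k
  proof (induction k)
    case (Suc k)
    then show ?case using incr[of "l0 + k"] by simp
  qed (use l0 in simp)
  let ?c = "real (coarse_sampler_ops K)"
  have sum: "real (mgmc_cost K \<nu>1 \<nu>2 L) \<le> ?c + a * real L + b * (real (n L) / (1 - \<rho>))" for L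
  proof (induction L)
    case 0
    show ?case using ab \<rho> by simp
  next
    case (Suc L)
    have "real (mgmc_cost K \<nu>1 \<nu>2 (Suc L)) \<le>
        (?c + a * real L + b * (real (n L) / (1 - \<rho>))) + (a + b * real (n (Suc L)))"
      using Suc level[of L] by simp
    \<comment> \<open>The geometric sum in closed form: n L <= \<open>\<rho>\<close> n (L + 1) and
      \<open>\<rho>\<close> / (1 - \<open>\<rho>\<close>) + 1 = 1 / (1 -
      \<open>\<rho>\<close>).\<close>
    moreover have "real (n L) / (1 - \<rho>) + real (n (Suc L)) \<le> real (n (Suc L)) / (1 - \<rho>)"
    proof -
      have "real (n L) / (1 - \<rho>) \<le> \<rho> * real (n (Suc L)) / (1 - \<rho>)"
        using grow[of L] \<rho> by (intro divide_right_mono) auto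
      also have "\<dots> = real (n (Suc L)) / (1 - \<rho>) - real (n (Suc L))"
        using \<rho> by (simp add: field_simps)
      finally show ?thesis by simp
    qed
    from mult_left_mono[OF this ab(2)]
    have "b * (real (n L) / (1 - \<rho>)) + b * real (n (Suc L)) \<le> b * (real (n (Suc L)) / (1 - \<rho>))"
      by (simp add: distrib_left)
    ultimately show ?case by (simp add: distrib_left)
  qed
  have "real (mgmc_cost K \<nu>1 \<nu>2 L) \<le> (?c + a * (1 + real l0) + b / (1 - \<rho>)) * real (n L)" if "0 < n L" for L
  proof -
    have nL: "1 \<le> real (n L)" using that by simp
    have "L \<le> n L + l0"
      using large[of "L - l0"] by (cases "l0 \<le> L") auto
    then have "real L \<le> real (n L) + real l0" by linarith
    also have "\<dots> \<le> (1 + real l0) * real (n L)" using nL mult_left_mono[OF nL, of "real l0"] by (simp add: algebra_simps)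
    finally have "a * real L \<le> a * ((1 + real l0) * real (n L))" using ab(1) by (rule mult_left_mono)
    moreover have "?c \<le> ?c * real (n L)" using mult_left_mono[OF nL, of ?c] by simp
    ultimately show ?thesis using sum[of L] by (simp add: algebra_simps)
  qed
  then show ?thesis by blast
qed blast

lemma mgmc_cost_model_linear:
  fixes \<Gamma> :: "real ^ 'b ^ 'b::finite" and n :: "nat \<Rightarrow> nat"
  assumes cm: "cost_model K A I n \<Gamma> s c\<^sub>0 c\<^sub>1 c\<^sub>2"
    and \<rho>: "\<rho> < 1" and grow: "\<forall>l\<ge>1. real (n (l - 1)) \<le> \<rho> * real (n l)"
    and dims: "\<And>l. dim_row (A l) = n l" "\<And>l. dim_row (I (Suc l)) = n (Suc l)"
  shows "\<exists>C. \<forall>L. 0 < n L \<longrightarrow> real (mgmc_cost K \<nu>1 \<nu>2 L) \<le> C * real (n L)"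
proof -
  define \<beta> where "\<beta> = real CARD('b)"
  define p where "p = (if \<forall>i j. i \<noteq> j \<longrightarrow> vec_nth (vec_nth \<Gamma> i) j = 0 then 1 else 2 :: nat)"
  have \<beta>: "0 \<le> \<beta>" by (simp add: \<beta>_def)
  note cm' = cm[unfolded cost_model_def Let_def, folded \<beta>_def p_def]
  \<comment> \<open>Absolute values, as the constants of the cost model carry no sign
    condition.\<close>
  define r where "r = \<bar>c\<^sub>0\<bar> * (real s + 1 + \<beta>)"
  define a where "a = \<bar>c\<^sub>1\<bar> * \<beta> ^ p"
  define b where "b = \<bar>c\<^sub>2\<bar> * (1 + \<beta>)"
  have nn: "0 \<le> r" "0 \<le> a" "0 \<le> b" using \<beta> by (auto simp: r_def a_def b_def)
  have sparse: "c\<^sub>0 * (real (nnz X) + (1 + \<beta>) * real k) \<le> r * real k"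
    if "row_nnz_le X s" "dim_row X = k" for X k
  proof -
    have "real (nnz X) \<le> real s * real k"
      using nnz_le[OF that(1)] that(2) by (metis mult.commute of_nat_le_iff of_nat_mult)
    then have "\<bar>c\<^sub>0\<bar> * (real (nnz X) + (1 + \<beta>) * real k) \<le> \<bar>c\<^sub>0\<bar> * (real s * real k + (1 + \<beta>) * real k)"
      by (intro mult_left_mono) auto
    moreover have "c\<^sub>0 * (real (nnz X) + (1 + \<beta>) * real k) \<le> \<bar>c\<^sub>0\<bar> * (real (nnz X) + (1 + \<beta>) * real k)"
      using \<beta> by (intro mult_right_mono) auto
    ultimately show ?thesis by (simp add: r_def algebra_simps)
  qed
  have rows: "row_nnz_le (A l) s" "row_nnz_le (I (Suc l)) s" for l
    using cm' by (blast, simp)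
  have res: "real (residual_ops K (Suc l)) \<le> r * real (n (Suc l))" for l
    by (rule order.trans[OF _ sparse[OF rows(1) dims(1)]]) (use cm' in simp)
  have rst: "real (restriction_ops K (Suc l)) \<le> r * real (n (Suc l))" for l
    by (rule order.trans[OF _ sparse[OF rows(2) dims(2)]]) (use cm' in simp)
  have prl: "real (prolongation_ops K (Suc l)) \<le> r * real (n (Suc l))" for l
    by (rule order.trans[OF _ sparse[OF rows(2) dims(2)]]) (use cm' in simp)
  have smo: "real (smoother_ops K (Suc l)) \<le> a + b * real (n (Suc l))" for l
  proof -
    have "real (smoother_ops K (Suc l)) \<le> c\<^sub>1 * \<beta> ^ p + c\<^sub>2 * (1 + \<beta>) * real (n (Suc l))"
      using cm' by simp
    also have "\<dots> \<le> a + b * real (n (Suc l))"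
      unfolding a_def b_def using \<beta> by (intro add_mono mult_right_mono) auto
    finally show ?thesis .
  qed
  show ?thesis
  proof (rule mgmc_cost_linear[OF \<rho>])
    show "real (n l) \<le> \<rho> * real (n (Suc l))" for l using grow[rule_format, of "Suc l"] by simp
    show "0 \<le> (real \<nu>1 + real \<nu>2) * a" "0 \<le> (real \<nu>1 + real \<nu>2) * b + 3 * r" using nn by auto
    show "real (\<nu>1 * smoother_ops K (Suc l) + residual_ops K (Suc l) + restriction_ops K (Suc l) +
        prolongation_ops K (Suc l) + \<nu>2 * smoother_ops K (Suc l)) \<le>
        (real \<nu>1 + real \<nu>2) * a + ((real \<nu>1 + real \<nu>2) * b + 3 * r) * real (n (Suc l))" for l
      using mult_left_mono[OF smo[of l], of "real \<nu>1"] mult_left_mono[OF smo[of l], of "real \<nu>2"]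
        res[of l] rst[of l] prl[of l]
      by (simp add: algebra_simps)
  qed
qed

section \<open>Application to the Bayesian problem\<close>

lemma multivariate_normal_centered:
  assumes "prob_space M" "multivariate_normal M n X (0\<^sub>v n) C"
  shows "centered M n X C"
  using multivariate_normal_moments[OF assms] multivariate_normal_carrier[OF assms(2)]
  by (simp add: centered_def)

theorem corollary4p23:
  fixes D V :: "'h::{real_inner, complete_space, second_countable_topology} set"
    and \<A> S :: "'h \<Rightarrow> 'h"
    and \<phi> :: "nat \<Rightarrow> nat \<Rightarrow> 'h" and n :: "nat \<Rightarrow> nat"
    and \<B> :: "'h \<Rightarrow> real ^ 'b::finite" and \<Gamma> :: "real ^ 'b ^ 'b" and y :: "real ^ 'b"
    and \<chi> :: 'h
    and M :: "nat \<Rightarrow> real mat" and \<nu> :: nat and C\<^sub>A C\<^sub>0 :: real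
    and \<Omega> :: "nat \<Rightarrow> 'w measure" and R :: "nat \<Rightarrow> draw \<Rightarrow> 'w \<Rightarrow> real vec"
    and A I :: "nat \<Rightarrow> real mat" and f F :: "nat \<Rightarrow> real vec"
    and \<theta> :: "nat \<Rightarrow> nat \<Rightarrow> 'w \<Rightarrow> real vec" and X :: "nat \<Rightarrow> nat \<Rightarrow> 'w \<Rightarrow> real"
  defines "A \<equiv> posterior_mat S \<B> \<Gamma> \<phi> n"
    and "I \<equiv> prolongation \<phi> n"
    and "f \<equiv> posterior_rhs \<B> \<Gamma> y \<phi> n"
    and "F \<equiv> functional_vec \<chi> \<phi> n"
    and "\<theta> \<equiv> \<lambda>L. mgmc_chain A M I (\<nu> div 2) (\<nu> div 2) L (f L) (R L)"
    and "X \<equiv> \<lambda>L m \<omega>. F L \<bullet> \<theta> L m \<omega>"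
  assumes "self_adjoint_op D \<A>" and "positive_definite_op D \<A>" and "has_compact_inverse D \<A>"
    and "positive_sqrt_op D \<A> V S"
    and "\<forall>l. level_basis \<phi> n l"
    and "\<forall>l. level_space \<phi> n l \<subseteq> level_space \<phi> n (Suc l)" and "\<forall>l. level_space \<phi> n l \<subseteq> V"
    and "bounded_linear \<B>"
    and "transpose \<Gamma> = \<Gamma>" and "\<forall>x. x \<noteq> 0 \<longrightarrow> 0 < inner x (\<Gamma> *v x)"
    and "0 < \<nu>" and "even \<nu>"
    and "\<forall>l\<ge>1. M l \<in> carrier_mat (n l) (n l) \<and> (M l)\<^sup>T = M l"
    and "\<forall>l\<ge>1. sym_pos_def (A l) \<and> loewner_le (A l) (M l)"
    and "0 < C\<^sub>A"
    and "\<forall>l\<ge>1. spectral_norm (msqrt (M l) * (minv (A l) - I l * minv (A (l - 1)) * (I l)\<^sup>T)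
                 * msqrt (M l)) \<le> C\<^sub>A"
    and "\<forall>L. prob_space (\<Omega> L)"
    and "\<forall>L. multivariate_normal (\<Omega> L) (n L) (R L Init)
           (mean_vec (\<Omega> L) (n L) (R L Init)) (cov_mat (\<Omega> L) (n L) (R L Init))"
    and "\<forall>L. max (euclidean_norm (msqrt (A L) *\<^sub>v mean_vec (\<Omega> L) (n L) (R L Init)))
               (spectral_norm (msqrt (A L) * cov_mat (\<Omega> L) (n L) (R L Init) * msqrt (A L))) \<le> C\<^sub>0"
    and "\<forall>L m l k. 1 \<le> l \<and> l \<le> L \<and> k < \<nu> \<longrightarrow>
           multivariate_normal (\<Omega> L) (n l) (R L (Smooth m l k)) (0\<^sub>v (n l)) (M l + (M l)\<^sup>T - A l)"
    and "\<forall>L m. multivariate_normal (\<Omega> L) (n 0) (R L (Coarse m)) (0\<^sub>v (n 0)) (minv (A 0))"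
    and "\<forall>L. prob_space.indep_vars (\<Omega> L) (\<lambda>d. borel_vec (draw_dim n L d)) (R L) (draws \<nu> L)"
  shows
    "(\<forall>K s c\<^sub>0 c\<^sub>1 c\<^sub>2 \<rho>.
        \<rho> < 1 \<and> (\<forall>l\<ge>1. real (n (l - 1)) \<le> \<rho> * real (n l)) \<and>
        cost_model K (stiffness_mat S \<phi> n) I n \<Gamma> s c\<^sub>0 c\<^sub>1 c\<^sub>2 \<longrightarrow>
        (\<exists>C. \<forall>L. 0 < n L \<longrightarrow>
           real (mgmc_cost K (\<nu> div 2) (\<nu> div 2) L) \<le> C * real (n L))) \<and>
     (\<exists>C. \<forall>L. F L \<noteq> 0\<^sub>v (n L) \<longrightarrow> (\<forall>m\<ge>1.
        summable (\<lambda>s. autocorrelation (\<Omega> L) (X L) m (Suc s)) \<and>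
        \<bar>integrated_autocorrelation_time (\<Omega> L) (X L) m\<bar> \<le> C)) \<and>
     (\<exists>C\<^sub>1\<^sub>1 C\<^sub>1\<^sub>2 C\<^sub>2. 0 < C\<^sub>1\<^sub>1 \<and> 0 < C\<^sub>1\<^sub>2 \<and> 0 < C\<^sub>2 \<and> C\<^sub>2 = ln (C\<^sub>A + real \<nu>) - ln C\<^sub>A \<and>
        (\<forall>L m.
          \<bar>prob_space.expectation (\<Omega> L) (X L m) - F L \<bullet> (minv (A L) *\<^sub>v f L)\<bar>
            \<le> C\<^sub>1\<^sub>1 * exp (- C\<^sub>2 * real m) \<and>
          \<bar>prob_space.variance (\<Omega> L) (X L m) - F L \<bullet> (minv (A L) *\<^sub>v F L)\<bar>
            \<le> C\<^sub>1\<^sub>2 * exp (- 2 * C\<^sub>2 * real m))) \<and>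
     (\<forall>W normW \<Psi>.
        subspace W \<and> W \<subseteq> V \<and> is_norm_on W normW \<and>
        (\<exists>C>0. \<forall>g. \<forall>u\<in>V. (\<forall>v\<in>V. energy S u v = inner g v) \<longrightarrow> u \<in> W \<and> normW u \<le> C * norm g) \<and>
        (\<forall>l. 0 \<le> \<Psi> l) \<and> decseq \<Psi> \<and> \<Psi> \<longlonglongrightarrow> 0 \<and>
        (\<forall>l. \<forall>w\<in>W. (INF v\<in>level_space \<phi> n l. energy_norm S (w - v)) \<le> sqrt (\<Psi> l) * normW w) \<longrightarrow>
        (\<forall>(\<Omega>\<^sub>s :: nat \<Rightarrow> 's measure) Z.
          (\<forall>L. prob_space (\<Omega>\<^sub>s L) \<and>
               multivariate_normal (\<Omega>\<^sub>s L) (n L) (Z L) (minv (A L) *\<^sub>v f L) (minv (A L))) \<longrightarrow>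
          weak_conv_m (\<lambda>L. distr (\<Omega>\<^sub>s L) borel (\<lambda>\<omega>. F L \<bullet> Z L \<omega>))
            (gaussian_law (inner \<chi> (posterior_mean D \<A> \<B> \<Gamma> y))
                          (inner \<chi> (posterior_op_inv D \<A> \<B> \<Gamma> \<chi>)))))"
proof -
  note spectral = assms(22) and init_law = assms(24) and init_bound = assms(25)
    and smooth_law = assms(26) and coarse_law = assms(27) and indep = assms(28)
  define \<kappa> where "\<kappa> = \<nu> div 2"
  have \<kappa>: "2 * \<kappa> = \<nu>" "0 < \<kappa>" using assms(17,18) by (auto simp: \<kappa>_def elim: evenE)
  interpret bd: bayesian_discretisation D V \<A> S \<B> \<Gamma> \<phi> n
    by (intro bayesian_discretisation.intro bayesian_problem.intro elliptic_operator.intro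
        bayesian_problem_axioms.intro bayesian_discretisation_axioms.intro)
      (use assms(7-16) in blast)+
  define g where "g = adjoint \<B> (matrix_inv \<Gamma> *v y)"
  have Ac: "A l \<in> carrier_mat (n l) (n l)" "sym_pos_def (A l)" for l
    by (simp_all add: A_def bd.Amat_carrier bd.Amat_sym_pos_def)
  have Ic: "I (Suc l) \<in> carrier_mat (n (Suc l)) (n l)" for l
    by (simp add: I_def bd.prolongation_carrier)
  have Mc: "M (Suc l) \<in> carrier_mat (n (Suc l)) (n (Suc l))" "(M (Suc l))\<^sup>T = M (Suc l)"
    "loewner_le (A (Suc l)) (M (Suc l))" for l
    using assms(19)[rule_format, of "Suc l"] assms(20)[rule_format, of "Suc l"] by auto
  have Fc: "F L \<in> carrier_vec (n L)" and f_eq: "f L = bd.Fvec g L" and fc: "f L \<in> carrier_vec (n L)" for L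
    by (simp_all add: F_def f_def bd.posterior_rhs_eq bd.Fvec_carrier g_def)
  \<comment> \<open>The sandwich bound for M at x = M^-1 w: there M x = w, and x . w is the form of
    M^-1 at w.\<close>
  have approx: "w \<bullet> (minv (A (Suc l)) *\<^sub>v w) -
      ((I (Suc l))\<^sup>T *\<^sub>v w) \<bullet> (minv (A l) *\<^sub>v ((I (Suc l))\<^sup>T *\<^sub>v w))
      \<le> C\<^sub>A * (w \<bullet> (minv (M (Suc l)) *\<^sub>v w))" if w: "w \<in> carrier_vec (n (Suc l))" for l w
  proof -
    let ?l = "Suc l" and ?I = "I (Suc l)"
    interpret sp: spd_splitting "n ?l" "A ?l" "M ?l"
      by unfold_locales (use Ac Mc in auto)
    define E where "E = minv (A ?l) - ?I * minv (A l) * ?I\<^sup>T"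
    define x where "x = minv (M ?l) *\<^sub>v w"
    define z where "z = minv (A l) *\<^sub>v (?I\<^sup>T *\<^sub>v w)"
    have x: "x \<in> carrier_vec (n ?l)" "M ?l *\<^sub>v x = w"
      using minv_mult_vec[OF Mc(1) sp.M_pos_def w] by (auto simp: x_def)
    note inv = sym_pos_def_inverse(1)[OF Ac]
    have It: "?I\<^sup>T \<in> carrier_mat (n l) (n ?l)" using Ic[of l] by simp
    have r: "?I\<^sup>T *\<^sub>v w \<in> carrier_vec (n l)" "z \<in> carrier_vec (n l)"
      using It w inv[of l] by (auto simp: z_def)
    have E: "E \<in> carrier_mat (n ?l) (n ?l)" using It Ic[of l] inv by (auto simp: E_def)
    have "E *\<^sub>v w = minv (A ?l) *\<^sub>v w - (?I * minv (A l) * ?I\<^sup>T) *\<^sub>v w"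
      unfolding E_def using It Ic[of l] inv[of l] inv[of ?l] w
      by (intro minus_mult_distrib_mat_vec[of _ "n ?l" "n ?l"]) auto
    also have "(?I * minv (A l) * ?I\<^sup>T) *\<^sub>v w = ?I *\<^sub>v z"
      using It Ic[of l] inv[of l] w r
      by (simp add: z_def assoc_mult_mat_vec[of _ "n ?l" "n l" _ "n ?l"] assoc_mult_mat_vec[of _ "n ?l" "n l" _ "n l"])
    finally have "w \<bullet> (E *\<^sub>v w) = w \<bullet> (minv (A ?l) *\<^sub>v w) - w \<bullet> (?I *\<^sub>v z)"
      using w inv[of ?l] Ic[of l] r by (simp add: scalar_prod_minus_distrib[of _ "n ?l"])
    also have "w \<bullet> (?I *\<^sub>v z) = (?I\<^sup>T *\<^sub>v w) \<bullet> z"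
      using transpose_vec_mult_scalar[OF Ic r(2) w] by simp
    finally have "w \<bullet> (E *\<^sub>v w) = w \<bullet> (minv (A ?l) *\<^sub>v w) - (?I\<^sup>T *\<^sub>v w) \<bullet> z" .
    moreover have "\<bar>w \<bullet> (E *\<^sub>v w)\<bar> \<le> C\<^sub>A * (x \<bullet> w)"
      using spectral_norm_sandwich[OF Mc(1) sym_pos_def_imp_sym_psd[OF Mc(1) sp.M_pos_def] E _ x(1), of C\<^sub>A]
        spectral[rule_format, of ?l] x(2) by (simp add: E_def)
    ultimately show ?thesis
      using comm_scalar_prod[OF x(1) w] by (simp add: x_def z_def)
  qed
  interpret gh: galerkin_hierarchy n A M I \<kappa> C\<^sub>A
  proof unfold_locales
    show "(I (Suc l) *\<^sub>v x) \<bullet> (A (Suc l) *\<^sub>v (I (Suc l) *\<^sub>v y)) = x \<bullet> (A l *\<^sub>v y)"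
      if "x \<in> carrier_vec (n l)" "y \<in> carrier_vec (n l)" for l x y
      using bd.Amat_galerkin[OF that] by (simp add: A_def I_def)
  qed (use Ac Mc Ic approx assms(21) in auto)
  \<comment> \<open>One instance per finest level L, each on its own probability space but with the
    same \<open>\<kappa>\<close>, \<open>C\<^sub>A\<close> and \<open>C\<^sub>0\<close>; the
    uniformity in L comes from this.\<close>
  have mb: "mgmc_bounded_init n A M I \<kappa> C\<^sub>A (\<Omega> L) L (f L) (R L) C\<^sub>0" for L
  proof -
    interpret prob_space "\<Omega> L" using assms(23) by blast
    note moments = multivariate_normal_moments[OF prob_space_axioms]
    note init = init_law[rule_format, of L]
    have psd: "sym_psd (A L)" by (rule sym_pos_def_imp_sym_psd[OF Ac])
    let ?m = "mean_vec (\<Omega> L) (n L) (R L Init)" and ?C = "cov_mat (\<Omega> L) (n L) (R L Init)"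
    have mC: "?m \<in> carrier_vec (n L)" "?C \<in> carrier_mat (n L) (n L)"
      using init by (auto simp: multivariate_normal_def)
    have bounds: "euclidean_norm (msqrt (A L) *\<^sub>v ?m) \<le> C\<^sub>0" "spectral_norm (msqrt (A L) * ?C * msqrt (A L)) \<le> C\<^sub>0"
      using init_bound[rule_format, of L] by auto
    have C0: "0 \<le> C\<^sub>0" using bounds(1) euclidean_norm_nonneg order.trans by blast
    have smooth: "multivariate_normal (\<Omega> L) (n l) (R L (Smooth m l k)) (0\<^sub>v (n l)) (M l + (M l)\<^sup>T - A l)"
      if "1 \<le> l" "l \<le> L" "k < \<nu>" for m l k
      using smooth_law that by blast
    have coarse: "multivariate_normal (\<Omega> L) (n 0) (R L (Coarse m)) (0\<^sub>v (n 0)) (minv (A 0))" for m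
      using coarse_law by blast
    have sq: "sq_integrable (\<Omega> L) (\<lambda>\<omega>. v \<bullet> R L d \<omega>)"
      if "d \<in> draws \<nu> L" "v \<in> carrier_vec (draw_dim n L d)" for d v
      using that unfolding draws_def
      by (auto simp: draw_dim_def intro: moments(1)[OF init] moments(1)[OF smooth] moments(1)[OF coarse])
    show ?thesis
    proof unfold_locales
      show "centered (\<Omega> L) (n l) (R L (Smooth m l k)) (M l + (M l)\<^sup>T - A l)"
        if "1 \<le> l" "l \<le> L" "k < 2 * \<kappa>" for l k m
        using that \<kappa> by (intro multivariate_normal_centered prob_space_axioms smooth) auto
      show "centered (\<Omega> L) (n 0) (R L (Coarse m)) (minv (A 0))" for m
        by (intro multivariate_normal_centered prob_space_axioms coarse)
      show "R L Init \<omega> \<in> carrier_vec (n L)" if "\<omega> \<in> space (\<Omega> L)" for \<omega>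
        by (rule multivariate_normal_carrier[OF init that])
      show "sq_integrable (\<Omega> L) (\<lambda>\<omega>. v \<bullet> R L Init \<omega>)" if "v \<in> carrier_vec (n L)" for v
        by (rule moments(1)[OF init that])
      show "covariance (\<Omega> L) (\<lambda>\<omega>. v \<bullet> R L d \<omega>) (\<lambda>\<omega>. w \<bullet> R L d' \<omega>) = 0"
        if "d \<in> draws (2 * \<kappa>) L" "d' \<in> draws (2 * \<kappa>) L" "d \<noteq> d'"
          "v \<in> carrier_vec (draw_dim n L d)" "w \<in> carrier_vec (draw_dim n L d')" for d d' v w
        using that sq indep[rule_format, of L] unfolding \<kappa>(1)
        by (intro indep_vars_uncorrelated[where N = "draw_dim n L" and D = "draws \<nu> L"]) auto
      fix u :: "real vec"
      assume u: "u \<in> carrier_vec (n L)"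
      have Au: "A L *\<^sub>v u \<in> carrier_vec (n L)" using u Ac by simp
      have nu: "euclidean_norm (msqrt (A L) *\<^sub>v u) = sqrt (u \<bullet> (A L *\<^sub>v u))"
        by (simp add: euclidean_norm_def msqrt_form[OF Ac(1) psd u u])
      have "expectation (\<lambda>\<omega>. (A L *\<^sub>v u) \<bullet> R L Init \<omega>) = u \<bullet> (A L *\<^sub>v ?m)"
        using moments(2)[OF init Au] symmetric_form_left[OF Ac(1) _ u mC(1)] Ac(2)[of L]
        by (simp add: sym_pos_def_def)
      then have "\<bar>expectation (\<lambda>\<omega>. (A L *\<^sub>v u) \<bullet> R L Init \<omega>)\<bar> \<le>
          sqrt (u \<bullet> (A L *\<^sub>v u)) * euclidean_norm (msqrt (A L) *\<^sub>v ?m)"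
        using psd_form_Cauchy_Schwarz[OF Ac(1) psd u mC(1)] nu by simp
      also have "\<dots> \<le> sqrt (u \<bullet> (A L *\<^sub>v u)) * C\<^sub>0"
        using bounds(1) sym_pos_def_form_nonneg[OF Ac u] by (intro mult_left_mono) auto
      finally show "\<bar>expectation (\<lambda>\<omega>. (A L *\<^sub>v u) \<bullet> R L Init \<omega>)\<bar> \<le> C\<^sub>0 * sqrt (u \<bullet> (A L *\<^sub>v u))"
        by (simp add: mult.commute)
      show "covariance (\<Omega> L) (\<lambda>\<omega>. (A L *\<^sub>v u) \<bullet> R L Init \<omega>) (\<lambda>\<omega>. (A L *\<^sub>v u) \<bullet> R L Init \<omega>)
          \<le> C\<^sub>0 * (u \<bullet> (A L *\<^sub>v u))"
        using moments(3)[OF init Au] spectral_norm_sandwich[OF Ac(1) psd mC(2) bounds(2) u] by simp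
    qed (use fc \<kappa> C0 in auto)
  qed
  have C0: "0 \<le> C\<^sub>0" using mgmc_bounded_init.C\<^sub>0_nonneg[OF mb] .
  let ?K = "1 + 2 * ((1 + C\<^sub>0) / (1 - gh.rate\<^sup>2) * (gh.rate / (1 - gh.rate)))"
  have iact: "summable (\<lambda>s. autocorrelation (\<Omega> L) (X L) m (Suc s)) \<and>
      \<bar>integrated_autocorrelation_time (\<Omega> L) (X L) m\<bar> \<le> ?K" if "F L \<noteq> 0\<^sub>v (n L)" "1 \<le> m" for L m
  proof -
    interpret mb: mgmc_bounded_init n A M I \<kappa> C\<^sub>A "\<Omega> L" L "f L" "R L" C\<^sub>0 by (rule mb)
    have "X L = (\<lambda>m \<omega>. F L \<bullet> mb.chain m \<omega>)"
      unfolding X_def \<theta>_def mb.chain_def by (simp add: \<kappa>_def)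
    then show ?thesis
      using mb.functional_iact[OF Fc that] unfolding mb.iact_bound_def by simp
  qed
  obtain c where c: "0 < c" "\<And>l g. bd.Fvec g l \<bullet> (minv (bd.Amat l) *\<^sub>v bd.Fvec g l) \<le> (c * norm g)\<^sup>2"
    using bd.solve_bound by blast
  define c1 where "c1 = c * norm g"
  define c2 where "c2 = c * norm \<chi>"
  have c12: "0 \<le> c1" "0 \<le> c2" using c(1) by (auto simp: c1_def c2_def)
  have f_bound: "f L \<bullet> (minv (A L) *\<^sub>v f L) \<le> c1\<^sup>2" and F_bound: "F L \<bullet> (minv (A L) *\<^sub>v F L) \<le> c2\<^sup>2" for L
    using c(2)[of g L] c(2)[of \<chi> L] by (simp_all add: f_eq F_def A_def c1_def c2_def)
  define C\<^sub>2 where "C\<^sub>2 = ln (C\<^sub>A + real \<nu>) - ln C\<^sub>A"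
  have "2 * real \<kappa> = real \<nu>" using \<kappa>(1) by linarith
  \<comment> \<open>\<open>C\<^sub>2\<close> is minus the logarithm of the contraction factor, so
    powers of the factor are exactly the exponentials claimed.\<close>
  then have "gh.rate = C\<^sub>A / (C\<^sub>A + real \<nu>)" by (simp only: gh.rate_def)
  also have "\<dots> = exp (ln C\<^sub>A - ln (C\<^sub>A + real \<nu>))"
    using assms(17,21) by (simp add: exp_diff)
  finally have "exp (- C\<^sub>2) = gh.rate" by (simp add: C\<^sub>2_def)
  then have rate: "gh.rate ^ m = exp (- C\<^sub>2 * real m)" for m
    using exp_of_nat2_mult[of "- C\<^sub>2" m] by simp
  \<comment> \<open>The summand 1 keeps both constants positive when c2 = 0, that is when
    \<open>\<chi>\<close> = 0.\<close>
  have conv: "\<bar>prob_space.expectation (\<Omega> L) (X L m) - F L \<bullet> (minv (A L) *\<^sub>v f L)\<bar>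
        \<le> ((C\<^sub>0 + c1) * c2 + 1) * exp (- C\<^sub>2 * real m) \<and>
      \<bar>prob_space.variance (\<Omega> L) (X L m) - F L \<bullet> (minv (A L) *\<^sub>v F L)\<bar>
        \<le> ((1 + C\<^sub>0) * c2\<^sup>2 + 1) * exp (- 2 * C\<^sub>2 * real m)" for L m
  proof -
    interpret mb: mgmc_bounded_init n A M I \<kappa> C\<^sub>A "\<Omega> L" L "f L" "R L" C\<^sub>0 by (rule mb)
    have X: "X L m = (\<lambda>\<omega>. F L \<bullet> mb.chain m \<omega>)"
      unfolding X_def \<theta>_def mb.chain_def by (simp add: \<kappa>_def)
    have sf: "sqrt (f L \<bullet> (minv (A L) *\<^sub>v f L)) \<le> c1" and sF: "sqrt (F L \<bullet> (minv (A L) *\<^sub>v F L)) \<le> c2"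
      using f_bound[of L] F_bound[of L] c12 by (auto intro: real_le_lsqrt)
    have "\<bar>mb.expectation (X L m) - F L \<bullet> (minv (A L) *\<^sub>v f L)\<bar> \<le>
        (C\<^sub>0 + sqrt (f L \<bullet> (minv (A L) *\<^sub>v f L))) * gh.rate ^ m * sqrt (F L \<bullet> (minv (A L) *\<^sub>v F L))"
      unfolding X by (rule mb.functional_expectation[OF Fc])
    also have "\<dots> \<le> (C\<^sub>0 + c1) * gh.rate ^ m * c2"
      using sf sF C0 c12 gh.rate_pos minv_form_nonneg[OF Ac Fc] minv_form_nonneg[OF Ac fc]
      by (intro mult_mono) auto
    also have "\<dots> \<le> ((C\<^sub>0 + c1) * c2 + 1) * gh.rate ^ m"
      using gh.rate_pos by (simp add: algebra_simps)
    finally have 1: "\<bar>mb.expectation (X L m) - F L \<bullet> (minv (A L) *\<^sub>v f L)\<bar> \<le>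
        ((C\<^sub>0 + c1) * c2 + 1) * exp (- C\<^sub>2 * real m)" by (simp only: rate)
    have "\<bar>mb.variance (X L m) - F L \<bullet> (minv (A L) *\<^sub>v F L)\<bar> \<le>
        (1 + C\<^sub>0) * gh.rate ^ (2 * m) * (F L \<bullet> (minv (A L) *\<^sub>v F L))"
      unfolding X by (rule mb.functional_variance[OF Fc])
    also have "\<dots> \<le> (1 + C\<^sub>0) * gh.rate ^ (2 * m) * c2\<^sup>2"
      using F_bound[of L] C0 gh.rate_pos by (intro mult_left_mono) auto
    also have "\<dots> \<le> ((1 + C\<^sub>0) * c2\<^sup>2 + 1) * gh.rate ^ (2 * m)"
      using gh.rate_pos by (simp add: algebra_simps)
    finally have 2: "\<bar>mb.variance (X L m) - F L \<bullet> (minv (A L) *\<^sub>v F L)\<bar> \<le>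
        ((1 + C\<^sub>0) * c2\<^sup>2 + 1) * exp (- 2 * C\<^sub>2 * real m)"
      by (simp only: rate) (simp add: mult_ac)
    show ?thesis using 1 2 by blast
  qed
  have C\<^sub>2_pos: "0 < C\<^sub>2" using assms(17,21) by (simp add: C\<^sub>2_def)
  have C_pos: "0 < (C\<^sub>0 + c1) * c2 + 1" "0 < (1 + C\<^sub>0) * c2\<^sup>2 + 1"
    using C0 c12 by (auto intro!: add_nonneg_pos)
  have weak: "weak_conv_m (\<lambda>L. distr (\<Omega>\<^sub>s L) borel (\<lambda>\<omega>. F L \<bullet> Z L \<omega>))
      (gaussian_law (inner \<chi> (posterior_mean D \<A> \<B> \<Gamma> y)) (inner \<chi> (posterior_op_inv D \<A> \<B> \<Gamma> \<chi>)))"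
    if reg: "\<forall>g. \<forall>u\<in>V. (\<forall>v\<in>V. energy S u v = inner g v) \<longrightarrow> u \<in> W \<and> normW u \<le> C * norm g"
      and \<Psi>: "\<Psi> \<longlonglongrightarrow> 0"
      and best: "\<forall>l. \<forall>w\<in>W. (INF v\<in>level_space \<phi> n l. energy_norm S (w - v)) \<le> sqrt (\<Psi> l) * normW w"
      and Z: "\<forall>L. prob_space (\<Omega>\<^sub>s L) \<and>
        multivariate_normal (\<Omega>\<^sub>s L) (n L) (Z L) (minv (A L) *\<^sub>v f L) (minv (A L))"
    for W normW and \<Psi> :: "nat \<Rightarrow> real" and C and \<Omega>\<^sub>s :: "nat \<Rightarrow> 's measure" and Z
  proof -
    \<comment> \<open>Used at h = g for the mean and at h = \<open>\<chi>\<close> for the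
      variance.\<close>
    have lim: "(\<lambda>L. F L \<bullet> (minv (A L) *\<^sub>v bd.Fvec h L)) \<longlonglongrightarrow> inner \<chi> (bd.post_inv h)" for h
    proof -
      have "(\<lambda>l. inner (bd.galerkin_solution l h) \<chi>) \<longlonglongrightarrow> inner (bd.post_inv h) \<chi>"
        by (rule bd.galerkin_convergence[of W \<Psi> normW]) (use reg best \<Psi> in blast)+
      then show ?thesis by (simp add: F_def A_def bd.Fvec_solve inner_commute)
    qed
    have law: "distr (\<Omega>\<^sub>s L) borel (\<lambda>\<omega>. F L \<bullet> Z L \<omega>) =
        gaussian_law (F L \<bullet> (minv (A L) *\<^sub>v f L)) (F L \<bullet> (minv (A L) *\<^sub>v F L))" for L
      using Z Fc by (simp add: multivariate_normal_def)
    have "weak_conv_m (\<lambda>L. gaussian_law (F L \<bullet> (minv (A L) *\<^sub>v f L)) (F L \<bullet> (minv (A L) *\<^sub>v F L)))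
        (gaussian_law (inner \<chi> (bd.post_inv g)) (inner \<chi> (bd.post_inv \<chi>)))"
      using lim[of g] lim[of \<chi>] minv_form_nonneg[OF Ac Fc]
      by (intro weak_conv_gaussian_law) (auto simp: f_eq F_def)
    then show ?thesis
      by (simp only: law posterior_mean_def bd.post_inv_def g_def)
  qed
  have cost: "\<exists>C. \<forall>L. 0 < n L \<longrightarrow> real (mgmc_cost K (\<nu> div 2) (\<nu> div 2) L) \<le> C * real (n L)"
    if "\<rho> < 1" "\<forall>l\<ge>1. real (n (l - 1)) \<le> \<rho> * real (n l)"
      "cost_model K (stiffness_mat S \<phi> n) I n \<Gamma> s c\<^sub>0 c\<^sub>1 c\<^sub>2" for K s c\<^sub>0 c\<^sub>1 c\<^sub>2 \<rho>
    by (rule mgmc_cost_model_linear[OF that(3,1,2)]) (use Ic in \<open>auto simp: stiffness_mat_def\<close>)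
  show ?thesis
  proof (intro conjI)
    show "\<exists>C\<^sub>1\<^sub>1 C\<^sub>1\<^sub>2 C\<^sub>2. 0 < C\<^sub>1\<^sub>1 \<and> 0 < C\<^sub>1\<^sub>2 \<and> 0 < C\<^sub>2 \<and> C\<^sub>2 = ln (C\<^sub>A + real \<nu>) - ln C\<^sub>A \<and>
        (\<forall>L m.
          \<bar>prob_space.expectation (\<Omega> L) (X L m) - F L \<bullet> (minv (A L) *\<^sub>v f L)\<bar>
            \<le> C\<^sub>1\<^sub>1 * exp (- C\<^sub>2 * real m) \<and>
          \<bar>prob_space.variance (\<Omega> L) (X L m) - F L \<bullet> (minv (A L) *\<^sub>v F L)\<bar>
            \<le> C\<^sub>1\<^sub>2 * exp (- 2 * C\<^sub>2 * real m))"
      by (intro exI[of _ "(C\<^sub>0 + c1) * c2 + 1"] exI[of _ "(1 + C\<^sub>0) * c2\<^sup>2 + 1"] exI[of _ C\<^sub>2] conjI allI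
          C_pos C\<^sub>2_pos conv[THEN conjunct1] conv[THEN conjunct2]) (rule C\<^sub>2_def)
  qed ((use cost iact in blast)+, intro allI impI, elim conjE exE, rule weak)
qed

end
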